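(* Let $E$ be a set, $I\subseteq E\times E$ an irreflexive symmetric relation, and $M(E,I)$ the corresponding free partially commutative monoid. Let $m\geq -1$ be an integer and let $X_m^{\bullet}$ and $X_{m+1}^{\bullet}$ be the right pointed $M(E,I)$-sets defined in the context. Then for every $k\geq 1$ there is an isomorphism of abelian groups $$H_k(X_{m+1}^{\bullet})\;\cong\; H_k(X_m^{\bullet})\oplus H_{k-1}(E,\mathfrak{M}),$$ where $H_{*}(E,\mathfrak{M})$ denotes the homology groups of the simplicial scheme (abstract simplicial complex) $(E,\mathfrak{M})$.
   Context: Free partially commutative monoid: for a set $E$ and an irreflexive symmetric relation $I\subseteq E\times E$, $M(E,I)$ is the monoid with generating set $E$ and relations $ab=ba$ for all $(a,b)\in I$. The $M(E,I)$-sets $X_n^{\bullet}$: for $n\geq 0$, $X_n^{\bullet}=\{x_0,x_1,\dots,x_n,*\}$ is a pointed set with $n+2$ distinct elements and base point $*$, with the right action of $M(E,I)$ determined by $x_i\cdot e=x_{i+1}$ for $0\leq i\leq n-1$, $x_n\cdot e=*$, $*\cdot e=*$, for all $e\in E$. For $n=-1$, $X_{-1}^{\bullet}=\{*\}$ consists of the base point only. Homology: for a right pointed $M(E,I)$-set $X$, let $\mathscr{K}_*(X)$ (also written $(M(E,I)/X)^{op}$) be the small category whose objects are all elements of $X$ (including $*$) and whose morphisms $x\to x'$ are the triples $(x,\mu,x')$ with $\mu\in M(E,I)$ and $x\cdot\mu=x'$. Put $H_k(X)=\varinjlim_k^{\mathscr{K}_*(X)}\Delta\mathbb{Z}$, the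 $k$-th left derived functor of the colimit functor $\varinjlim:\mathrm{Ab}^{\mathscr{K}_*(X)}\to\mathrm{Ab}$ evaluated at the constant functor $\Delta\mathbb{Z}$ (with value $\mathbb{Z}$ on objects and $1_{\mathbb{Z}}$ on morphisms). Simplicial scheme: $(E,\mathfrak{M})$ is the abstract simplicial complex with vertex set $E$ whose simplices are the nonempty finite subsets of $E$ consisting of pairwise commuting generators, i.e. nonempty finite $S\subseteq E$ with $(a,b)\in I$ for all distinct $a,b\in S$.
   Formalization: For k = 1, H_0(E,𝔐) is taken as reduced homology (kernel of the augmentation), since the claim fails with ordinary homology: for E a single point H_1(X_n) = Z for all n while H_0(E,𝔐) = Z; for k ≥ 2 ordinary homology is used as stated. *)

theory Defs
  imports "HOL-Algebra.Free_Abelian_Groups"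
begin

section \<open>Free partially commutative monoids\<close>

inductive_set trace_cong :: "'e set \<Rightarrow> ('e \<times> 'e) set \<Rightarrow> ('e list \<times> 'e list) set"
  for E :: "'e set" and I :: "('e \<times> 'e) set" where
  refl: "w \<in> lists E \<Longrightarrow> (w, w) \<in> trace_cong E I"
| comm: "\<lbrakk>(a, b) \<in> I; a \<in> E; b \<in> E; u \<in> lists E; v \<in> lists E\<rbrakk>
    \<Longrightarrow> (u @ [a, b] @ v, u @ [b, a] @ v) \<in> trace_cong E I"
| sym: "(u, v) \<in> trace_cong E I \<Longrightarrow> (v, u) \<in> trace_cong E I"
| trans: "\<lbrakk>(u, v) \<in> trace_cong E I; (v, w) \<in> trace_cong E I\<rbrakk> \<Longrightarrow> (u, w) \<in> trace_cong E I"

definition trace_monoid :: "'e set \<Rightarrow> ('e \<times> 'e) set \<Rightarrow> 'e list set monoid" where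
  "trace_monoid E I =
     \<lparr>carrier = lists E // trace_cong E I,
      monoid.mult = (\<lambda>U V. \<Union>u\<in>U. \<Union>v\<in>V. trace_cong E I `` {u @ v}),
      one = trace_cong E I `` {[]}\<rparr>"

section \<open>Right pointed sets over a monoid\<close>

record ('x, 'a) rset =
  points :: "'x set"
  base :: 'x
  act :: "'x \<Rightarrow> 'a \<Rightarrow> 'x"

definition right_pointed_set :: "'a monoid \<Rightarrow> ('x, 'a) rset \<Rightarrow> bool" where
  "right_pointed_set M A \<longleftrightarrow>
     base A \<in> points A \<and>
     (\<forall>x\<in>points A. \<forall>p\<in>carrier M. act A x p \<in> points A) \<and>
     (\<forall>x\<in>points A. act A x \<one>\<^bsub>M\<^esub> = x) \<and>
     (\<forall>x\<in>points A. \<forall>p\<in>carrier M. \<forall>q\<in>carrier M.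
        act A x (p \<otimes>\<^bsub>M\<^esub> q) = act A (act A x p) q) \<and>
     (\<forall>p\<in>carrier M. act A (base A) p = base A)"

text \<open>The action of a trace (a class of words) determined by the action of the generators.\<close>

definition trace_action :: "('x \<Rightarrow> 'e \<Rightarrow> 'x) \<Rightarrow> 'x \<Rightarrow> 'e list set \<Rightarrow> 'x" where
  "trace_action \<delta> x p = (THE y. \<exists>w\<in>p. y = foldl \<delta> x w)"

datatype xpoint = Elt nat | Base

fun X_step :: "int \<Rightarrow> xpoint \<Rightarrow> 'e \<Rightarrow> xpoint" where
  "X_step n (Elt i) e = (if int i < n then Elt (Suc i) else Base)"
| "X_step n Base e = Base"

text \<open>For \<open>n = -1\<close> only the base point remains.\<close>

definition X_set :: "int \<Rightarrow> (xpoint, 'e list set) rset" where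
  "X_set n = \<lparr>points = {Elt i |i. int i \<le> n} \<union> {Base}, base = Base,
              act = trace_action (X_step n)\<rparr>"

lemma foldl_X_step_length: "length u = length v \<Longrightarrow> foldl (X_step n) x u = foldl (X_step n) x v"
proof (induction u v arbitrary: x rule: list_induct2)
  case (Cons a u b v)
  have "X_step n x a = X_step n x b" by (cases x) auto
  then show ?case using Cons.IH by simp
qed simp

lemma trace_cong_length: "(u, v) \<in> trace_cong E I \<Longrightarrow> length u = length v"
  by (induction rule: trace_cong.induct) auto

lemma trace_cong_lists: "(u, v) \<in> trace_cong E I \<Longrightarrow> u \<in> lists E \<and> v \<in> lists E"
  by (induction rule: trace_cong.induct) auto

lemma trace_class_carrier: "w \<in> lists E \<Longrightarrow> trace_cong E I `` {w} \<in> carrier (trace_monoid E I)"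
  by (simp add: trace_monoid_def quotientI)

lemma trace_carrierE:
  assumes "p \<in> carrier (trace_monoid E I)"
  obtains w where "w \<in> lists E" "p = trace_cong E I `` {w}"
proof -
  from assms have "p \<in> lists E // trace_cong E I" by (simp add: trace_monoid_def)
  then show thesis by (rule quotientE) (rule that)
qed

lemma trace_cong_append:
  assumes "(u, u') \<in> trace_cong E I" "a \<in> lists E" "b \<in> lists E"
  shows "(a @ u @ b, a @ u' @ b) \<in> trace_cong E I"
  using assms
proof (induction rule: trace_cong.induct)
  case (refl w)
  then show ?case by (intro trace_cong.refl) auto
next
  case (comm c d u v)
  then show ?case using trace_cong.comm[of c d I E "a @ u" "v @ b"] by auto
next
  case (sym u v)
  then show ?case by (blast intro: trace_cong.sym)
next
  case (trans u v w)
  then show ?case using trace_cong.trans by blast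
qed

lemma trace_class_mult:
  assumes "u \<in> lists E" "v \<in> lists E"
  shows "trace_cong E I `` {u} \<otimes>\<^bsub>trace_monoid E I\<^esub> trace_cong E I `` {v}
           = trace_cong E I `` {u @ v}"
proof -
  have "trace_cong E I `` {u' @ v'} = trace_cong E I `` {u @ v}"
    if "(u, u') \<in> trace_cong E I" "(v, v') \<in> trace_cong E I" for u' v'
  proof -
    have "(u @ v, u' @ v) \<in> trace_cong E I"
      using trace_cong_append[OF that(1), of "[]" v] assms by simp
    moreover have "(u' @ v, u' @ v') \<in> trace_cong E I"
      using trace_cong_append[OF that(2), of u' "[]"] trace_cong_lists[OF that(1)] by simp
    ultimately have "(u @ v, u' @ v') \<in> trace_cong E I" by (rule trace_cong.trans)
    then have "((u @ v, w) \<in> trace_cong E I) = ((u' @ v', w) \<in> trace_cong E I)" for w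
      by (metis trace_cong.sym trace_cong.trans)
    then show ?thesis by (intro equalityI subsetI) simp_all
  qed
  then have "(\<Union>v'\<in>trace_cong E I `` {v}. trace_cong E I `` {u' @ v'}) = trace_cong E I `` {u @ v}"
    if "u' \<in> trace_cong E I `` {u}" for u'
    using that trace_cong.refl[OF assms(2)] by (intro UN_constant_eq) (simp_all, blast)
  then show ?thesis
    unfolding trace_monoid_def monoid.simps
    using trace_cong.refl[OF assms(1)] by (intro UN_constant_eq) (simp_all, blast)
qed

lemma monoid_trace_monoid: "monoid (trace_monoid E I)"
proof (rule monoidI)
  show "\<one>\<^bsub>trace_monoid E I\<^esub> \<in> carrier (trace_monoid E I)"
    using trace_class_carrier[of "[]" E I] by (simp add: trace_monoid_def)
  have one: "\<one>\<^bsub>trace_monoid E I\<^esub> = trace_cong E I `` {[]}" by (simp add: trace_monoid_def)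
  fix p assume "p \<in> carrier (trace_monoid E I)"
  then obtain u where u: "u \<in> lists E" "p = trace_cong E I `` {u}" by (rule trace_carrierE)
  show "\<one>\<^bsub>trace_monoid E I\<^esub> \<otimes>\<^bsub>trace_monoid E I\<^esub> p = p"
    "p \<otimes>\<^bsub>trace_monoid E I\<^esub> \<one>\<^bsub>trace_monoid E I\<^esub> = p"
    using u by (simp_all add: one trace_class_mult)
  fix q assume "q \<in> carrier (trace_monoid E I)"
  then obtain v where v: "v \<in> lists E" "q = trace_cong E I `` {v}" by (rule trace_carrierE)
  show "p \<otimes>\<^bsub>trace_monoid E I\<^esub> q \<in> carrier (trace_monoid E I)"
    using u v by (simp add: trace_class_mult trace_class_carrier)
  fix r assume "r \<in> carrier (trace_monoid E I)"
  then obtain w where w: "w \<in> lists E" "r = trace_cong E I `` {w}" by (rule trace_carrierE)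
  show "p \<otimes>\<^bsub>trace_monoid E I\<^esub> q \<otimes>\<^bsub>trace_monoid E I\<^esub> r
      = p \<otimes>\<^bsub>trace_monoid E I\<^esub> (q \<otimes>\<^bsub>trace_monoid E I\<^esub> r)"
    using u v w by (simp add: trace_class_mult)
qed

lemma act_X_set:
  assumes "w \<in> lists E"
  shows "act (X_set n) x (trace_cong E I `` {w}) = foldl (X_step n) x w"
proof -
  have eq: "foldl (X_step n) x u = foldl (X_step n) x w" if "u \<in> trace_cong E I `` {w}" for u
    by (rule foldl_X_step_length) (use that trace_cong_length[of w u E I] in simp)
  have "w \<in> trace_cong E I `` {w}" using assms by (simp add: trace_cong.refl)
  then have "(THE y. \<exists>u\<in>trace_cong E I `` {w}. y = foldl (X_step n) x u) = foldl (X_step n) x w"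
    by (intro the_equality) (blast, metis eq)
  then show ?thesis by (simp add: X_set_def trace_action_def)
qed

lemma right_pointed_set_X_set: "right_pointed_set (trace_monoid E I) (X_set n)"
proof -
  have points: "points (X_set n :: (xpoint, 'a list set) rset) = {Elt i |i. int i \<le> n} \<union> {Base}"
    and base: "base (X_set n :: (xpoint, 'a list set) rset) = Base"
    by (simp_all add: X_set_def)
  have closed: "foldl (X_step n) x w \<in> {Elt i |i. int i \<le> n} \<union> {Base}"
    if "x \<in> {Elt i |i. int i \<le> n} \<union> {Base}" for x and w :: "'a list"
    using that
  proof (induction w arbitrary: x)
    case (Cons e w)
    have "X_step n x e \<in> {Elt i |i. int i \<le> n} \<union> {Base}" by (cases x) auto
    then show ?case using Cons.IH by simp
  qed simp
  have fixed: "foldl (X_step n) Base w = Base" for w :: "'a list" by (induction w) auto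
  have one: "\<one>\<^bsub>trace_monoid E I\<^esub> = trace_cong E I `` {[]}" by (simp add: trace_monoid_def)
  show ?thesis
    unfolding right_pointed_set_def points base
  proof (intro conjI ballI)
    fix x assume x: "x \<in> {Elt i |i. int i \<le> n} \<union> {Base}"
    show "act (X_set n) x \<one>\<^bsub>trace_monoid E I\<^esub> = x" by (simp add: one act_X_set)
    fix p assume "p \<in> carrier (trace_monoid E I)"
    then obtain u where u: "u \<in> lists E" "p = trace_cong E I `` {u}" by (rule trace_carrierE)
    show "act (X_set n) x p \<in> {Elt i |i. int i \<le> n} \<union> {Base}"
      using closed[OF x, of u] u by (simp add: act_X_set)
    fix q assume "q \<in> carrier (trace_monoid E I)"
    then obtain v where v: "v \<in> lists E" "q = trace_cong E I `` {v}" by (rule trace_carrierE)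
    show "act (X_set n) x (p \<otimes>\<^bsub>trace_monoid E I\<^esub> q) = act (X_set n) (act (X_set n) x p) q"
      using u v by (simp add: trace_class_mult act_X_set)
  next
    fix p assume "p \<in> carrier (trace_monoid E I)"
    then obtain u where u: "u \<in> lists E" "p = trace_cong E I `` {u}" by (rule trace_carrierE)
    show "act (X_set n) Base p = Base" using u by (simp add: act_X_set fixed)
  qed simp
qed

section \<open>Small categories and functors to abelian groups\<close>

record ('o, 'a) small_cat =
  Ob :: "'o set"
  Ar :: "'a set"
  Dom :: "'a \<Rightarrow> 'o"
  Cod :: "'a \<Rightarrow> 'o"
  Ident :: "'o \<Rightarrow> 'a"
  Comp :: "'a \<Rightarrow> 'a \<Rightarrow> 'a"  \<comment> \<open>\<open>Comp C g f\<close> is \<open>g\<close> after \<open>f\<close>\<close>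

definition K_cat :: "'a monoid \<Rightarrow> ('x, 'a) rset \<Rightarrow> ('x, 'x \<times> 'a \<times> 'x) small_cat" where
  "K_cat M A =
     \<lparr>Ob = points A,
      Ar = {(x, p, x'). x \<in> points A \<and> p \<in> carrier M \<and> x' \<in> points A \<and> act A x p = x'},
      Dom = (\<lambda>(x, p, x'). x),
      Cod = (\<lambda>(x, p, x'). x'),
      Ident = (\<lambda>x. (x, \<one>\<^bsub>M\<^esub>, x)),
      Comp = (\<lambda>(y, q, z) (x, p, y'). (x, p \<otimes>\<^bsub>M\<^esub> q, z))\<rparr>"

record ('o, 'a, 'g) ab_fun =
  fob :: "'o \<Rightarrow> 'g monoid"
  far :: "'a \<Rightarrow> 'g \<Rightarrow> 'g"

definition ab_functor :: "('o, 'a) small_cat \<Rightarrow> ('o, 'a, 'g) ab_fun \<Rightarrow> bool" where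
  "ab_functor C F \<longleftrightarrow>
     (\<forall>c\<in>Ob C. comm_group (fob F c)) \<and>
     (\<forall>f\<in>Ar C. far F f \<in> hom (fob F (Dom C f)) (fob F (Cod C f))) \<and>
     (\<forall>c\<in>Ob C. \<forall>a\<in>carrier (fob F c). far F (Ident C c) a = a) \<and>
     (\<forall>f\<in>Ar C. \<forall>g\<in>Ar C. Cod C f = Dom C g \<longrightarrow>
        (\<forall>a\<in>carrier (fob F (Dom C f)). far F (Comp C g f) a = far F g (far F f a)))"

definition nat_transf :: "('o, 'a) small_cat \<Rightarrow> ('o, 'a, 'g) ab_fun \<Rightarrow> ('o, 'a, 'h) ab_fun
    \<Rightarrow> ('o \<Rightarrow> 'g \<Rightarrow> 'h) \<Rightarrow> bool" where
  "nat_transf C F G \<eta> \<longleftrightarrow>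
     (\<forall>c\<in>Ob C. \<eta> c \<in> hom (fob F c) (fob G c)) \<and>
     (\<forall>f\<in>Ar C. \<forall>a\<in>carrier (fob F (Dom C f)).
        \<eta> (Cod C f) (far F f a) = far G f (\<eta> (Dom C f) a))"

definition epi_transf :: "('o, 'a) small_cat \<Rightarrow> ('o, 'a, 'g) ab_fun \<Rightarrow> ('o, 'a, 'h) ab_fun
    \<Rightarrow> ('o \<Rightarrow> 'g \<Rightarrow> 'h) \<Rightarrow> bool" where
  "epi_transf C F G \<eta> \<longleftrightarrow>
     nat_transf C F G \<eta> \<and> (\<forall>c\<in>Ob C. \<eta> c ` carrier (fob F c) = carrier (fob G c))"

definition const_int :: "('o, 'a, int) ab_fun" where
  "const_int = \<lparr>fob = (\<lambda>_. integer_group), far = (\<lambda>_ n. n)\<rparr>"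

section \<open>Homology of chain complexes of abelian groups\<close>

text \<open>The differential \<open>d n\<close> goes from \<open>G (Suc n)\<close> to \<open>G n\<close>.\<close>

fun chain_homology :: "(nat \<Rightarrow> 'g monoid) \<Rightarrow> (nat \<Rightarrow> 'g \<Rightarrow> 'g) \<Rightarrow> nat \<Rightarrow> 'g set monoid" where
  "chain_homology G d 0 = G 0 Mod (d 0 ` carrier (G 1))"
| "chain_homology G d (Suc n) =
     (G (Suc n))\<lparr>carrier := kernel (G (Suc n)) (G n) (d n)\<rparr>
       Mod (d (Suc n) ` carrier (G (Suc (Suc n))))"

section \<open>The colimit functor\<close>

text \<open>The colimit of \<open>F\<close> is the direct sum of the values \<open>F c\<close> modulo the subgroup generated by
  all \<open>\<iota> (F f a) - \<iota> a\<close>, where \<open>\<iota>\<close> denotes the inclusions of the summands.\<close>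

definition summand_incl :: "('o, 'a) small_cat \<Rightarrow> ('o, 'a, 'g) ab_fun \<Rightarrow> 'o \<Rightarrow> 'g \<Rightarrow> 'o \<Rightarrow> 'g" where
  "summand_incl C F c a = (\<lambda>c'\<in>Ob C. if c' = c then a else \<one>\<^bsub>fob F c'\<^esub>)"

definition colim_rel :: "('o, 'a) small_cat \<Rightarrow> ('o, 'a, 'g) ab_fun \<Rightarrow> ('o \<Rightarrow> 'g) set" where
  "colim_rel C F =
     (let S = sum_group (Ob C) (fob F) in
      generate S {summand_incl C F (Cod C f) (far F f a)
                    \<otimes>\<^bsub>S\<^esub> inv\<^bsub>S\<^esub> summand_incl C F (Dom C f) a
                  |f a. f \<in> Ar C \<and> a \<in> carrier (fob F (Dom C f))})"

definition colim :: "('o, 'a) small_cat \<Rightarrow> ('o, 'a, 'g) ab_fun \<Rightarrow> ('o \<Rightarrow> 'g) set monoid" where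
  "colim C F = sum_group (Ob C) (fob F) Mod colim_rel C F"

text \<open>The union below is over equal cosets: it is the coset of the image of any representative.\<close>

definition colim_map :: "('o, 'a) small_cat \<Rightarrow> ('o, 'a, 'g) ab_fun \<Rightarrow> ('o, 'a, 'h) ab_fun
    \<Rightarrow> ('o \<Rightarrow> 'g \<Rightarrow> 'h) \<Rightarrow> ('o \<Rightarrow> 'g) set \<Rightarrow> ('o \<Rightarrow> 'h) set" where
  "colim_map C F G \<eta> U =
     (\<Union>u\<in>U. colim_rel C G #>\<^bsub>sum_group (Ob C) (fob G)\<^esub> (\<lambda>c\<in>Ob C. \<eta> c (u c)))"

section \<open>Left derived functors of the colimit\<close>

text \<open>The functor category is formed with the abelian groups whose elements belong to the type
  \<open>'g\<close> of the values of \<open>P\<close>; epimorphisms of functors to abelian groups are the pointwise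
  surjections.\<close>

definition projective_functor :: "('o, 'a) small_cat \<Rightarrow> ('o, 'a, 'g) ab_fun \<Rightarrow> bool" where
  "projective_functor C P \<longleftrightarrow>
     ab_functor C P \<and>
     (\<forall>(A :: ('o, 'a, 'g) ab_fun) (B :: ('o, 'a, 'g) ab_fun) \<pi> \<phi>.
        ab_functor C A \<and> ab_functor C B \<and> epi_transf C A B \<pi> \<and> nat_transf C P B \<phi> \<longrightarrow>
        (\<exists>\<psi>. nat_transf C P A \<psi> \<and> (\<forall>c\<in>Ob C. \<forall>a\<in>carrier (fob P c). \<pi> c (\<psi> c a) = \<phi> c a)))"

definition projective_resolution :: "('o, 'a) small_cat \<Rightarrow> ('o, 'a, 'h) ab_fun
    \<Rightarrow> (nat \<Rightarrow> ('o, 'a, 'g) ab_fun) \<Rightarrow> (nat \<Rightarrow> 'o \<Rightarrow> 'g \<Rightarrow> 'g) \<Rightarrow> ('o \<Rightarrow> 'g \<Rightarrow> 'h) \<Rightarrow> bool" where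
  "projective_resolution C F P d \<epsilon> \<longleftrightarrow>
     (\<forall>n. projective_functor C (P n)) \<and>
     (\<forall>n. nat_transf C (P (Suc n)) (P n) (d n)) \<and>
     epi_transf C (P 0) F \<epsilon> \<and>
     (\<forall>c\<in>Ob C.
        kernel (fob (P 0) c) (fob F c) (\<epsilon> c) = d 0 c ` carrier (fob (P 1) c) \<and>
        (\<forall>n. kernel (fob (P (Suc n)) c) (fob (P n) c) (d n c)
               = d (Suc n) c ` carrier (fob (P (Suc (Suc n))) c)))"

text \<open>The \<open>k\<close>-th left derived functor of the colimit over \<open>C\<close>, evaluated at \<open>F\<close>.  A chosen
  projective resolution is used; as usual another choice gives an isomorphic group.  The elements
  of the groups of the resolution are taken from \<open>'a list \<Rightarrow>\<^sub>0 int\<close>.  This type is infinite and at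
  least as large as the set of arrows, so that the functor category has enough projectives; for
  instance, it contains the bar resolution of a constant functor, which in degree \<open>n\<close> is free on
  strings of \<open>n + 1\<close> arrows.\<close>

definition left_derived_colim :: "('o, 'a) small_cat \<Rightarrow> ('o, 'a, 'h) ab_fun \<Rightarrow> nat
    \<Rightarrow> ('o \<Rightarrow> 'a list \<Rightarrow>\<^sub>0 int) set set monoid" where
  "left_derived_colim C F k =
     (let (P, d, \<epsilon>) =
        (SOME (P :: nat \<Rightarrow> ('o, 'a, 'a list \<Rightarrow>\<^sub>0 int) ab_fun, d, \<epsilon>).
           projective_resolution C F P d \<epsilon>)
      in chain_homology (\<lambda>n. colim C (P n)) (\<lambda>n. colim_map C (P (Suc n)) (P n) (d n)) k)"

definition rset_homology ::
    "'a monoid \<Rightarrow> ('x, 'a) rset \<Rightarrow> nat \<Rightarrow> ('x \<Rightarrow> ('x \<times> 'a \<times> 'x) list \<Rightarrow>\<^sub>0 int) set set monoid" where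
  "rset_homology M A k = left_derived_colim (K_cat M A) const_int k"

section \<open>Homology of simplicial schemes\<close>

definition commuting_simplices :: "'e set \<Rightarrow> ('e \<times> 'e) set \<Rightarrow> 'e set set" where
  "commuting_simplices E I =
     {S. S \<noteq> {} \<and> finite S \<and> S \<subseteq> E \<and> (\<forall>a\<in>S. \<forall>b\<in>S. a \<noteq> b \<longrightarrow> (a, b) \<in> I)}"

definition simplex_chains :: "'e set set \<Rightarrow> nat \<Rightarrow> ('e set \<Rightarrow>\<^sub>0 int) monoid" where
  "simplex_chains K n = free_Abelian_group {S \<in> K. card S = Suc n}"

text \<open>Simplices are oriented by a linear order \<open>r\<close> of the vertices: the face of \<open>v\<^sub>0 < \<dots> < v\<^sub>n\<close>
  opposite to \<open>v\<^sub>i\<close> gets the sign \<open>(-1)\<^sup>i\<close>, where \<open>i\<close> is the number of vertices below \<open>v\<^sub>i\<close>.\<close>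

definition simplex_boundary :: "('e \<times> 'e) set \<Rightarrow> ('e set \<Rightarrow>\<^sub>0 int) \<Rightarrow> ('e set \<Rightarrow>\<^sub>0 int)" where
  "simplex_boundary r =
     frag_extend (\<lambda>S. \<Sum>v\<in>S. frag_cmul ((-1) ^ card {u \<in> S. u \<noteq> v \<and> (u, v) \<in> r}) (frag_of (S - {v})))"

definition simplicial_homology ::
    "('e \<times> 'e) set \<Rightarrow> 'e set set \<Rightarrow> nat \<Rightarrow> ('e set \<Rightarrow>\<^sub>0 int) set monoid" where
  "simplicial_homology r K n = chain_homology (simplex_chains K) (\<lambda>_. simplex_boundary r) n"

definition augmentation :: "('e set \<Rightarrow>\<^sub>0 int) \<Rightarrow> int" where
  "augmentation c = (\<Sum>S\<in>Poly_Mapping.keys c. Poly_Mapping.lookup c S)"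

text \<open>Homology of the complex augmented by \<open>C\<^sub>0 \<rightarrow> \<int>\<close>; only degree 0 is affected.
  This is the version that occurs in the decomposition of \<open>H\<^sub>1\<close>: if \<open>E\<close> has a single element, then
  the nerve of \<open>K_cat\<close> is, up to homotopy, the graph \<open>x\<^sub>0 \<rightarrow> \<dots> \<rightarrow> x\<^sub>n \<rightarrow> *\<close> with a loop at \<open>*\<close>, so
  \<open>H\<^sub>1\<close> is \<open>\<int>\<close> for every \<open>n\<close>, although the unreduced \<open>H\<^sub>0\<close> of a point is \<open>\<int>\<close>.\<close>

fun reduced_simplicial_homology ::
    "('e \<times> 'e) set \<Rightarrow> 'e set set \<Rightarrow> nat \<Rightarrow> ('e set \<Rightarrow>\<^sub>0 int) set monoid" where
  "reduced_simplicial_homology r K 0 =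
     (simplex_chains K 0)\<lparr>carrier := kernel (simplex_chains K 0) integer_group augmentation\<rparr>
       Mod (simplex_boundary r ` carrier (simplex_chains K 1))"
| "reduced_simplicial_homology r K (Suc n) = simplicial_homology r K (Suc n)"

end

theory Submission
  imports Defs
begin

text \<open>The category of a right \<open>M(E, I)\<close>-set \<open>X\<close> has a cubical resolution of the constant functor
  \<open>\<int>\<close>: in degree \<open>n\<close> it is free on the cubes \<open>(x, S, p)\<close> where \<open>S\<close> is a set of \<open>n\<close> initial letters
  of the trace \<open>p\<close> (such letters commute pairwise), and the faces for \<open>e \<in> S\<close> are \<open>(x, S - e, p)\<close> and
  \<open>(x e, S - e, e\<^sup>-\<^sup>1 p)\<close>.  For fixed \<open>x\<close> and \<open>p\<close> the faces of the first kind form the augmented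
  chain complex of a simplex, which is contractible unless \<open>p = 1\<close>, and the faces of the second kind
  shorten \<open>p\<close>; hence the resolution is exact.  Its colimit is free on the pairs \<open>(x, S)\<close> of a point and a
  clique, with boundary \<open>\<Sum>\<^sub>e \<plusminus>((x e, S - e) - (x, S - e))\<close>.

  The set \<open>X\<^sub>m\<close> embeds into \<open>X\<^sub>m\<^sub>+\<^sub>1\<close> by \<open>x\<^sub>i \<mapsto> x\<^sub>i\<^sub>+\<^sub>1\<close>, and the quotient complex is the augmented
  complex of cliques.  The sequence splits on homology because a cycle \<open>c\<close> of cliques lifts to the
  cycle \<open>(x\<^sub>0 - *) \<otimes> c\<close>, and \<open>(x\<^sub>0 - *) \<otimes> \<partial>b\<close> is the boundary of
  \<open>-(x\<^sub>0 + \<dots> + x\<^sub>m\<^sub>+\<^sub>1) \<otimes> b\<close>.\<close>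

text \<open>The derived functor uses a resolution chosen by \<open>SOME\<close>, of which nothing
  else is known, so independence of the resolution is proved within the prescribed value type. The
  cubical resolution must live in that type too, whence the coding of cubes as lists of triples. Its
  terms are projective by unique division: a trace whose initial letters include \<open>S\<close> is
  the product of \<open>S\<close> times exactly one trace, so every cube is the translate of one
  pair of a point and a clique along one arrow. Each term is a sum of representable functors, each
  with colimit the integers. The empty clique sits in degree 0, so the quotient complex is the
  augmented simplicial complex moved up by one degree. This accounts for the index
  \<open>k - 1\<close> and for the reduced group in degree 0. The base point in the lift is a
  correction. A clique boundary placed at x_0 is homologous to its copy at the base point, and that
  copy never bounds unless it is zero, since collapsing all points to the base point is a chain map
  onto a complex with zero boundary. Subtracting it lets boundaries lift to boundaries.\<close>

lemma (in comm_group) comm_group_subgroup: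
  assumes "subgroup H G"
  shows "comm_group (G\<lparr>carrier := H\<rparr>)"
  by (rule group.group_comm_groupI[OF subgroup_imp_group[OF assms]])
    (use subgroup.subset[OF assms] in \<open>auto intro: m_comm\<close>)

section \<open>Homology of complexes of abelian groups\<close>

text \<open>First isomorphism theorem for \<open>f\<close> followed by the projection to
  \<open>H Mod B'\<close>. Surjectivity of \<open>f\<close> is asked only modulo \<open>B'\<close>,
  which is what maps on homology provide.\<close>

lemma FactGroup_isoI:
  assumes G: "comm_group G" and H: "comm_group H" and B: "subgroup B G" and B': "subgroup B' H"
    and f: "f \<in> hom G H"
    and inj: "\<And>a. a \<in> carrier G \<Longrightarrow> f a \<in> B' \<longleftrightarrow> a \<in> B"
    and surj: "\<And>b. b \<in> carrier H \<Longrightarrow> \<exists>a\<in>carrier G. \<exists>c\<in>B'. b = c \<otimes>\<^bsub>H\<^esub> f a"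
  shows "G Mod B \<cong> H Mod B'"
proof -
  interpret G: comm_group G by fact
  interpret H: comm_group H by fact
  have nB': "B' \<lhd> H" by (rule H.subgroup_imp_normal) fact
  interpret Q: group "H Mod B'" by (rule normal.factorgroup_is_group) fact
  have hom: "(\<lambda>a. B' #>\<^bsub>H\<^esub> f a) \<in> hom G (H Mod B')"
    using hom_compose[OF f normal.r_coset_hom_Mod[OF nB']] by (simp add: comp_def)
  interpret h: group_hom G "H Mod B'" "\<lambda>a. B' #>\<^bsub>H\<^esub> f a"
    by unfold_locales (rule hom)
  have fc: "f a \<in> carrier H" if "a \<in> carrier G" for a
    using f that by (auto simp: hom_def)
  have "kernel G (H Mod B') (\<lambda>a. B' #>\<^bsub>H\<^esub> f a) = B"
  proof -
    have "B' #>\<^bsub>H\<^esub> f a = B' \<longleftrightarrow> a \<in> B" if "a \<in> carrier G" for a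
      using inj[OF that] H.coset_join1[OF _ fc[OF that] B'] H.coset_join2[OF fc[OF that] B']
        subgroup.subset[OF B'] by blast
    then show ?thesis
      using subgroup.subset[OF B] by (auto simp: kernel_def)
  qed
  moreover have "(\<lambda>a. B' #>\<^bsub>H\<^esub> f a) ` carrier G = carrier (H Mod B')"
  proof
    show "(\<lambda>a. B' #>\<^bsub>H\<^esub> f a) ` carrier G \<subseteq> carrier (H Mod B')"
      using fc by (auto simp: carrier_FactGroup)
    show "carrier (H Mod B') \<subseteq> (\<lambda>a. B' #>\<^bsub>H\<^esub> f a) ` carrier G"
    proof
      fix X assume "X \<in> carrier (H Mod B')"
      then obtain b where b: "b \<in> carrier H" "X = B' #>\<^bsub>H\<^esub> b" by (auto simp: carrier_FactGroup)
      then obtain a c where ac: "a \<in> carrier G" "c \<in> B'" "b = c \<otimes>\<^bsub>H\<^esub> f a" using surj by blast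
      have "b \<in> B' #>\<^bsub>H\<^esub> f a" using ac by (auto simp: r_coset_def)
      then have "B' #>\<^bsub>H\<^esub> f a = B' #>\<^bsub>H\<^esub> b"
        using H.repr_independence[OF _ fc B'] ac(1) by blast
      then show "X \<in> (\<lambda>a. B' #>\<^bsub>H\<^esub> f a) ` carrier G" using b ac by blast
    qed
  qed
  ultimately show ?thesis using h.FactGroup_iso by simp
qed

definition chain_complex :: "(nat \<Rightarrow> 'g monoid) \<Rightarrow> (nat \<Rightarrow> 'g \<Rightarrow> 'g) \<Rightarrow> bool" where
  "chain_complex G d \<longleftrightarrow>
     (\<forall>n. comm_group (G n)) \<and> (\<forall>n. d n \<in> hom (G (Suc n)) (G n)) \<and>
     (\<forall>n. \<forall>a\<in>carrier (G (Suc (Suc n))). d n (d (Suc n) a) = \<one>\<^bsub>G n\<^esub>)"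

text \<open>The numerator of \<open>chain_homology\<close> in degree \<open>Suc n\<close>: the index
  is one below the degree of the cycles.\<close>

definition cycle_group :: "(nat \<Rightarrow> 'g monoid) \<Rightarrow> (nat \<Rightarrow> 'g \<Rightarrow> 'g) \<Rightarrow> nat \<Rightarrow> 'g monoid" where
  "cycle_group G d n = (G (Suc n))\<lparr>carrier := kernel (G (Suc n)) (G n) (d n)\<rparr>"

lemma chain_homology_Suc:
  "chain_homology G d (Suc n) = cycle_group G d n Mod (d (Suc n) ` carrier (G (Suc (Suc n))))"
  by (simp add: cycle_group_def)

lemma carrier_cycle_group:
  "carrier (cycle_group G d n) = {a \<in> carrier (G (Suc n)). d n a = \<one>\<^bsub>G n\<^esub>}"
  by (simp add: cycle_group_def kernel_def)

lemma mult_cycle_group [simp]: "monoid.mult (cycle_group G d n) = monoid.mult (G (Suc n))"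
  by (simp add: cycle_group_def)

lemma
  assumes "chain_complex G d"
  shows comm_group_cycle_group: "comm_group (cycle_group G d n)"
    and subgroup_boundaries: "subgroup (d (Suc n) ` carrier (G (Suc (Suc n)))) (cycle_group G d n)"
proof -
  interpret comm_group "G i" for i using assms by (simp add: chain_complex_def)
  interpret d: group_hom "G (Suc i)" "G i" "d i" for i
    using assms by unfold_locales (simp add: chain_complex_def)
  show "comm_group (cycle_group G d n)"
    unfolding cycle_group_def by (rule comm_group_subgroup[OF d.subgroup_kernel])
  show "subgroup (d (Suc n) ` carrier (G (Suc (Suc n)))) (cycle_group G d n)"
    unfolding cycle_group_def
    by (rule subgroup_incl[OF d.img_is_subgroup d.subgroup_kernel])
      (use assms in \<open>auto simp: chain_complex_def kernel_def\<close>)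
qed

lemma comm_group_chain_homology:
  assumes "chain_complex G d"
  shows "comm_group (chain_homology G d (Suc n))"
  unfolding chain_homology_Suc
  by (rule comm_group.abelian_FactGroup[OF comm_group_cycle_group[OF assms] subgroup_boundaries[OF assms]])

lemma chain_homology_isoI:
  assumes G: "chain_complex G d" and H: "chain_complex H e"
    and f: "f \<in> hom (cycle_group G d n) (cycle_group H e n)"
    and "\<And>a. a \<in> carrier (cycle_group G d n) \<Longrightarrow>
      f a \<in> e (Suc n) ` carrier (H (Suc (Suc n))) \<longleftrightarrow> a \<in> d (Suc n) ` carrier (G (Suc (Suc n)))"
    and "\<And>b. b \<in> carrier (cycle_group H e n) \<Longrightarrow> \<exists>a\<in>carrier (cycle_group G d n).
      \<exists>c\<in>carrier (H (Suc (Suc n))). b = e (Suc n) c \<otimes>\<^bsub>H (Suc n)\<^esub> f a"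
  shows "chain_homology G d (Suc n) \<cong> chain_homology H e (Suc n)"
  unfolding chain_homology_Suc
  by (rule FactGroup_isoI[OF comm_group_cycle_group[OF G] comm_group_cycle_group[OF H]
        subgroup_boundaries[OF G] subgroup_boundaries[OF H] f])
    (use assms(4,5) in auto)

section \<open>Chain maps and chain homotopies\<close>

definition chain_map :: "(nat \<Rightarrow> 'g monoid) \<Rightarrow> (nat \<Rightarrow> 'g \<Rightarrow> 'g) \<Rightarrow> (nat \<Rightarrow> 'h monoid) \<Rightarrow>
    (nat \<Rightarrow> 'h \<Rightarrow> 'h) \<Rightarrow> (nat \<Rightarrow> 'g \<Rightarrow> 'h) \<Rightarrow> bool" where
  "chain_map G d H e f \<longleftrightarrow>
     (\<forall>n. f n \<in> hom (G n) (H n)) \<and>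
     (\<forall>n. \<forall>a\<in>carrier (G (Suc n)). e n (f (Suc n) a) = f n (d n a))"

text \<open>The relation f - id = ds + sd in multiplicative notation, stated in the positive degrees
  only, since homology is compared in degrees \<open>Suc n\<close>.\<close>

definition homotopic_to_id :: "(nat \<Rightarrow> 'g monoid) \<Rightarrow> (nat \<Rightarrow> 'g \<Rightarrow> 'g) \<Rightarrow> (nat \<Rightarrow> 'g \<Rightarrow> 'g) \<Rightarrow> bool" where
  "homotopic_to_id G d f \<longleftrightarrow>
     (\<exists>s. (\<forall>n. s n \<in> hom (G n) (G (Suc n))) \<and>
       (\<forall>n. \<forall>a\<in>carrier (G (Suc n)).
          f (Suc n) a = d (Suc n) (s (Suc n) a) \<otimes>\<^bsub>G (Suc n)\<^esub> s n (d n a) \<otimes>\<^bsub>G (Suc n)\<^esub> a))"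

lemma chain_map_cycle_group:
  assumes G: "chain_complex G d" and H: "chain_complex H e" and f: "chain_map G d H e f"
  shows "f (Suc n) \<in> hom (cycle_group G d n) (cycle_group H e n)"
proof -
  interpret G: comm_group "G i" for i using G by (simp add: chain_complex_def)
  interpret H: comm_group "H i" for i using H by (simp add: chain_complex_def)
  interpret f: group_hom "G i" "H i" "f i" for i
    using f by unfold_locales (simp add: chain_map_def)
  show ?thesis
    using f by (auto simp: hom_def carrier_cycle_group chain_map_def)
qed

lemma homotopic_to_id_cycle:
  assumes G: "chain_complex G d" and f: "homotopic_to_id G d f"
    and a: "a \<in> carrier (cycle_group G d n)"
  shows "\<exists>c\<in>carrier (G (Suc (Suc n))). f (Suc n) a = d (Suc n) c \<otimes>\<^bsub>G (Suc n)\<^esub> a"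
proof -
  interpret G: comm_group "G i" for i using G by (simp add: chain_complex_def)
  interpret d: group_hom "G (Suc i)" "G i" "d i" for i
    using G by unfold_locales (simp add: chain_complex_def)
  obtain s where s: "\<And>n. s n \<in> hom (G n) (G (Suc n))"
    "\<And>a. a \<in> carrier (G (Suc n)) \<Longrightarrow>
      f (Suc n) a = d (Suc n) (s (Suc n) a) \<otimes>\<^bsub>G (Suc n)\<^esub> s n (d n a) \<otimes>\<^bsub>G (Suc n)\<^esub> a"
    using f unfolding homotopic_to_id_def by blast
  interpret s: group_hom "G i" "G (Suc i)" "s i" for i
    using s(1) by unfold_locales
  have "a \<in> carrier (G (Suc n))" "d n a = \<one>\<^bsub>G n\<^esub>" using a by (simp_all add: carrier_cycle_group)
  then show ?thesis using s(2)[of a] by (intro bexI[of _ "s (Suc n) a"]) auto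
qed

text \<open>Injectivity comes from \<open>gf\<close>: if f a = e b, then a differs by a boundary
  from g (f a) = g (e b) = d (g b). Surjectivity comes from \<open>fg\<close>: a cycle b differs by
  a boundary from f (g b).\<close>

lemma chain_homotopy_equivalence_iso:
  assumes G: "chain_complex G d" and H: "chain_complex H e"
    and f: "chain_map G d H e f" and g: "chain_map H e G d g"
    and gf: "homotopic_to_id G d (\<lambda>n a. g n (f n a))"
    and fg: "homotopic_to_id H e (\<lambda>n a. f n (g n a))"
  shows "chain_homology G d (Suc n) \<cong> chain_homology H e (Suc n)"
proof (rule chain_homology_isoI[OF G H chain_map_cycle_group[OF G H f]])
  interpret G: comm_group "G i" for i using G by (simp add: chain_complex_def)
  interpret H: comm_group "H i" for i using H by (simp add: chain_complex_def)
  interpret d: group_hom "G (Suc i)" "G i" "d i" for i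
    using G by unfold_locales (simp add: chain_complex_def)
  interpret e: group_hom "H (Suc i)" "H i" "e i" for i
    using H by unfold_locales (simp add: chain_complex_def)
  interpret f: group_hom "G i" "H i" "f i" for i
    using f by unfold_locales (simp add: chain_map_def)
  interpret g: group_hom "H i" "G i" "g i" for i
    using g by unfold_locales (simp add: chain_map_def)
  have fd: "e n (f (Suc n) a) = f n (d n a)" if "a \<in> carrier (G (Suc n))" for n a
    using f that by (simp add: chain_map_def)
  have ge: "d n (g (Suc n) a) = g n (e n a)" if "a \<in> carrier (H (Suc n))" for n a
    using g that by (simp add: chain_map_def)
  {
    fix a assume a: "a \<in> carrier (cycle_group G d n)"
    then have aG: "a \<in> carrier (G (Suc n))" by (simp add: carrier_cycle_group)
    show "f (Suc n) a \<in> e (Suc n) ` carrier (H (Suc (Suc n))) \<longleftrightarrow>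
        a \<in> d (Suc n) ` carrier (G (Suc (Suc n)))"
    proof
      assume "a \<in> d (Suc n) ` carrier (G (Suc (Suc n)))"
      then show "f (Suc n) a \<in> e (Suc n) ` carrier (H (Suc (Suc n)))"
        using f.hom_closed by (auto simp: fd[symmetric])
    next
      assume "f (Suc n) a \<in> e (Suc n) ` carrier (H (Suc (Suc n)))"
      then obtain b where b: "b \<in> carrier (H (Suc (Suc n)))" "f (Suc n) a = e (Suc n) b" by blast
      obtain c where c: "c \<in> carrier (G (Suc (Suc n)))"
        "g (Suc n) (f (Suc n) a) = d (Suc n) c \<otimes>\<^bsub>G (Suc n)\<^esub> a"
        using homotopic_to_id_cycle[OF G gf a] by blast
      have "a = inv\<^bsub>G (Suc n)\<^esub> d (Suc n) c \<otimes>\<^bsub>G (Suc n)\<^esub> g (Suc n) (e (Suc n) b)"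
        using c(1) aG unfolding b(2)[symmetric] c(2) by (simp flip: G.m_assoc)
      also have "\<dots> = d (Suc n) (inv\<^bsub>G (Suc (Suc n))\<^esub> c \<otimes>\<^bsub>G (Suc (Suc n))\<^esub> g (Suc (Suc n)) b)"
        using b(1) c(1) by (simp add: ge)
      finally have "a = \<dots>" .
      then show "a \<in> d (Suc n) ` carrier (G (Suc (Suc n)))"
        by (rule image_eqI) (use b c in simp)
    qed
  next
    fix b assume b: "b \<in> carrier (cycle_group H e n)"
    then have bH: "b \<in> carrier (H (Suc n))" by (simp add: carrier_cycle_group)
    have "g (Suc n) b \<in> carrier (cycle_group G d n)"
      using chain_map_cycle_group[OF H G g] b by (auto simp: hom_def)
    moreover obtain c where c: "c \<in> carrier (H (Suc (Suc n)))"
        "f (Suc n) (g (Suc n) b) = e (Suc n) c \<otimes>\<^bsub>H (Suc n)\<^esub> b"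
      using homotopic_to_id_cycle[OF H fg b] by blast
    moreover have "b = e (Suc n) (inv\<^bsub>H (Suc (Suc n))\<^esub> c) \<otimes>\<^bsub>H (Suc n)\<^esub> f (Suc n) (g (Suc n) b)"
      using c(1) bH unfolding c(2) by (simp flip: H.m_assoc)
    ultimately show "\<exists>a\<in>carrier (cycle_group G d n). \<exists>c\<in>carrier (H (Suc (Suc n))).
        b = e (Suc n) c \<otimes>\<^bsub>H (Suc n)\<^esub> f (Suc n) a"
      using c(1) H.inv_closed by blast
  }
qed

lemma homotopic_to_id_self:
  assumes G: "chain_complex G d" and f: "\<And>n a. a \<in> carrier (G n) \<Longrightarrow> f n a = a"
  shows "homotopic_to_id G d f"
  unfolding homotopic_to_id_def
proof (intro exI[of _ "\<lambda>n _. \<one>\<^bsub>G (Suc n)\<^esub>"] conjI allI ballI)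
  interpret G: comm_group "G i" for i using G by (simp add: chain_complex_def)
  interpret d: group_hom "G (Suc i)" "G i" "d i" for i
    using G by unfold_locales (simp add: chain_complex_def)
  show "(\<lambda>_. \<one>\<^bsub>G (Suc n)\<^esub>) \<in> hom (G n) (G (Suc n))" for n
    by (auto simp: hom_def)
  fix n a assume "a \<in> carrier (G (Suc n))"
  then show "f (Suc n) a = d (Suc n) \<one>\<^bsub>G (Suc (Suc n))\<^esub> \<otimes>\<^bsub>G (Suc n)\<^esub> \<one>\<^bsub>G (Suc n)\<^esub> \<otimes>\<^bsub>G (Suc n)\<^esub> a"
    by (simp add: f)
qed

text \<open>That \<open>e\<close> squares to zero is concluded rather than assumed: it is
  transported along the isomorphisms. The boundary of cells will get this property from the colimit
  complex in this way.\<close>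

lemma chain_homology_isomorphic_complexes:
  assumes G: "chain_complex G d" and H: "\<And>n. comm_group (H n)" and e: "\<And>n. e n \<in> hom (H (Suc n)) (H n)"
    and f: "\<And>n. f n \<in> iso (G n) (H n)"
    and fd: "\<And>n a. a \<in> carrier (G (Suc n)) \<Longrightarrow> f n (d n a) = e n (f (Suc n) a)"
  shows "chain_complex H e" and "chain_homology G d (Suc k) \<cong> chain_homology H e (Suc k)"
proof -
  interpret G: comm_group "G i" for i using G by (simp add: chain_complex_def)
  interpret d: group_hom "G (Suc i)" "G i" "d i" for i
    using G by unfold_locales (simp add: chain_complex_def)
  let ?g = "\<lambda>n. inv_into (carrier (G n)) (f n)"
  have g: "?g n \<in> iso (H n) (G n)" for n by (rule G.iso_set_sym[OF f])
  have fg: "f n (?g n b) = b" and gc: "?g n b \<in> carrier (G n)" if "b \<in> carrier (H n)" for n b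
    using f[of n] that by (auto simp: iso_def bij_betw_def intro: f_inv_into_f inv_into_into)
  have gf: "?g n (f n a) = a" if "a \<in> carrier (G n)" for n a
    using f[of n] that by (simp add: iso_def bij_betw_def)
  have eg: "e n b = f n (d n (?g (Suc n) b))" if "b \<in> carrier (H (Suc n))" for n b
    using fd[OF gc[OF that]] fg[OF that] by simp
  have "e n (e (Suc n) b) = \<one>\<^bsub>H n\<^esub>" if b: "b \<in> carrier (H (Suc (Suc n)))" for n b
  proof -
    have "e n (e (Suc n) b) = f n (d n (d (Suc n) (?g (Suc (Suc n)) b)))"
      using fd[OF d.hom_closed[OF gc[OF b]]] eg[OF b] by simp
    also have "d n (d (Suc n) (?g (Suc (Suc n)) b)) = \<one>\<^bsub>G n\<^esub>"
      using G gc[OF b] by (simp add: chain_complex_def)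
    also have "f n \<one>\<^bsub>G n\<^esub> = \<one>\<^bsub>H n\<^esub>"
      by (rule hom_one[OF iso_imp_homomorphism[OF f] G.is_group]) (use H in \<open>simp add: comm_group_def\<close>)
    finally show ?thesis .
  qed
  then show cH: "chain_complex H e" using H e by (simp add: chain_complex_def)
  show "chain_homology G d (Suc k) \<cong> chain_homology H e (Suc k)"
  proof (rule chain_homotopy_equivalence_iso[OF G cH, where f = f and g = ?g])
    show "chain_map G d H e f"
      using iso_imp_homomorphism[OF f] fd by (simp add: chain_map_def)
    show "chain_map H e G d ?g"
      using iso_imp_homomorphism[OF g] eg gf d.hom_closed[OF gc] by (simp add: chain_map_def)
  qed (use gf fg in \<open>simp_all add: homotopic_to_id_self[OF G] homotopic_to_id_self[OF cH]\<close>)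
qed

section \<open>Functoriality of the colimit\<close>

definition has_endpoints :: "('o, 'a) small_cat \<Rightarrow> bool" where
  "has_endpoints C \<longleftrightarrow> (\<forall>f\<in>Ar C. Dom C f \<in> Ob C \<and> Cod C f \<in> Ob C)"

definition sum_map :: "('o, 'a) small_cat \<Rightarrow> ('o \<Rightarrow> 'g \<Rightarrow> 'h) \<Rightarrow> ('o \<Rightarrow> 'g) \<Rightarrow> 'o \<Rightarrow> 'h" where
  "sum_map C \<eta> u = (\<lambda>c\<in>Ob C. \<eta> c (u c))"

lemma comm_group_sum_group:
  assumes "\<And>i. i \<in> I \<Longrightarrow> comm_group (G i)"
  shows "comm_group (sum_group I G)"
proof -
  have gp: "group (G i)" if "i \<in> I" for i using assms[OF that] by (simp add: comm_group_def)
  show ?thesis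
  proof (rule group.group_comm_groupI)
    show "group (sum_group I G)" using gp by (rule sum_group)
    fix x y assume "x \<in> carrier (sum_group I G)" "y \<in> carrier (sum_group I G)"
    then have "x i \<in> carrier (G i)" "y i \<in> carrier (G i)" if "i \<in> I" for i
      using that gp by (auto simp: carrier_sum_group)
    then show "x \<otimes>\<^bsub>sum_group I G\<^esub> y = y \<otimes>\<^bsub>sum_group I G\<^esub> x"
      using comm_monoid.m_comm[OF comm_group.axioms(1)[OF assms]] by (auto intro!: restrict_ext)
  qed
qed

lemma sum_map_hom:
  assumes F: "\<And>c. c \<in> Ob C \<Longrightarrow> group (F c)" and G: "\<And>c. c \<in> Ob C \<Longrightarrow> group (G c)"
    and \<eta>: "\<And>c. c \<in> Ob C \<Longrightarrow> \<eta> c \<in> hom (F c) (G c)"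
  shows "sum_map C \<eta> \<in> hom (sum_group (Ob C) F) (sum_group (Ob C) G)"
proof (rule homI)
  have one: "\<eta> c \<one>\<^bsub>F c\<^esub> = \<one>\<^bsub>G c\<^esub>" if "c \<in> Ob C" for c
    using hom_one[OF \<eta> F G] that by blast
  fix u assume "u \<in> carrier (sum_group (Ob C) F)"
  then have u: "u \<in> (\<Pi>\<^sub>E i\<in>Ob C. carrier (F i))" "finite {i \<in> Ob C. u i \<noteq> \<one>\<^bsub>F i\<^esub>}"
    using F by (auto simp: carrier_sum_group)
  have "finite {i \<in> Ob C. sum_map C \<eta> u i \<noteq> \<one>\<^bsub>G i\<^esub>}"
    by (rule finite_subset[OF _ u(2)]) (auto simp: sum_map_def one)
  then show "sum_map C \<eta> u \<in> carrier (sum_group (Ob C) G)"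
    using u(1) \<eta> G by (auto simp: carrier_sum_group sum_map_def hom_def PiE_iff Pi_iff)
  fix v assume "v \<in> carrier (sum_group (Ob C) F)"
  then have v: "v \<in> (\<Pi>\<^sub>E i\<in>Ob C. carrier (F i))" using F by (auto simp: carrier_sum_group)
  show "sum_map C \<eta> (u \<otimes>\<^bsub>sum_group (Ob C) F\<^esub> v) =
      sum_map C \<eta> u \<otimes>\<^bsub>sum_group (Ob C) G\<^esub> sum_map C \<eta> v"
    using u(1) v hom_mult[OF \<eta>] by (auto simp: sum_map_def PiE_iff intro!: restrict_ext)
qed

abbreviation big_sum :: "('o, 'a) small_cat \<Rightarrow> ('o, 'a, 'g) ab_fun \<Rightarrow> ('o \<Rightarrow> 'g) monoid" where
  "big_sum C F \<equiv> sum_group (Ob C) (fob F)"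

lemma ab_functor_group: "ab_functor C F \<Longrightarrow> c \<in> Ob C \<Longrightarrow> group (fob F c)"
  by (simp add: ab_functor_def comm_group_def)

lemma ab_functor_sum: "ab_functor C F \<Longrightarrow> comm_group (big_sum C F)"
  by (rule comm_group_sum_group) (simp add: ab_functor_def)

lemma summand_incl_closed:
  assumes "ab_functor C F" "c \<in> Ob C" "a \<in> carrier (fob F c)"
  shows "summand_incl C F c a \<in> carrier (big_sum C F)"
proof -
  have "finite {i \<in> Ob C. summand_incl C F c a i \<noteq> \<one>\<^bsub>fob F i\<^esub>}"
    by (rule finite_subset[of _ "{c}"]) (auto simp: summand_incl_def)
  moreover have "\<one>\<^bsub>fob F i\<^esub> \<in> carrier (fob F i)" if "i \<in> Ob C" for i
    by (rule monoid.one_closed[OF group.is_monoid[OF ab_functor_group[OF assms(1) that]]])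
  then have "summand_incl C F c a \<in> (\<Pi>\<^sub>E i\<in>Ob C. carrier (fob F i))"
    using assms by (auto simp: summand_incl_def)
  ultimately show ?thesis using ab_functor_group[OF assms(1)] by (simp add: carrier_sum_group)
qed

lemma far_closed:
  "ab_functor C F \<Longrightarrow> f \<in> Ar C \<Longrightarrow> a \<in> carrier (fob F (Dom C f)) \<Longrightarrow>
    far F f a \<in> carrier (fob F (Cod C f))"
  by (auto simp: ab_functor_def hom_def)

lemma
  assumes C: "has_endpoints C" and F: "ab_functor C F"
  shows colim_rel_subgroup: "subgroup (colim_rel C F) (big_sum C F)"
    and comm_group_colim: "comm_group (colim C F)"
proof -
  interpret S: comm_group "big_sum C F" by (rule ab_functor_sum[OF F])
  show sub: "subgroup (colim_rel C F) (big_sum C F)"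
    unfolding colim_rel_def Let_def
    by (rule S.generate_is_subgroup)
      (use C far_closed[OF F] in \<open>auto simp: has_endpoints_def
         simp del: mult_sum_group inv_sum_group intro!: S.m_closed S.inv_closed summand_incl_closed[OF F]\<close>)
  show "comm_group (colim C F)"
    unfolding colim_def by (rule S.abelian_FactGroup[OF sub])
qed

lemma nat_transf_hom: "nat_transf C F G \<eta> \<Longrightarrow> c \<in> Ob C \<Longrightarrow> \<eta> c \<in> hom (fob F c) (fob G c)"
  by (simp add: nat_transf_def)

lemma nat_transf_closed:
  "nat_transf C F G \<eta> \<Longrightarrow> c \<in> Ob C \<Longrightarrow> a \<in> carrier (fob F c) \<Longrightarrow> \<eta> c a \<in> carrier (fob G c)"
  by (auto simp: nat_transf_def hom_def)

lemma nat_transf_naturality: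
  "nat_transf C F G \<eta> \<Longrightarrow> f \<in> Ar C \<Longrightarrow> a \<in> carrier (fob F (Dom C f)) \<Longrightarrow>
    \<eta> (Cod C f) (far F f a) = far G f (\<eta> (Dom C f) a)"
  by (simp add: nat_transf_def)

lemma nat_transf_one:
  "ab_functor C F \<Longrightarrow> ab_functor C G \<Longrightarrow> nat_transf C F G \<eta> \<Longrightarrow> c \<in> Ob C \<Longrightarrow>
    \<eta> c \<one>\<^bsub>fob F c\<^esub> = \<one>\<^bsub>fob G c\<^esub>"
  by (meson ab_functor_group hom_one nat_transf_hom)

lemma nat_transf_sum_hom:
  assumes "ab_functor C F" "ab_functor C G" "nat_transf C F G \<eta>"
  shows "sum_map C \<eta> \<in> hom (big_sum C F) (big_sum C G)"
  by (rule sum_map_hom[OF ab_functor_group[OF assms(1)] ab_functor_group[OF assms(2)]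
        nat_transf_hom[OF assms(3)]])

lemma group_hom_sum_map:
  assumes "ab_functor C F" "ab_functor C G" "nat_transf C F G \<eta>"
  shows "group_hom (big_sum C F) (big_sum C G) (sum_map C \<eta>)"
  using ab_functor_sum[OF assms(1)] ab_functor_sum[OF assms(2)] nat_transf_sum_hom[OF assms]
  by (simp add: group_hom_def group_hom_axioms_def comm_group_def)

lemma sum_map_summand_incl:
  assumes "ab_functor C F" "ab_functor C G" "nat_transf C F G \<eta>"
  shows "sum_map C \<eta> (summand_incl C F c a) = summand_incl C G c (\<eta> c a)"
  using nat_transf_one[OF assms] by (auto simp: sum_map_def summand_incl_def intro!: restrict_ext)

text \<open>By naturality the generating relation for an arrow \<open>f\<close> and an element
  \<open>a\<close> goes to the relation for the same arrow and the image of
  \<open>a\<close>.\<close>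

lemma sum_map_colim_rel:
  assumes C: "has_endpoints C"
    and F: "ab_functor C F" and G: "ab_functor C G" and \<eta>: "nat_transf C F G \<eta>"
  shows "sum_map C \<eta> ` colim_rel C F \<subseteq> colim_rel C G"
proof -
  let ?S = "big_sum C F" and ?T = "big_sum C G"
  interpret h: group_hom ?S ?T "sum_map C \<eta>" by (rule group_hom_sum_map[OF F G \<eta>])
  let ?R = "{summand_incl C F (Cod C f) (far F f a) \<otimes>\<^bsub>?S\<^esub> inv\<^bsub>?S\<^esub> summand_incl C F (Dom C f) a
                  |f a. f \<in> Ar C \<and> a \<in> carrier (fob F (Dom C f))}"
  have R: "?R \<subseteq> carrier ?S"
    using C far_closed[OF F] by (auto simp: has_endpoints_def
         simp del: mult_sum_group inv_sum_group intro!: h.G.m_closed h.G.inv_closed summand_incl_closed[OF F])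
  have "sum_map C \<eta> ` ?R \<subseteq> {summand_incl C G (Cod C f) (far G f a) \<otimes>\<^bsub>?T\<^esub>
      inv\<^bsub>?T\<^esub> summand_incl C G (Dom C f) a |f a. f \<in> Ar C \<and> a \<in> carrier (fob G (Dom C f))}"
    (is "_ \<subseteq> ?R'")
  proof
    fix y assume "y \<in> sum_map C \<eta> ` ?R"
    then obtain f a where fa: "f \<in> Ar C" "a \<in> carrier (fob F (Dom C f))"
      "y = sum_map C \<eta> (summand_incl C F (Cod C f) (far F f a) \<otimes>\<^bsub>?S\<^esub> inv\<^bsub>?S\<^esub> summand_incl C F (Dom C f) a)"
      by blast
    have o: "Dom C f \<in> Ob C" "Cod C f \<in> Ob C" using C fa(1) by (auto simp: has_endpoints_def)
    have "y = summand_incl C G (Cod C f) (far G f (\<eta> (Dom C f) a)) \<otimes>\<^bsub>?T\<^esub>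
        inv\<^bsub>?T\<^esub> summand_incl C G (Dom C f) (\<eta> (Dom C f) a)"
      unfolding fa(3)
      using summand_incl_closed[OF F o(1) fa(2)] summand_incl_closed[OF F o(2) far_closed[OF F fa(1,2)]]
      by (simp add: sum_map_summand_incl[OF F G \<eta>] nat_transf_naturality[OF \<eta> fa(1,2)]
          del: mult_sum_group inv_sum_group)
    then show "y \<in> ?R'" using fa nat_transf_closed[OF \<eta> o(1) fa(2)] by blast
  qed
  then show ?thesis
    unfolding colim_rel_def Let_def h.generate_img[OF R, symmetric] by (rule h.H.mono_generate)
qed

text \<open>All representatives of a coset have images in one coset, so the union in
  \<open>colim_map\<close> collapses. From here on \<open>colim_map\<close> is computed on
  representatives.\<close>

lemma colim_map_coset:
  assumes C: "has_endpoints C"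
    and F: "ab_functor C F" and G: "ab_functor C G" and \<eta>: "nat_transf C F G \<eta>"
    and u: "u \<in> carrier (big_sum C F)"
  shows "colim_map C F G \<eta> (colim_rel C F #>\<^bsub>big_sum C F\<^esub> u) =
    colim_rel C G #>\<^bsub>big_sum C G\<^esub> sum_map C \<eta> u"
proof -
  let ?S = "big_sum C F" and ?T = "big_sum C G"
  interpret h: group_hom ?S ?T "sum_map C \<eta>" by (rule group_hom_sum_map[OF F G \<eta>])
  have eq: "colim_rel C G #>\<^bsub>?T\<^esub> sum_map C \<eta> v = colim_rel C G #>\<^bsub>?T\<^esub> sum_map C \<eta> u"
    if v: "v \<in> colim_rel C F #>\<^bsub>?S\<^esub> u" for v
  proof -
    obtain w where w: "w \<in> colim_rel C F" "v = w \<otimes>\<^bsub>?S\<^esub> u"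
      using v unfolding r_coset_def by blast
    have "w \<in> carrier ?S" using w(1) subgroup.subset[OF colim_rel_subgroup[OF C F]] by blast
    then have "sum_map C \<eta> v = sum_map C \<eta> w \<otimes>\<^bsub>?T\<^esub> sum_map C \<eta> u"
      unfolding w(2) using u by (rule h.hom_mult)
    moreover have "sum_map C \<eta> w \<in> colim_rel C G"
      using sum_map_colim_rel[OF C F G \<eta>] w(1) by blast
    ultimately have "sum_map C \<eta> v \<in> colim_rel C G #>\<^bsub>?T\<^esub> sum_map C \<eta> u"
      unfolding r_coset_def by blast
    then show ?thesis
      using h.H.repr_independence[OF _ h.hom_closed[OF u] colim_rel_subgroup[OF C G]] by simp
  qed
  have self: "u \<in> colim_rel C F #>\<^bsub>?S\<^esub> u"
    by (rule h.G.rcos_self[OF u colim_rel_subgroup[OF C F]])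
  show ?thesis
    unfolding colim_map_def sum_map_def[of C \<eta>, symmetric]
    by (intro UN_constant_eq[OF self] ballI eq)
qed

lemma carrier_colimE:
  assumes "x \<in> carrier (colim C F)"
  obtains u where "u \<in> carrier (big_sum C F)"
    "x = colim_rel C F #>\<^bsub>big_sum C F\<^esub> u"
  using assms by (auto simp: colim_def carrier_FactGroup)

lemma coset_in_colim:
  "u \<in> carrier (big_sum C F) \<Longrightarrow>
    colim_rel C F #>\<^bsub>big_sum C F\<^esub> u \<in> carrier (colim C F)"
  by (auto simp: colim_def carrier_FactGroup)

lemma mult_colim_cosets:
  assumes "has_endpoints C" "ab_functor C F"
    "u \<in> carrier (big_sum C F)" "v \<in> carrier (big_sum C F)"
  shows "(colim_rel C F #>\<^bsub>big_sum C F\<^esub> u) \<otimes>\<^bsub>colim C F\<^esub>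
      (colim_rel C F #>\<^bsub>big_sum C F\<^esub> v) =
    colim_rel C F #>\<^bsub>big_sum C F\<^esub> (u \<otimes>\<^bsub>big_sum C F\<^esub> v)"
proof -
  interpret S: comm_group "big_sum C F" by (rule ab_functor_sum[OF assms(2)])
  interpret N: normal "colim_rel C F" "big_sum C F"
    by (rule S.subgroup_imp_normal[OF colim_rel_subgroup[OF assms(1,2)]])
  show ?thesis unfolding colim_def mult_FactGroup by (rule N.rcos_sum[OF assms(3,4)])
qed

lemma colim_map_hom:
  assumes C: "has_endpoints C"
    and F: "ab_functor C F" and G: "ab_functor C G" and \<eta>: "nat_transf C F G \<eta>"
  shows "colim_map C F G \<eta> \<in> hom (colim C F) (colim C G)"
proof (rule homI)
  let ?S = "big_sum C F" and ?T = "big_sum C G"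
  interpret h: group_hom ?S ?T "sum_map C \<eta>" by (rule group_hom_sum_map[OF F G \<eta>])
  fix x assume "x \<in> carrier (colim C F)"
  then obtain u where u: "u \<in> carrier ?S" "x = colim_rel C F #>\<^bsub>?S\<^esub> u" by (rule carrier_colimE)
  show "colim_map C F G \<eta> x \<in> carrier (colim C G)"
    unfolding u(2) colim_map_coset[OF C F G \<eta> u(1)] by (rule coset_in_colim[OF h.hom_closed[OF u(1)]])
  fix y assume "y \<in> carrier (colim C F)"
  then obtain v where v: "v \<in> carrier ?S" "y = colim_rel C F #>\<^bsub>?S\<^esub> v" by (rule carrier_colimE)
  show "colim_map C F G \<eta> (x \<otimes>\<^bsub>colim C F\<^esub> y) =
      colim_map C F G \<eta> x \<otimes>\<^bsub>colim C G\<^esub> colim_map C F G \<eta> y"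
    unfolding u(2) v(2) mult_colim_cosets[OF C F u(1) v(1)] colim_map_coset[OF C F G \<eta> u(1)]
      colim_map_coset[OF C F G \<eta> v(1)] colim_map_coset[OF C F G \<eta> h.G.m_closed[OF u(1) v(1)]]
      mult_colim_cosets[OF C G h.hom_closed[OF u(1)] h.hom_closed[OF v(1)]] h.hom_mult[OF u(1) v(1)] ..
qed

section \<open>The colimit as an additive functor of natural transformations\<close>

lemma sum_group_component:
  "ab_functor C F \<Longrightarrow> u \<in> carrier (big_sum C F) \<Longrightarrow> c \<in> Ob C \<Longrightarrow> u c \<in> carrier (fob F c)"
  by (auto simp: carrier_sum_group ab_functor_group)

lemma colim_map_cong:
  assumes C: "has_endpoints C"
    and F: "ab_functor C F" and G: "ab_functor C G"
    and \<eta>: "nat_transf C F G \<eta>" and \<theta>: "nat_transf C F G \<theta>"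
    and eq: "\<And>c a. c \<in> Ob C \<Longrightarrow> a \<in> carrier (fob F c) \<Longrightarrow> \<eta> c a = \<theta> c a"
    and x: "x \<in> carrier (colim C F)"
  shows "colim_map C F G \<eta> x = colim_map C F G \<theta> x"
proof -
  obtain u where u: "u \<in> carrier (big_sum C F)"
    "x = colim_rel C F #>\<^bsub>big_sum C F\<^esub> u" using x by (rule carrier_colimE)
  have "sum_map C \<eta> u = sum_map C \<theta> u"
    using eq sum_group_component[OF F u(1)] by (auto simp: sum_map_def intro!: restrict_ext)
  then show ?thesis
    unfolding u(2) colim_map_coset[OF C F G \<eta> u(1)] colim_map_coset[OF C F G \<theta> u(1)] by simp
qed

lemma colim_map_id:
  assumes C: "has_endpoints C" and F: "ab_functor C F"
    and \<eta>: "nat_transf C F F \<eta>"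
    and eq: "\<And>c a. c \<in> Ob C \<Longrightarrow> a \<in> carrier (fob F c) \<Longrightarrow> \<eta> c a = a"
    and x: "x \<in> carrier (colim C F)"
  shows "colim_map C F F \<eta> x = x"
proof -
  obtain u where u: "u \<in> carrier (big_sum C F)"
    "x = colim_rel C F #>\<^bsub>big_sum C F\<^esub> u" using x by (rule carrier_colimE)
  have "u \<in> extensional (Ob C)" using u(1) ab_functor_group[OF F] by (auto simp: carrier_sum_group PiE_def)
  then have "sum_map C \<eta> u = u"
    using eq sum_group_component[OF F u(1)] by (auto simp: sum_map_def fun_eq_iff extensional_def)
  then show ?thesis
    unfolding u(2) colim_map_coset[OF C F F \<eta> u(1)] by simp
qed

lemma nat_transf_comp:
  assumes \<eta>: "nat_transf C F G \<eta>" and \<theta>: "nat_transf C G H \<theta>" and C: "has_endpoints C"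
  shows "nat_transf C F H (\<lambda>c a. \<theta> c (\<eta> c a))"
  unfolding nat_transf_def
proof (intro conjI ballI)
  fix c assume "c \<in> Ob C"
  then show "(\<lambda>a. \<theta> c (\<eta> c a)) \<in> hom (fob F c) (fob H c)"
    using hom_compose[OF nat_transf_hom[OF \<eta>] nat_transf_hom[OF \<theta>]] by (simp add: comp_def)
next
  fix f a assume f: "f \<in> Ar C" and a: "a \<in> carrier (fob F (Dom C f))"
  have "Dom C f \<in> Ob C" using C f by (simp add: has_endpoints_def)
  then show "\<theta> (Cod C f) (\<eta> (Cod C f) (far F f a)) = far H f (\<theta> (Dom C f) (\<eta> (Dom C f) a))"
    using nat_transf_naturality[OF \<eta> f a] nat_transf_naturality[OF \<theta> f nat_transf_closed[OF \<eta> _ a]]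
    by simp
qed

lemma colim_map_comp:
  assumes C: "has_endpoints C"
    and F: "ab_functor C F" and G: "ab_functor C G" and H: "ab_functor C H"
    and \<eta>: "nat_transf C F G \<eta>" and \<theta>: "nat_transf C G H \<theta>"
    and x: "x \<in> carrier (colim C F)"
  shows "colim_map C G H \<theta> (colim_map C F G \<eta> x) = colim_map C F H (\<lambda>c a. \<theta> c (\<eta> c a)) x"
proof -
  obtain u where u: "u \<in> carrier (big_sum C F)"
    "x = colim_rel C F #>\<^bsub>big_sum C F\<^esub> u" using x by (rule carrier_colimE)
  have v: "sum_map C \<eta> u \<in> carrier (big_sum C G)"
    using nat_transf_sum_hom[OF F G \<eta>] u(1) by (auto simp: hom_def)
  have "sum_map C \<theta> (sum_map C \<eta> u) = sum_map C (\<lambda>c a. \<theta> c (\<eta> c a)) u"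
    by (auto simp: sum_map_def intro!: restrict_ext)
  then show ?thesis
    unfolding u(2) colim_map_coset[OF C F G \<eta> u(1)] colim_map_coset[OF C G H \<theta> v]
      colim_map_coset[OF C F H nat_transf_comp[OF \<eta> \<theta> C] u(1)] by simp
qed

lemma nat_transf_mult:
  assumes C: "has_endpoints C" and G: "ab_functor C G"
    and \<eta>: "nat_transf C F G \<eta>" and \<theta>: "nat_transf C F G \<theta>"
  shows "nat_transf C F G (\<lambda>c a. \<eta> c a \<otimes>\<^bsub>fob G c\<^esub> \<theta> c a)"
  unfolding nat_transf_def
proof (intro conjI ballI)
  fix c assume c: "c \<in> Ob C"
  interpret G: comm_group "fob G c" using G c by (simp add: ab_functor_def)
  show "(\<lambda>a. \<eta> c a \<otimes>\<^bsub>fob G c\<^esub> \<theta> c a) \<in> hom (fob F c) (fob G c)"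
    by (rule G.hom_group_mult[OF nat_transf_hom[OF \<eta> c] nat_transf_hom[OF \<theta> c]])
next
  fix f a assume f: "f \<in> Ar C" and a: "a \<in> carrier (fob F (Dom C f))"
  have D: "Dom C f \<in> Ob C" using C f by (simp add: has_endpoints_def)
  have "far G f \<in> hom (fob G (Dom C f)) (fob G (Cod C f))" using G f by (simp add: ab_functor_def)
  from hom_mult[OF this nat_transf_closed[OF \<eta> D a] nat_transf_closed[OF \<theta> D a]]
  show "\<eta> (Cod C f) (far F f a) \<otimes>\<^bsub>fob G (Cod C f)\<^esub> \<theta> (Cod C f) (far F f a) =
      far G f (\<eta> (Dom C f) a \<otimes>\<^bsub>fob G (Dom C f)\<^esub> \<theta> (Dom C f) a)"
    using nat_transf_naturality[OF \<eta> f a] nat_transf_naturality[OF \<theta> f a] by simp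
qed

lemma colim_map_mult:
  assumes C: "has_endpoints C"
    and F: "ab_functor C F" and G: "ab_functor C G"
    and \<eta>: "nat_transf C F G \<eta>" and \<theta>: "nat_transf C F G \<theta>"
    and x: "x \<in> carrier (colim C F)"
  shows "colim_map C F G (\<lambda>c a. \<eta> c a \<otimes>\<^bsub>fob G c\<^esub> \<theta> c a) x =
    colim_map C F G \<eta> x \<otimes>\<^bsub>colim C G\<^esub> colim_map C F G \<theta> x"
proof -
  obtain u where u: "u \<in> carrier (big_sum C F)"
    "x = colim_rel C F #>\<^bsub>big_sum C F\<^esub> u" using x by (rule carrier_colimE)
  have v: "sum_map C \<eta> u \<in> carrier (big_sum C G)"
    using nat_transf_sum_hom[OF F G \<eta>] u(1) by (auto simp: hom_def)
  have w: "sum_map C \<theta> u \<in> carrier (big_sum C G)"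
    using nat_transf_sum_hom[OF F G \<theta>] u(1) by (auto simp: hom_def)
  have "sum_map C (\<lambda>c a. \<eta> c a \<otimes>\<^bsub>fob G c\<^esub> \<theta> c a) u =
      sum_map C \<eta> u \<otimes>\<^bsub>big_sum C G\<^esub> sum_map C \<theta> u"
    by (auto simp: sum_map_def intro!: restrict_ext)
  then show ?thesis
    unfolding u(2) colim_map_coset[OF C F G \<eta> u(1)] colim_map_coset[OF C F G \<theta> u(1)]
      colim_map_coset[OF C F G nat_transf_mult[OF C G \<eta> \<theta>] u(1)] mult_colim_cosets[OF C G v w]
    by simp
qed

lemma nat_transf_inv:
  assumes C: "has_endpoints C" and F: "ab_functor C F" and G: "ab_functor C G"
    and \<eta>: "nat_transf C F G \<eta>"
  shows "nat_transf C F G (\<lambda>c a. inv\<^bsub>fob G c\<^esub> (\<eta> c a))"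
  unfolding nat_transf_def
proof (intro conjI ballI)
  fix c assume c: "c \<in> Ob C"
  interpret G: comm_group "fob G c" using G c by (simp add: ab_functor_def)
  show "(\<lambda>a. inv\<^bsub>fob G c\<^esub> (\<eta> c a)) \<in> hom (fob F c) (fob G c)"
    using nat_transf_hom[OF \<eta> c] by (auto simp: hom_def Pi_iff G.inv_mult)
next
  fix f a assume f: "f \<in> Ar C" and a: "a \<in> carrier (fob F (Dom C f))"
  have D: "Dom C f \<in> Ob C" "Cod C f \<in> Ob C" using C f by (auto simp: has_endpoints_def)
  interpret group_hom "fob G (Dom C f)" "fob G (Cod C f)" "far G f"
    using G f D by (simp add: ab_functor_def comm_group_def group_hom_def group_hom_axioms_def)
  show "inv\<^bsub>fob G (Cod C f)\<^esub> \<eta> (Cod C f) (far F f a) = far G f (inv\<^bsub>fob G (Dom C f)\<^esub> \<eta> (Dom C f) a)"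
    using nat_transf_naturality[OF \<eta> f a] nat_transf_closed[OF \<eta> D(1) a] by simp
qed

section \<open>Independence of the projective resolution\<close>

text \<open>Projectivity speaks of epimorphisms, whereas \<open>d\<close> need not be one. Replacing
  \<open>B\<close> by the image \<open>J\<close> of \<open>d\<close>, a subfunctor through which
  \<open>\<phi>\<close> factors by \<open>img\<close>, turns \<open>d\<close> into an epimorphism
  onto \<open>J\<close>.\<close>

lemma projective_functor_lift:
  fixes P A B :: "('o, 'a, 'g) ab_fun"
  assumes C: "has_endpoints C" and P: "projective_functor C P"
    and A: "ab_functor C A" and B: "ab_functor C B"
    and d: "nat_transf C A B d" and \<phi>: "nat_transf C P B \<phi>"
    and img: "\<And>c a. c \<in> Ob C \<Longrightarrow> a \<in> carrier (fob P c) \<Longrightarrow> \<phi> c a \<in> d c ` carrier (fob A c)"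
  shows "\<exists>\<psi>. nat_transf C P A \<psi> \<and> (\<forall>c\<in>Ob C. \<forall>a\<in>carrier (fob P c). d c (\<psi> c a) = \<phi> c a)"
proof -
  define J :: "('o, 'a, 'g) ab_fun" where
    "J = \<lparr>fob = \<lambda>c. (fob B c)\<lparr>carrier := d c ` carrier (fob A c)\<rparr>, far = far B\<rparr>"
  have fobJ: "fob J c = (fob B c)\<lparr>carrier := d c ` carrier (fob A c)\<rparr>" and farJ: "far J = far B" for c
    by (simp_all add: J_def)
  have carJ: "carrier (fob J c) = d c ` carrier (fob A c)" for c by (simp add: fobJ)
  have sub: "d c a \<in> carrier (fob B c)" if "c \<in> Ob C" "a \<in> carrier (fob A c)" for c a
    using nat_transf_closed[OF d that] .
  have J: "ab_functor C J"
    unfolding ab_functor_def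
  proof (intro conjI ballI impI)
    fix c assume c: "c \<in> Ob C"
    interpret B: comm_group "fob B c" using B c by (simp add: ab_functor_def)
    interpret h: group_hom "fob A c" "fob B c" "d c"
      using ab_functor_group[OF A c] nat_transf_hom[OF d c]
      by (simp add: group_hom_def group_hom_axioms_def B.is_group)
    show "comm_group (fob J c)"
      unfolding fobJ by (rule B.comm_group_subgroup[OF h.img_is_subgroup])
    fix a assume "a \<in> carrier (fob J c)"
    then have "a \<in> carrier (fob B c)" using sub[OF c] by (auto simp: carJ)
    then show "far J (Ident C c) a = a" using B c by (simp add: ab_functor_def farJ)
  next
    fix f assume f: "f \<in> Ar C"
    then have o: "Dom C f \<in> Ob C" "Cod C f \<in> Ob C" using C by (auto simp: has_endpoints_def)
    have "far B f (d (Dom C f) a) \<in> d (Cod C f) ` carrier (fob A (Cod C f))"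
      if "a \<in> carrier (fob A (Dom C f))" for a
      unfolding nat_transf_naturality[OF d f that, symmetric] using far_closed[OF A f that] by blast
    moreover have "far B f \<in> hom (fob B (Dom C f)) (fob B (Cod C f))"
      using B f by (simp add: ab_functor_def)
    ultimately show "far J f \<in> hom (fob J (Dom C f)) (fob J (Cod C f))"
      using sub[OF o(1)] by (auto simp: hom_def fobJ farJ)
    fix g a assume "g \<in> Ar C" "Cod C f = Dom C g" "a \<in> carrier (fob J (Dom C f))"
    moreover from this have "a \<in> carrier (fob B (Dom C f))" using sub[OF o(1)] by (auto simp: carJ)
    ultimately show "far J (Comp C g f) a = far J g (far J f a)"
      using B f by (simp add: ab_functor_def farJ)
  qed
  have "nat_transf C A J d"
    using d by (auto simp: nat_transf_def hom_def fobJ farJ)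
  then have "epi_transf C A J d" by (simp add: epi_transf_def fobJ)
  moreover have "nat_transf C P J \<phi>"
    using \<phi> img by (auto simp: nat_transf_def hom_def fobJ farJ)
  ultimately show ?thesis using P A J unfolding projective_functor_def by blast
qed

lemma projective_functor_lift_const_int:
  fixes P A :: "('o, 'a, 'b \<Rightarrow>\<^sub>0 int) ab_fun"
  assumes C: "has_endpoints C" and P: "projective_functor C P"
    and A: "ab_functor C A"
    and \<epsilon>: "epi_transf C A const_int \<epsilon>" and \<phi>: "nat_transf C P const_int \<phi>"
  shows "\<exists>\<psi>. nat_transf C P A \<psi> \<and> (\<forall>c\<in>Ob C. \<forall>a\<in>carrier (fob P c). \<epsilon> c (\<psi> c a) = \<phi> c a)"
proof -
  \<comment> \<open>Projectivity only concerns functors with values in the type \<open>'b \<Rightarrow>\<^sub>0 int\<close>, so the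
    integers are replaced by the multiples of a basis element.\<close>
  define j :: "int \<Rightarrow> ('b \<Rightarrow>\<^sub>0 int)" where "j n = frag_cmul n (frag_of undefined)" for n
  define B :: "('o, 'a, 'b \<Rightarrow>\<^sub>0 int) ab_fun" where
    "B = \<lparr>fob = \<lambda>_. free_Abelian_group {undefined}, far = \<lambda>_ x. x\<rparr>"
  have inj: "j m = j n \<Longrightarrow> m = n" for m n
    by (metis j_def frag_cmul_diff_distrib eq_iff_diff_eq_0 frag_cmul_eq_0_iff frag_of_nonzero)
  have B: "ab_functor C B"
    by (auto simp: ab_functor_def B_def abelian_free_Abelian_group hom_def)
  have j: "nat_transf C F B (\<lambda>c a. j (\<eta> c a))" if "nat_transf C F const_int \<eta>"
    for F :: "('o, 'a, 'b \<Rightarrow>\<^sub>0 int) ab_fun" and \<eta>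
    using that by (auto simp: nat_transf_def hom_def B_def const_int_def j_def frag_cmul_distrib)
  have e: "nat_transf C A const_int \<epsilon>" using \<epsilon> by (simp add: epi_transf_def)
  have "j (\<phi> c a) \<in> (\<lambda>a. j (\<epsilon> c a)) ` carrier (fob A c)"
    if "c \<in> Ob C" "a \<in> carrier (fob P c)" for c a
  proof -
    have "\<phi> c a \<in> \<epsilon> c ` carrier (fob A c)"
      using \<epsilon> that(1) by (simp add: epi_transf_def const_int_def)
    then show ?thesis by auto
  qed
  from projective_functor_lift[OF C P A B j[OF e] j[OF \<phi>] this]
  show ?thesis using inj by blast
qed

lemma projective_resolutionD:
  assumes "projective_resolution C F P d \<epsilon>"
  shows "projective_functor C (P n)" "ab_functor C (P n)" "nat_transf C (P (Suc n)) (P n) (d n)"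
    "epi_transf C (P 0) F \<epsilon>" "nat_transf C (P 0) F \<epsilon>"
    "c \<in> Ob C \<Longrightarrow> kernel (fob (P 0) c) (fob F c) (\<epsilon> c) = d 0 c ` carrier (fob (P 1) c)"
    "c \<in> Ob C \<Longrightarrow> kernel (fob (P (Suc n)) c) (fob (P n) c) (d n c)
        = d (Suc n) c ` carrier (fob (P (Suc (Suc n))) c)"
proof -
  show P: "projective_functor C (P n)" using assms by (simp add: projective_resolution_def)
  then show "ab_functor C (P n)" by (simp add: projective_functor_def)
qed (use assms in \<open>simp_all add: projective_resolution_def epi_transf_def\<close>)

lemma projective_resolution_dd:
  assumes "projective_resolution C F P d \<epsilon>" "c \<in> Ob C"
  shows "a \<in> carrier (fob (P (Suc (Suc n))) c) \<Longrightarrow> d n c (d (Suc n) c a) = \<one>\<^bsub>fob (P n) c\<^esub>"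
    and "a \<in> carrier (fob (P 1) c) \<Longrightarrow> \<epsilon> c (d 0 c a) = \<one>\<^bsub>fob F c\<^esub>"
proof -
  assume "a \<in> carrier (fob (P (Suc (Suc n))) c)"
  then have "d (Suc n) c a \<in> kernel (fob (P (Suc n)) c) (fob (P n) c) (d n c)"
    unfolding projective_resolutionD(7)[OF assms] by (rule imageI)
  then show "d n c (d (Suc n) c a) = \<one>\<^bsub>fob (P n) c\<^esub>" by (simp add: kernel_def)
next
  assume "a \<in> carrier (fob (P 1) c)"
  then have "d 0 c a \<in> kernel (fob (P 0) c) (fob F c) (\<epsilon> c)"
    unfolding projective_resolutionD(6)[OF assms] by (rule imageI)
  then show "\<epsilon> c (d 0 c a) = \<one>\<^bsub>fob F c\<^esub>" by (simp add: kernel_def)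
qed

lemma fob_const_int: "fob const_int c = integer_group"
  by (simp add: const_int_def)

lemma projective_resolution_comparison:
  fixes P Q :: "nat \<Rightarrow> ('o, 'a, 'b \<Rightarrow>\<^sub>0 int) ab_fun"
  assumes C: "has_endpoints C"
    and P: "projective_resolution C const_int P d \<epsilon>" and Q: "projective_resolution C const_int Q e \<theta>"
  shows "\<exists>f. (\<forall>n. nat_transf C (P n) (Q n) (f n)) \<and>
    (\<forall>c\<in>Ob C. \<forall>a\<in>carrier (fob (P 0) c). \<theta> c (f 0 c a) = \<epsilon> c a) \<and>
    (\<forall>n. \<forall>c\<in>Ob C. \<forall>a\<in>carrier (fob (P (Suc n)) c). e n c (f (Suc n) c a) = f n c (d n c a))"
proof -
  note Pd = projective_resolutionD[OF P] and Qd = projective_resolutionD[OF Q]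
  \<comment> \<open>The invariant of the recursion. Its last conjunct is the condition under which
    the next component can be lifted; compatibility with the augmentations is recorded at the bottom
    only, where it starts the recursion.\<close>
  let ?R = "\<lambda>n f. nat_transf C (P n) (Q n) f \<and>
    (n = 0 \<longrightarrow> (\<forall>c\<in>Ob C. \<forall>a\<in>carrier (fob (P 0) c). \<theta> c (f c a) = \<epsilon> c a)) \<and>
    (\<forall>c\<in>Ob C. \<forall>a\<in>carrier (fob (P (Suc n)) c). f c (d n c a) \<in> e n c ` carrier (fob (Q (Suc n)) c))"
  let ?S = "\<lambda>n f g. \<forall>c\<in>Ob C. \<forall>a\<in>carrier (fob (P (Suc n)) c). e n c (g c a) = f c (d n c a)"
  have "\<exists>f. \<forall>n. ?R n (f n) \<and> ?S n (f n) (f (Suc n))"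
  proof (rule dependent_nat_choice)
    obtain f where f: "nat_transf C (P 0) (Q 0) f"
      "\<And>c a. c \<in> Ob C \<Longrightarrow> a \<in> carrier (fob (P 0) c) \<Longrightarrow> \<theta> c (f c a) = \<epsilon> c a"
      using projective_functor_lift_const_int[OF C Pd(1) Qd(2) Qd(4) Pd(5)] by blast
    have "f c (d 0 c a) \<in> e 0 c ` carrier (fob (Q (Suc 0)) c)"
      if c: "c \<in> Ob C" and a: "a \<in> carrier (fob (P (Suc 0)) c)" for c a
    proof -
      have da: "d 0 c a \<in> carrier (fob (P 0) c)" by (rule nat_transf_closed[OF Pd(3) c a])
      have "f c (d 0 c a) \<in> kernel (fob (Q 0) c) integer_group (\<theta> c)"
        using nat_transf_closed[OF f(1) c da] f(2)[OF c da] projective_resolution_dd(2)[OF P c] a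
        by (simp add: kernel_def fob_const_int)
      then show ?thesis using Qd(6)[OF c] by (simp add: fob_const_int)
    qed
    with f show "\<exists>f. ?R 0 f" by blast
  next
    fix f n assume f: "?R n f"
    have lift: "\<exists>g. nat_transf C (P (Suc n)) (Q (Suc n)) g \<and>
        (\<forall>c\<in>Ob C. \<forall>a\<in>carrier (fob (P (Suc n)) c). e n c (g c a) = f c (d n c a))"
      by (rule projective_functor_lift[OF C Pd(1) Qd(2) Qd(2) Qd(3) nat_transf_comp[OF Pd(3) _ C]])
        (use f in auto)
    then obtain g where g: "nat_transf C (P (Suc n)) (Q (Suc n)) g"
      "\<And>c a. c \<in> Ob C \<Longrightarrow> a \<in> carrier (fob (P (Suc n)) c) \<Longrightarrow> e n c (g c a) = f c (d n c a)"
      by blast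
    have "g c (d (Suc n) c a) \<in> e (Suc n) c ` carrier (fob (Q (Suc (Suc n))) c)"
      if c: "c \<in> Ob C" and a: "a \<in> carrier (fob (P (Suc (Suc n))) c)" for c a
    proof -
      have da: "d (Suc n) c a \<in> carrier (fob (P (Suc n)) c)" by (rule nat_transf_closed[OF Pd(3) c a])
      have "f c (d n c (d (Suc n) c a)) = \<one>\<^bsub>fob (Q n) c\<^esub>"
        unfolding projective_resolution_dd(1)[OF P c a] using f nat_transf_one[OF Pd(2) Qd(2) _ c] by blast
      then have "g c (d (Suc n) c a) \<in> kernel (fob (Q (Suc n)) c) (fob (Q n) c) (e n c)"
        using nat_transf_closed[OF g(1) c da] g(2)[OF c da] by (simp add: kernel_def)
      then show ?thesis using Qd(7)[OF c] by simp
    qed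
    with g show "\<exists>g. ?R (Suc n) g \<and> ?S n f g" by blast
  qed
  then obtain f where f: "\<And>n. ?R n (f n) \<and> ?S n (f n) (f (Suc n))" by blast
  show ?thesis
  proof (intro exI[of _ f] conjI allI)
    show "\<forall>c\<in>Ob C. \<forall>a\<in>carrier (fob (P 0) c). \<theta> c (f 0 c a) = \<epsilon> c a" using f[of 0] by blast
  qed (use f in blast)+
qed

text \<open>The homotopy is built for h = f - id, which covers zero on \<open>const_int\<close>:
  each s is obtained by lifting h - sd along d, which is possible because h - sd takes values in
  cycles.\<close>

lemma projective_resolution_homotopy:
  fixes P :: "nat \<Rightarrow> ('o, 'a, 'b \<Rightarrow>\<^sub>0 int) ab_fun"
  assumes C: "has_endpoints C"
    and P: "projective_resolution C const_int P d \<epsilon>"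
    and f: "\<And>n. nat_transf C (P n) (P n) (f n)"
    and f0: "\<And>c a. c \<in> Ob C \<Longrightarrow> a \<in> carrier (fob (P 0) c) \<Longrightarrow> \<epsilon> c (f 0 c a) = \<epsilon> c a"
    and fd: "\<And>n c a. c \<in> Ob C \<Longrightarrow> a \<in> carrier (fob (P (Suc n)) c) \<Longrightarrow>
      d n c (f (Suc n) c a) = f n c (d n c a)"
  shows "\<exists>s. (\<forall>n. nat_transf C (P n) (P (Suc n)) (s n)) \<and>
    (\<forall>n. \<forall>c\<in>Ob C. \<forall>a\<in>carrier (fob (P (Suc n)) c). f (Suc n) c a =
       d (Suc n) c (s (Suc n) c a) \<otimes>\<^bsub>fob (P (Suc n)) c\<^esub> s n c (d n c a) \<otimes>\<^bsub>fob (P (Suc n)) c\<^esub> a)"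
proof -
  note Pd = projective_resolutionD[OF P]
  have id: "nat_transf C F F (\<lambda>c a. a)" for F :: "('o, 'a, 'b \<Rightarrow>\<^sub>0 int) ab_fun"
    by (auto simp: nat_transf_def hom_def)
  define h where "h n c a = f n c a \<otimes>\<^bsub>fob (P n) c\<^esub> inv\<^bsub>fob (P n) c\<^esub> a" for n c a
  have h: "nat_transf C (P n) (P n) (h n)" for n
    unfolding h_def
    by (rule nat_transf_mult[OF C Pd(2) f nat_transf_inv[OF C Pd(2) Pd(2) id]])
  have cg: "comm_group (fob (P n) c)" if "c \<in> Ob C" for c n
    using Pd(2) that by (auto simp: ab_functor_def)
  have gh: "group_hom (fob (P (Suc n)) c) (fob (P n) c) (d n c)" if "c \<in> Ob C" for c n
    using cg[OF that] nat_transf_hom[OF Pd(3) that]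
    by (simp add: group_hom_def group_hom_axioms_def comm_group_def)
  have hd: "d n c (h (Suc n) c a) = h n c (d n c a)"
    if c: "c \<in> Ob C" and a: "a \<in> carrier (fob (P (Suc n)) c)" for n c a
  proof -
    interpret d: group_hom "fob (P (Suc n)) c" "fob (P n) c" "d n c" by (rule gh[OF c])
    show ?thesis
      using a fd[OF c a] nat_transf_closed[OF f c a] by (simp add: h_def)
  qed
  have \<epsilon>h: "\<epsilon> c (h 0 c a) = \<one>\<^bsub>fob const_int c\<^esub>"
    if c: "c \<in> Ob C" and a: "a \<in> carrier (fob (P 0) c)" for c a
  proof -
    interpret d: group_hom "fob (P 0) c" integer_group "\<epsilon> c"
      using cg[OF c] nat_transf_hom[OF Pd(5) c]
      by (simp add: group_hom_def group_hom_axioms_def comm_group_def fob_const_int)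
    show ?thesis
      using a f0[OF c a] nat_transf_closed[OF f c a] by (simp add: h_def fob_const_int)
  qed
  \<comment> \<open>That d s agrees with h on boundaries is exactly what makes h - sd a cycle in the
    next degree.\<close>
  let ?R = "\<lambda>n s. nat_transf C (P n) (P (Suc n)) s \<and>
    (\<forall>c\<in>Ob C. \<forall>a\<in>carrier (fob (P (Suc n)) c). d n c (s c (d n c a)) = h n c (d n c a))"
  let ?S = "\<lambda>n s t. \<forall>c\<in>Ob C. \<forall>a\<in>carrier (fob (P (Suc n)) c). d (Suc n) c (t c a) =
      h (Suc n) c a \<otimes>\<^bsub>fob (P (Suc n)) c\<^esub> inv\<^bsub>fob (P (Suc n)) c\<^esub> s c (d n c a)"
  have "\<exists>s. \<forall>n. ?R n (s n) \<and> ?S n (s n) (s (Suc n))"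
  proof (rule dependent_nat_choice)
    have "\<exists>s. nat_transf C (P 0) (P (Suc 0)) s \<and>
        (\<forall>c\<in>Ob C. \<forall>a\<in>carrier (fob (P 0) c). d 0 c (s c a) = h 0 c a)"
    proof (rule projective_functor_lift[OF C Pd(1) Pd(2) Pd(2) Pd(3) h])
      fix c a assume c: "c \<in> Ob C" and a: "a \<in> carrier (fob (P 0) c)"
      have "h 0 c a \<in> kernel (fob (P 0) c) integer_group (\<epsilon> c)"
        using \<epsilon>h[OF c a] nat_transf_closed[OF h c a] by (simp add: kernel_def fob_const_int)
      then show "h 0 c a \<in> d 0 c ` carrier (fob (P (Suc 0)) c)"
        using Pd(6)[OF c] by (simp add: fob_const_int)
    qed
    then show "\<exists>s. ?R 0 s" using nat_transf_closed[OF Pd(3)] by blast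
  next
    fix s n assume s: "?R n s"
    let ?k = "\<lambda>c a. h (Suc n) c a \<otimes>\<^bsub>fob (P (Suc n)) c\<^esub> inv\<^bsub>fob (P (Suc n)) c\<^esub> s c (d n c a)"
    have sn: "nat_transf C (P n) (P (Suc n)) s" using s by blast
    have sd: "nat_transf C (P (Suc n)) (P (Suc n)) (\<lambda>c a. s c (d n c a))"
      by (rule nat_transf_comp[OF Pd(3) sn C])
    have k: "nat_transf C (P (Suc n)) (P (Suc n)) ?k"
      by (rule nat_transf_mult[OF C Pd(2) h nat_transf_inv[OF C Pd(2) Pd(2) sd]])
    have "\<exists>t. nat_transf C (P (Suc n)) (P (Suc (Suc n))) t \<and> ?S n s t"
    proof (rule projective_functor_lift[OF C Pd(1) Pd(2) Pd(2) Pd(3) k])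
      fix c a assume c: "c \<in> Ob C" and a: "a \<in> carrier (fob (P (Suc n)) c)"
      interpret d: group_hom "fob (P (Suc n)) c" "fob (P n) c" "d n c" by (rule gh[OF c])
      have "d n c (?k c a) = \<one>\<^bsub>fob (P n) c\<^esub>"
        using hd[OF c a] s c a nat_transf_closed[OF h c a] nat_transf_closed[OF h c]
          nat_transf_closed[OF sd c a] by simp
      then have "?k c a \<in> kernel (fob (P (Suc n)) c) (fob (P n) c) (d n c)"
        using nat_transf_closed[OF k c a] by (simp add: kernel_def)
      then show "?k c a \<in> d (Suc n) c ` carrier (fob (P (Suc (Suc n))) c)"
        using Pd(7)[OF c] by simp
    qed
    then obtain t where t: "nat_transf C (P (Suc n)) (P (Suc (Suc n))) t" "?S n s t" by blast
    have "d (Suc n) c (t c (d (Suc n) c a)) = h (Suc n) c (d (Suc n) c a)"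
      if c: "c \<in> Ob C" and a: "a \<in> carrier (fob (P (Suc (Suc n))) c)" for c a
    proof -
      interpret comm_group "fob (P (Suc n)) c" by (rule cg[OF c])
      have da: "d (Suc n) c a \<in> carrier (fob (P (Suc n)) c)" by (rule nat_transf_closed[OF Pd(3) c a])
      have "s c (d n c (d (Suc n) c a)) = \<one>\<^bsub>fob (P (Suc n)) c\<^esub>"
        unfolding projective_resolution_dd(1)[OF P c a] by (rule nat_transf_one[OF Pd(2) Pd(2) sn c])
      then show ?thesis using t(2) c da nat_transf_closed[OF h c da] by simp
    qed
    with t show "\<exists>t. ?R (Suc n) t \<and> ?S n s t" by blast
  qed
  then obtain s where s: "\<And>n. ?R n (s n) \<and> ?S n (s n) (s (Suc n))" by blast
  have "f (Suc n) c a =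
       d (Suc n) c (s (Suc n) c a) \<otimes>\<^bsub>fob (P (Suc n)) c\<^esub> s n c (d n c a) \<otimes>\<^bsub>fob (P (Suc n)) c\<^esub> a"
    if c: "c \<in> Ob C" and a: "a \<in> carrier (fob (P (Suc n)) c)" for n c a
  proof -
    interpret comm_group "fob (P (Suc n)) c" by (rule cg[OF c])
    have sd: "s n c (d n c a) \<in> carrier (fob (P (Suc n)) c)"
      using s[of n] nat_transf_closed[OF _ c nat_transf_closed[OF Pd(3) c a]] by blast
    have "d (Suc n) c (s (Suc n) c a) = h (Suc n) c a \<otimes>\<^bsub>fob (P (Suc n)) c\<^esub>
        inv\<^bsub>fob (P (Suc n)) c\<^esub> s n c (d n c a)"
      using s[of n] c a by blast
    then show ?thesis
      using a sd nat_transf_closed[OF f c a] by (simp add: h_def m_assoc)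
  qed
  then show ?thesis using s by blast
qed

abbreviation colim_cx :: "('o, 'a) small_cat \<Rightarrow> (nat \<Rightarrow> ('o, 'a, 'g) ab_fun) \<Rightarrow> nat \<Rightarrow> ('o \<Rightarrow> 'g) set monoid" where
  "colim_cx C P \<equiv> \<lambda>n. colim C (P n)"

abbreviation colim_bd :: "('o, 'a) small_cat \<Rightarrow> (nat \<Rightarrow> ('o, 'a, 'g) ab_fun) \<Rightarrow> (nat \<Rightarrow> 'o \<Rightarrow> 'g \<Rightarrow> 'g) \<Rightarrow>
    nat \<Rightarrow> ('o \<Rightarrow> 'g) set \<Rightarrow> ('o \<Rightarrow> 'g) set" where
  "colim_bd C P d \<equiv> \<lambda>n. colim_map C (P (Suc n)) (P n) (d n)"

lemma chain_complex_colim: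
  assumes C: "has_endpoints C" and P: "projective_resolution C F P d \<epsilon>"
  shows "chain_complex (colim_cx C P) (colim_bd C P d)"
  unfolding chain_complex_def
proof (intro conjI allI ballI)
  note Pd = projective_resolutionD[OF P]
  show "comm_group (colim C (P n))" for n by (rule comm_group_colim[OF C Pd(2)])
  show "colim_map C (P (Suc n)) (P n) (d n) \<in> hom (colim C (P (Suc n))) (colim C (P n))" for n
    by (rule colim_map_hom[OF C Pd(2) Pd(2) Pd(3)])
  fix n x assume x: "x \<in> carrier (colim C (P (Suc (Suc n))))"
  have dd: "nat_transf C (P (Suc (Suc n))) (P n) (\<lambda>c a. d n c (d (Suc n) c a))"
    by (rule nat_transf_comp[OF Pd(3) Pd(3) C])
  interpret G: comm_group "colim C (P n)" by (rule comm_group_colim[OF C Pd(2)])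
  \<comment> \<open>The composite of the differentials is trivial, hence equal to its own square.
    Additivity of \<open>colim_map\<close> turns this into y = y y on the colimit, so y is the unit;
    no separate zero transformation has to be treated.\<close>
  have eq: "d n c (d (Suc n) c a) = d n c (d (Suc n) c a) \<otimes>\<^bsub>fob (P n) c\<^esub> d n c (d (Suc n) c a)"
    if "c \<in> Ob C" "a \<in> carrier (fob (P (Suc (Suc n))) c)" for c a
    using projective_resolution_dd(1)[OF P that] monoid.r_one[OF group.is_monoid[OF ab_functor_group[OF Pd(2) that(1)]]]
      monoid.one_closed[OF group.is_monoid[OF ab_functor_group[OF Pd(2) that(1)]]] by simp
  let ?y = "colim_map C (P (Suc (Suc n))) (P n) (\<lambda>c a. d n c (d (Suc n) c a)) x"
  have "?y = ?y \<otimes>\<^bsub>colim C (P n)\<^esub> ?y"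
    using colim_map_cong[OF C Pd(2) Pd(2) dd nat_transf_mult[OF C Pd(2) dd dd] eq x]
    unfolding colim_map_mult[OF C Pd(2) Pd(2) dd dd x] by blast
  moreover have "?y \<in> carrier (colim C (P n))"
    using colim_map_hom[OF C Pd(2) Pd(2) dd] x by (auto simp: hom_def)
  ultimately have "?y = \<one>\<^bsub>colim C (P n)\<^esub>" using G.l_cancel_one' by blast
  then show "colim_map C (P (Suc n)) (P n) (d n) (colim_map C (P (Suc (Suc n))) (P (Suc n)) (d (Suc n)) x)
      = \<one>\<^bsub>colim C (P n)\<^esub>"
    unfolding colim_map_comp[OF C Pd(2) Pd(2) Pd(2) Pd(3) Pd(3) x] .
qed

lemma homotopic_to_id_colim:
  fixes P :: "nat \<Rightarrow> ('o, 'a, 'b \<Rightarrow>\<^sub>0 int) ab_fun"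
  assumes C: "has_endpoints C" and P: "projective_resolution C const_int P d \<epsilon>"
    and f: "\<And>n. nat_transf C (P n) (P n) (f n)"
    and f0: "\<And>c a. c \<in> Ob C \<Longrightarrow> a \<in> carrier (fob (P 0) c) \<Longrightarrow> \<epsilon> c (f 0 c a) = \<epsilon> c a"
    and fd: "\<And>n c a. c \<in> Ob C \<Longrightarrow> a \<in> carrier (fob (P (Suc n)) c) \<Longrightarrow>
      d n c (f (Suc n) c a) = f n c (d n c a)"
  shows "homotopic_to_id (colim_cx C P) (colim_bd C P d)
    (\<lambda>n. colim_map C (P n) (P n) (f n))"
proof -
  note Pd = projective_resolutionD[OF P]
  have id: "nat_transf C F F (\<lambda>c a. a)" for F :: "('o, 'a, 'b \<Rightarrow>\<^sub>0 int) ab_fun"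
    by (auto simp: nat_transf_def hom_def)
  have "\<exists>s. (\<forall>n. nat_transf C (P n) (P (Suc n)) (s n)) \<and>
    (\<forall>n. \<forall>c\<in>Ob C. \<forall>a\<in>carrier (fob (P (Suc n)) c). f (Suc n) c a =
       d (Suc n) c (s (Suc n) c a) \<otimes>\<^bsub>fob (P (Suc n)) c\<^esub> s n c (d n c a) \<otimes>\<^bsub>fob (P (Suc n)) c\<^esub> a)"
    by (rule projective_resolution_homotopy[where f = f, OF C P]) (simp_all add: f f0 fd)
  then obtain s where s: "\<And>n. nat_transf C (P n) (P (Suc n)) (s n)"
    and fs: "\<And>n c a. c \<in> Ob C \<Longrightarrow> a \<in> carrier (fob (P (Suc n)) c) \<Longrightarrow> f (Suc n) c a =
       d (Suc n) c (s (Suc n) c a) \<otimes>\<^bsub>fob (P (Suc n)) c\<^esub> s n c (d n c a) \<otimes>\<^bsub>fob (P (Suc n)) c\<^esub> a"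
    by blast
  show ?thesis
    unfolding homotopic_to_id_def
  proof (intro exI[of _ "\<lambda>n. colim_map C (P n) (P (Suc n)) (s n)"] conjI allI ballI)
    show "colim_map C (P n) (P (Suc n)) (s n) \<in> hom (colim C (P n)) (colim C (P (Suc n)))" for n
      by (rule colim_map_hom[OF C Pd(2) Pd(2) s])
    fix n x assume x: "x \<in> carrier (colim C (P (Suc n)))"
    have ds: "nat_transf C (P (Suc n)) (P (Suc n)) (\<lambda>c a. d (Suc n) c (s (Suc n) c a))"
      by (rule nat_transf_comp[OF s Pd(3) C])
    have sd: "nat_transf C (P (Suc n)) (P (Suc n)) (\<lambda>c a. s n c (d n c a))"
      by (rule nat_transf_comp[OF Pd(3) s C])
    note m = nat_transf_mult[OF C Pd(2) ds sd]
    have "colim_map C (P (Suc n)) (P (Suc n)) (f (Suc n)) x =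
      colim_map C (P (Suc n)) (P (Suc n)) (\<lambda>c a. d (Suc n) c (s (Suc n) c a)
        \<otimes>\<^bsub>fob (P (Suc n)) c\<^esub> s n c (d n c a) \<otimes>\<^bsub>fob (P (Suc n)) c\<^esub> a) x"
      by (rule colim_map_cong[OF C Pd(2) Pd(2) f nat_transf_mult[OF C Pd(2) m id] fs x])
    also have "\<dots> = colim_map C (P (Suc n)) (P (Suc n)) (\<lambda>c a. d (Suc n) c (s (Suc n) c a)) x
        \<otimes>\<^bsub>colim C (P (Suc n))\<^esub> colim_map C (P (Suc n)) (P (Suc n)) (\<lambda>c a. s n c (d n c a)) x
        \<otimes>\<^bsub>colim C (P (Suc n))\<^esub> x"
      unfolding colim_map_mult[OF C Pd(2) Pd(2) m id x] colim_map_mult[OF C Pd(2) Pd(2) ds sd x]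
        colim_map_id[OF C Pd(2) id HOL.refl x] ..
    finally show "colim_map C (P (Suc n)) (P (Suc n)) (f (Suc n)) x =
        colim_map C (P (Suc (Suc n))) (P (Suc n)) (d (Suc n))
          (colim_map C (P (Suc n)) (P (Suc (Suc n))) (s (Suc n)) x)
        \<otimes>\<^bsub>colim C (P (Suc n))\<^esub> colim_map C (P n) (P (Suc n)) (s n) (colim_map C (P (Suc n)) (P n) (d n) x)
        \<otimes>\<^bsub>colim C (P (Suc n))\<^esub> x"
      unfolding colim_map_comp[OF C Pd(2) Pd(2) Pd(2) s Pd(3) x]
        colim_map_comp[OF C Pd(2) Pd(2) Pd(2) Pd(3) s x] .
  qed
qed

lemma chain_homology_colim_resolutions:
  fixes P Q :: "nat \<Rightarrow> ('o, 'a, 'b \<Rightarrow>\<^sub>0 int) ab_fun"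
  assumes C: "has_endpoints C"
    and P: "projective_resolution C const_int P d \<epsilon>" and Q: "projective_resolution C const_int Q e \<theta>"
  shows "chain_homology (colim_cx C P) (colim_bd C P d) (Suc k) \<cong>
    chain_homology (colim_cx C Q) (colim_bd C Q e) (Suc k)"
proof -
  note Pd = projective_resolutionD[OF P] and Qd = projective_resolutionD[OF Q]
  obtain f where f: "\<And>n. nat_transf C (P n) (Q n) (f n)"
    "\<And>c a. c \<in> Ob C \<Longrightarrow> a \<in> carrier (fob (P 0) c) \<Longrightarrow> \<theta> c (f 0 c a) = \<epsilon> c a"
    "\<And>n c a. c \<in> Ob C \<Longrightarrow> a \<in> carrier (fob (P (Suc n)) c) \<Longrightarrow> e n c (f (Suc n) c a) = f n c (d n c a)"
    using projective_resolution_comparison[OF C P Q] by blast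
  obtain g where g: "\<And>n. nat_transf C (Q n) (P n) (g n)"
    "\<And>c a. c \<in> Ob C \<Longrightarrow> a \<in> carrier (fob (Q 0) c) \<Longrightarrow> \<epsilon> c (g 0 c a) = \<theta> c a"
    "\<And>n c a. c \<in> Ob C \<Longrightarrow> a \<in> carrier (fob (Q (Suc n)) c) \<Longrightarrow> d n c (g (Suc n) c a) = g n c (e n c a)"
    using projective_resolution_comparison[OF C Q P] by blast
  \<comment> \<open>This fact and \<open>null\<close> are stated for arbitrary resolutions because
    each is applied twice, with the roles of \<open>P\<close> and \<open>Q\<close>
    exchanged.\<close>
  have map: "chain_map (colim_cx C P) (colim_bd C P d)
      (colim_cx C Q) (colim_bd C Q e) (\<lambda>n. colim_map C (P n) (Q n) (f n))"
    if Pd: "\<And>n. ab_functor C (P n)" "\<And>n. nat_transf C (P (Suc n)) (P n) (d n)"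
    and Qd: "\<And>n. ab_functor C (Q n)" "\<And>n. nat_transf C (Q (Suc n)) (Q n) (e n)"
    and f: "\<And>n. nat_transf C (P n) (Q n) (f n)"
      "\<And>n c a. c \<in> Ob C \<Longrightarrow> a \<in> carrier (fob (P (Suc n)) c) \<Longrightarrow> e n c (f (Suc n) c a) = f n c (d n c a)"
    for P Q :: "nat \<Rightarrow> ('o, 'a, 'b \<Rightarrow>\<^sub>0 int) ab_fun" and d e f
    unfolding chain_map_def
  proof (intro conjI allI ballI)
    show "colim_map C (P n) (Q n) (f n) \<in> hom (colim C (P n)) (colim C (Q n))" for n
      by (rule colim_map_hom[OF C Pd(1) Qd(1) f(1)])
    fix n x assume x: "x \<in> carrier (colim C (P (Suc n)))"
    show "colim_map C (Q (Suc n)) (Q n) (e n) (colim_map C (P (Suc n)) (Q (Suc n)) (f (Suc n)) x) =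
        colim_map C (P n) (Q n) (f n) (colim_map C (P (Suc n)) (P n) (d n) x)"
      unfolding colim_map_comp[OF C Pd(1) Qd(1) Qd(1) f(1) Qd(2) x]
        colim_map_comp[OF C Pd(1) Pd(1) Qd(1) Pd(2) f(1) x]
      by (rule colim_map_cong[OF C Pd(1) Qd(1) nat_transf_comp[OF f(1) Qd(2) C]
            nat_transf_comp[OF Pd(2) f(1) C] f(2) x])
  qed
  have null: "homotopic_to_id (colim_cx C P) (colim_bd C P d)
      (\<lambda>n x. colim_map C (Q n) (P n) (g n) (colim_map C (P n) (Q n) (f n) x))"
    if P: "projective_resolution C const_int P d \<epsilon>" and Q: "projective_resolution C const_int Q e \<theta>"
    and f: "\<And>n. nat_transf C (P n) (Q n) (f n)"
    "\<And>c a. c \<in> Ob C \<Longrightarrow> a \<in> carrier (fob (P 0) c) \<Longrightarrow> \<theta> c (f 0 c a) = \<epsilon> c a"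
    "\<And>n c a. c \<in> Ob C \<Longrightarrow> a \<in> carrier (fob (P (Suc n)) c) \<Longrightarrow> e n c (f (Suc n) c a) = f n c (d n c a)"
    and g: "\<And>n. nat_transf C (Q n) (P n) (g n)"
    "\<And>c a. c \<in> Ob C \<Longrightarrow> a \<in> carrier (fob (Q 0) c) \<Longrightarrow> \<epsilon> c (g 0 c a) = \<theta> c a"
    "\<And>n c a. c \<in> Ob C \<Longrightarrow> a \<in> carrier (fob (Q (Suc n)) c) \<Longrightarrow> d n c (g (Suc n) c a) = g n c (e n c a)"
    for P Q :: "nat \<Rightarrow> ('o, 'a, 'b \<Rightarrow>\<^sub>0 int) ab_fun" and d e f g \<epsilon> \<theta>
  proof -
    note Pd = projective_resolutionD[OF P] and Qd = projective_resolutionD[OF Q]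
    have gf: "nat_transf C (P n) (P n) (\<lambda>c a. g n c (f n c a))" for n
      by (rule nat_transf_comp[OF f(1) g(1) C])
    have "homotopic_to_id (colim_cx C P) (colim_bd C P d)
      (\<lambda>n. colim_map C (P n) (P n) (\<lambda>c a. g n c (f n c a)))"
    proof (rule homotopic_to_id_colim[OF C P gf])
      fix c a assume c: "c \<in> Ob C" and a: "a \<in> carrier (fob (P 0) c)"
      show "\<epsilon> c (g 0 c (f 0 c a)) = \<epsilon> c a"
        using g(2)[OF c nat_transf_closed[OF f(1) c a]] f(2)[OF c a] by simp
    next
      fix n c a assume c: "c \<in> Ob C" and a: "a \<in> carrier (fob (P (Suc n)) c)"
      show "d n c (g (Suc n) c (f (Suc n) c a)) = g n c (f n c (d n c a))"
        using g(3)[OF c nat_transf_closed[OF f(1) c a]] f(3)[OF c a] by simp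
    qed
    then show ?thesis
      by (simp add: homotopic_to_id_def colim_map_comp[OF C Pd(2) Qd(2) Pd(2) f(1) g(1)])
  qed
  show ?thesis
  proof (rule chain_homotopy_equivalence_iso[OF chain_complex_colim[OF C P] chain_complex_colim[OF C Q]
          map[where P = P and Q = Q and d = d and e = e and f = f]
          map[where P = Q and Q = P and d = e and e = d and f = g]
          null[where f = f and g = g, OF P Q] null[where f = g and g = f, OF Q P]])
  qed (simp_all add: f g Pd(2,3) Qd(2,3))
qed

text \<open>The existence of a single resolution \<open>Q\<close> guarantees that the one picked by
  \<open>SOME\<close> is a resolution, and the comparison theorem then replaces it by
  \<open>Q\<close>. The type of \<open>Q\<close> is the one in the definition, so an explicit
  resolution has to be coded into it.\<close>

lemma
  fixes C :: "('o, 'a) small_cat" and Q :: "nat \<Rightarrow> ('o, 'a, 'a list \<Rightarrow>\<^sub>0 int) ab_fun"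
  assumes C: "has_endpoints C" and Q: "projective_resolution C const_int Q e \<theta>"
  shows comm_group_left_derived_colim: "comm_group (left_derived_colim C const_int (Suc k))"
    and left_derived_colim_iso: "left_derived_colim C const_int (Suc k) \<cong>
      chain_homology (colim_cx C Q) (colim_bd C Q e) (Suc k)"
proof -
  let ?A = "\<lambda>(P :: nat \<Rightarrow> ('o, 'a, 'a list \<Rightarrow>\<^sub>0 int) ab_fun, d, \<epsilon>).
      projective_resolution C (const_int :: ('o, 'a, int) ab_fun) P d \<epsilon>"
  obtain P d \<epsilon> where eq: "(SOME R. ?A R) = (P, d, \<epsilon>)"
    by (metis surj_pair)
  have "?A (SOME R. ?A R)"
    by (rule someI[of ?A "(Q, e, \<theta>)"]) (simp add: Q)
  then have "projective_resolution C const_int P d \<epsilon>" by (simp only: eq prod.case)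
  then show "comm_group (left_derived_colim C const_int (Suc k))"
    "left_derived_colim C const_int (Suc k) \<cong>
      chain_homology (colim_cx C Q) (colim_bd C Q e) (Suc k)"
    unfolding left_derived_colim_def eq
    using chain_homology_colim_resolutions[OF C _ Q] comm_group_chain_homology[OF chain_complex_colim[OF C]]
    by (simp_all del: chain_homology.simps)
qed

section \<open>Initial letters of traces\<close>

lemma trace_cong_class_eq:
  assumes "u \<in> lists E" "v \<in> lists E"
  shows "trace_cong E I `` {u} = trace_cong E I `` {v} \<longleftrightarrow> (u, v) \<in> trace_cong E I"
proof
  assume "trace_cong E I `` {u} = trace_cong E I `` {v}"
  moreover have "(v, v) \<in> trace_cong E I" using assms(2) by (rule trace_cong.refl)
  ultimately show "(u, v) \<in> trace_cong E I" by blast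
next
  assume "(u, v) \<in> trace_cong E I"
  then have "((u, w) \<in> trace_cong E I) = ((v, w) \<in> trace_cong E I)" for w
    by (metis trace_cong.sym trace_cong.trans)
  then show "trace_cong E I `` {u} = trace_cong E I `` {v}" by blast
qed

lemma remove1_in_lists: "w \<in> lists E \<Longrightarrow> remove1 a w \<in> lists E"
  using set_remove1_subset[of a w] by (auto simp del: set_remove1_subset)

text \<open>An elementary swap survives the removal of the first \<open>a\<close> if that occurrence
  lies outside the swapped pair; otherwise the two words become equal. Left cancellation and the
  diamond property below are consequences.\<close>

lemma trace_cong_remove1:
  "(u, v) \<in> trace_cong E I \<Longrightarrow> (remove1 a u, remove1 a v) \<in> trace_cong E I"
proof (induction rule: trace_cong.induct)
  case (refl w)
  then show ?case by (intro trace_cong.refl remove1_in_lists)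
next
  case (comm b c u v)
  have r: "remove1 a u \<in> lists E" "remove1 a v \<in> lists E"
    using comm(4,5) by (auto intro: remove1_in_lists simp del: in_lists_conv_set)
  show ?case
  proof (cases "a \<in> set u \<or> a \<noteq> b \<and> a \<noteq> c")
    case True
    then show ?thesis
      using trace_cong.comm[OF comm(1-3) r(1) comm(5)] trace_cong.comm[OF comm(1-4) r(2)]
      by (auto simp: remove1_append)
  next
    case False
    then have "remove1 a (u @ [b, c] @ v) = remove1 a (u @ [c, b] @ v)"
      by (auto simp: remove1_append)
    moreover have "remove1 a (u @ [c, b] @ v) \<in> lists E"
      using comm(2-5) by (intro remove1_in_lists) auto
    ultimately show ?thesis by (simp add: trace_cong.refl)
  qed
next
  case (sym u v)
  then show ?case by (blast intro: trace_cong.sym)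
next
  case (trans u v w)
  then show ?case by (blast intro: trace_cong.trans)
qed

text \<open>An elementary swap never exchanges \<open>a\<close> with \<open>b\<close> when they are
  unrelated by \<open>I\<close>, so dependent letters keep their relative order.\<close>

lemma trace_cong_filter_independent:
  "(u, v) \<in> trace_cong E I \<Longrightarrow> (a, b) \<notin> I \<Longrightarrow> (b, a) \<notin> I \<Longrightarrow>
    filter (\<lambda>x. x = a \<or> x = b) u = filter (\<lambda>x. x = a \<or> x = b) v"
  by (induction rule: trace_cong.induct) auto

definition letter :: "'e set \<Rightarrow> ('e \<times> 'e) set \<Rightarrow> 'e \<Rightarrow> 'e list set" where
  "letter E I a = trace_cong E I `` {[a]}"

definition initials :: "'e set \<Rightarrow> ('e \<times> 'e) set \<Rightarrow> 'e list set \<Rightarrow> 'e set" where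
  "initials E I p = {a \<in> E. \<exists>q\<in>carrier (trace_monoid E I). p = letter E I a \<otimes>\<^bsub>trace_monoid E I\<^esub> q}"

text \<open>Left division by a letter; the description is unique by
  \<open>letter_cancel\<close>.\<close>

definition remainder :: "'e set \<Rightarrow> ('e \<times> 'e) set \<Rightarrow> 'e \<Rightarrow> 'e list set \<Rightarrow> 'e list set" where
  "remainder E I a p =
     (THE q. q \<in> carrier (trace_monoid E I) \<and> p = letter E I a \<otimes>\<^bsub>trace_monoid E I\<^esub> q)"

definition trace_length :: "'e list set \<Rightarrow> nat" where
  "trace_length p = length (SOME w. w \<in> p)"

lemma trace_length_class: "w \<in> lists E \<Longrightarrow> trace_length (trace_cong E I `` {w}) = length w"
proof -
  assume "w \<in> lists E"
  then have "w \<in> trace_cong E I `` {w}" by (simp add: trace_cong.refl)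
  then have "(SOME v. v \<in> trace_cong E I `` {w}) \<in> trace_cong E I `` {w}" by (rule someI)
  then show ?thesis unfolding trace_length_def using trace_cong_length by fastforce
qed

definition clique :: "('e \<times> 'e) set \<Rightarrow> 'e set \<Rightarrow> bool" where
  "clique I S \<longleftrightarrow> finite S \<and> (\<forall>a\<in>S. \<forall>b\<in>S. a \<noteq> b \<longrightarrow> (a, b) \<in> I)"

text \<open>One enumeration of \<open>S\<close> is fixed by choice, so the product of the letters is
  a definite trace without an argument that their order is immaterial.\<close>

definition clique_trace :: "'e set \<Rightarrow> ('e \<times> 'e) set \<Rightarrow> 'e set \<Rightarrow> 'e list set" where
  "clique_trace E I S = trace_cong E I `` {SOME w. distinct w \<and> set w = S}"

locale commutation =
  fixes E :: "'e set" and I :: "('e \<times> 'e) set"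
  assumes I_irrefl: "irrefl I" and I_sym: "sym I"
begin

abbreviation M where "M \<equiv> trace_monoid E I"
abbreviation tr where "tr w \<equiv> trace_cong E I `` {w}"

sublocale monoid M by (rule monoid_trace_monoid)

lemma one_trace: "\<one>\<^bsub>M\<^esub> = tr []"
  by (simp add: trace_monoid_def)

lemma letter_closed [simp]: "a \<in> E \<Longrightarrow> letter E I a \<in> carrier M"
  unfolding letter_def by (rule trace_class_carrier) simp

lemma letter_mult_tr: "a \<in> E \<Longrightarrow> w \<in> lists E \<Longrightarrow> letter E I a \<otimes>\<^bsub>M\<^esub> tr w = tr (a # w)"
  unfolding letter_def by (subst trace_class_mult) auto

lemma letter_cancel:
  assumes "a \<in> E" "p \<in> carrier M" "q \<in> carrier M"
    and eq: "letter E I a \<otimes>\<^bsub>M\<^esub> p = letter E I a \<otimes>\<^bsub>M\<^esub> q"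
  shows "p = q"
proof -
  obtain u where u: "u \<in> lists E" "p = tr u" using assms(2) by (rule trace_carrierE)
  obtain v where v: "v \<in> lists E" "q = tr v" using assms(3) by (rule trace_carrierE)
  have "(a # u, a # v) \<in> trace_cong E I"
    using eq assms(1) u v by (simp add: letter_mult_tr trace_cong_class_eq)
  from trace_cong_remove1[OF this, of a] show ?thesis
    using u v by (simp add: trace_cong_class_eq)
qed

text \<open>If \<open>a\<close> and \<open>b\<close> were dependent, the words filtered to these two
  letters would begin differently. Given independence, the rest is a computation with
  \<open>remove1\<close>.\<close>

lemma letter_diamond:
  assumes "a \<in> E" "b \<in> E" "a \<noteq> b" "p \<in> carrier M" "q \<in> carrier M"
    and eq: "letter E I a \<otimes>\<^bsub>M\<^esub> p = letter E I b \<otimes>\<^bsub>M\<^esub> q"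
  shows "(a, b) \<in> I" and "\<exists>t\<in>carrier M. p = letter E I b \<otimes>\<^bsub>M\<^esub> t \<and> q = letter E I a \<otimes>\<^bsub>M\<^esub> t"
proof -
  obtain u where u: "u \<in> lists E" "p = tr u" using assms(4) by (rule trace_carrierE)
  obtain v where v: "v \<in> lists E" "q = tr v" using assms(5) by (rule trace_carrierE)
  have uv: "(a # u, b # v) \<in> trace_cong E I"
    using eq assms(1,2) u v by (simp add: letter_mult_tr trace_cong_class_eq)
  show "(a, b) \<in> I"
  proof (rule ccontr)
    assume "(a, b) \<notin> I"
    moreover from this have "(b, a) \<notin> I" using I_sym by (auto dest: symD)
    ultimately show False using trace_cong_filter_independent[OF uv, of a b] assms(3) by auto
  qed
  \<comment> \<open>The common remainder after dividing by both letters. Removing \<open>b\<close>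
    from both words gives v = a t; removing \<open>a\<close> gives u = b v' where v' is
    \<open>v\<close> without its first \<open>a\<close>, and removing \<open>a\<close> from v = a t
    identifies v' with t.\<close>
  let ?t = "remove1 b u"
  have t: "?t \<in> lists E" using u(1) by (rule remove1_in_lists)
  have 1: "(v, a # ?t) \<in> trace_cong E I"
    using trace_cong_remove1[OF uv, of b] assms(3) by (simp add: trace_cong.sym)
  have "(u, b # remove1 a v) \<in> trace_cong E I"
    using trace_cong_remove1[OF uv, of a] assms(3) by simp
  moreover have "(b # remove1 a v, b # ?t) \<in> trace_cong E I"
    using trace_cong_append[OF trace_cong_remove1[OF 1, of a], of "[b]" "[]"] assms(2) by simp
  ultimately have 2: "(u, b # ?t) \<in> trace_cong E I" by (rule trace_cong.trans)
  show "\<exists>t\<in>carrier M. p = letter E I b \<otimes>\<^bsub>M\<^esub> t \<and> q = letter E I a \<otimes>\<^bsub>M\<^esub> t"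
    using 1 2 t u v assms(1,2) trace_class_carrier[OF t]
    by (intro bexI[of _ "tr ?t"]) (simp_all add: letter_mult_tr trace_cong_class_eq)
qed

lemma letter_commute:
  assumes "(a, b) \<in> I" "a \<in> E" "b \<in> E" "p \<in> carrier M"
  shows "letter E I a \<otimes>\<^bsub>M\<^esub> (letter E I b \<otimes>\<^bsub>M\<^esub> p) = letter E I b \<otimes>\<^bsub>M\<^esub> (letter E I a \<otimes>\<^bsub>M\<^esub> p)"
proof -
  obtain u where u: "u \<in> lists E" "p = tr u" using assms(4) by (rule trace_carrierE)
  show ?thesis
    using trace_cong.comm[OF assms(1-3), of "[]" u] assms u
    by (simp add: letter_mult_tr trace_cong_class_eq)
qed

lemma trace_length_letter:
  assumes "a \<in> E" "p \<in> carrier M"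
  shows "trace_length (letter E I a \<otimes>\<^bsub>M\<^esub> p) = Suc (trace_length p)"
proof -
  obtain u where u: "u \<in> lists E" "p = tr u" using assms(2) by (rule trace_carrierE)
  then show ?thesis using assms(1) by (simp add: letter_mult_tr trace_length_class)
qed

lemma trace_length_eq_0:
  assumes "p \<in> carrier M" "trace_length p = 0"
  shows "p = \<one>\<^bsub>M\<^esub>"
proof -
  obtain u where u: "u \<in> lists E" "p = tr u" using assms(1) by (rule trace_carrierE)
  then show ?thesis using assms(2) by (simp add: one_trace trace_length_class)
qed

lemma initials_nonempty:
  assumes "p \<in> carrier M" "trace_length p > 0"
  shows "initials E I p \<noteq> {}"
proof -
  obtain u where u: "u \<in> lists E" "p = tr u" using assms(1) by (rule trace_carrierE)
  then obtain a v where "u = a # v" using assms(2) by (cases u) (auto simp: trace_length_class)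
  then have "a \<in> E" "v \<in> lists E" "p = letter E I a \<otimes>\<^bsub>M\<^esub> tr v"
    using u by (auto simp: letter_mult_tr)
  then show ?thesis using trace_class_carrier[of v E I] by (auto simp: initials_def)
qed

lemma initials_subset: "a \<in> initials E I p \<Longrightarrow> a \<in> E"
  by (simp add: initials_def)

lemma initials_letter: "a \<in> E \<Longrightarrow> q \<in> carrier M \<Longrightarrow> a \<in> initials E I (letter E I a \<otimes>\<^bsub>M\<^esub> q)"
  by (auto simp: initials_def)

lemma remainder_letter:
  assumes "a \<in> E" "q \<in> carrier M"
  shows "remainder E I a (letter E I a \<otimes>\<^bsub>M\<^esub> q) = q"
  unfolding remainder_def using letter_cancel[OF assms(1)] assms(2) by (intro the_equality) auto

lemma
  assumes "a \<in> initials E I p"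
  shows remainder_closed: "remainder E I a p \<in> carrier M"
    and letter_remainder: "letter E I a \<otimes>\<^bsub>M\<^esub> remainder E I a p = p"
  using assms by (auto simp: initials_def remainder_letter)

lemma trace_length_remainder:
  "a \<in> initials E I p \<Longrightarrow> trace_length p = Suc (trace_length (remainder E I a p))"
  using trace_length_letter[OF initials_subset remainder_closed] letter_remainder by metis

lemma initials_mult:
  assumes "a \<in> initials E I p" "q \<in> carrier M"
  shows "a \<in> initials E I (p \<otimes>\<^bsub>M\<^esub> q)"
    and "remainder E I a (p \<otimes>\<^bsub>M\<^esub> q) = remainder E I a p \<otimes>\<^bsub>M\<^esub> q"
proof -
  note a = initials_subset[OF assms(1)]
  have "p \<otimes>\<^bsub>M\<^esub> q = letter E I a \<otimes>\<^bsub>M\<^esub> (remainder E I a p \<otimes>\<^bsub>M\<^esub> q)"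
    using letter_remainder[OF assms(1)] remainder_closed[OF assms(1)] assms(2) a
    by (metis letter_closed m_assoc)
  then show "a \<in> initials E I (p \<otimes>\<^bsub>M\<^esub> q)"
    "remainder E I a (p \<otimes>\<^bsub>M\<^esub> q) = remainder E I a p \<otimes>\<^bsub>M\<^esub> q"
    using a remainder_closed[OF assms(1)] assms(2)
    by (simp_all add: initials_letter remainder_letter)
qed

text \<open>The diamond property in terms of division. It makes every finite set of initial letters
  a clique, keeps the remaining sides of a cube initial on a front face, and lets front faces in two
  directions commute.\<close>

lemma initials_independent:
  assumes "a \<in> initials E I p" "b \<in> initials E I p" "a \<noteq> b"
  shows "(a, b) \<in> I" and "b \<in> initials E I (remainder E I a p)"
    and "remainder E I b (remainder E I a p) = remainder E I a (remainder E I b p)"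
proof -
  note ab = initials_subset[OF assms(1)] initials_subset[OF assms(2)]
  have eq: "letter E I a \<otimes>\<^bsub>M\<^esub> remainder E I a p = letter E I b \<otimes>\<^bsub>M\<^esub> remainder E I b p"
    using letter_remainder assms by simp
  note * = letter_diamond[OF ab assms(3) remainder_closed[OF assms(1)] remainder_closed[OF assms(2)] eq]
  show "(a, b) \<in> I" by (rule *)
  obtain t where "t \<in> carrier M" "remainder E I a p = letter E I b \<otimes>\<^bsub>M\<^esub> t"
    "remainder E I b p = letter E I a \<otimes>\<^bsub>M\<^esub> t" using *(2) by blast
  then show "b \<in> initials E I (remainder E I a p)"
    "remainder E I b (remainder E I a p) = remainder E I a (remainder E I b p)"
    using ab by (simp_all add: initials_letter remainder_letter)
qed

lemma initials_letter_mult: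
  assumes "b \<in> initials E I q" "(a, b) \<in> I" "a \<in> E"
  shows "b \<in> initials E I (letter E I a \<otimes>\<^bsub>M\<^esub> q)"
proof -
  note b = initials_subset[OF assms(1)] and t = remainder_closed[OF assms(1)]
  have "letter E I a \<otimes>\<^bsub>M\<^esub> q = letter E I b \<otimes>\<^bsub>M\<^esub> (letter E I a \<otimes>\<^bsub>M\<^esub> remainder E I b q)"
    using letter_commute[OF assms(2,3) b t] letter_remainder[OF assms(1)] by simp
  then show ?thesis using initials_letter b t assms(3) by simp
qed

section \<open>Division by a product of initial letters\<close>

lemma clique_trace_word:
  assumes "finite S"
  obtains w where "distinct w" "set w = S" "clique_trace E I S = tr w"
  using someI_ex[of "\<lambda>w. distinct w \<and> set w = S"] finite_distinct_list[OF assms] that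
  unfolding clique_trace_def by blast

lemma clique_trace_closed: "finite S \<Longrightarrow> S \<subseteq> E \<Longrightarrow> clique_trace E I S \<in> carrier M"
  by (metis clique_trace_word trace_class_carrier in_listsI subsetD)

text \<open>The letters are divided off one at a time: those not yet used stay initial in the
  remainder.\<close>

lemma initials_factor:
  assumes "distinct w" "set w \<subseteq> initials E I p" "p \<in> carrier M"
  shows "\<exists>q\<in>carrier M. p = tr w \<otimes>\<^bsub>M\<^esub> q"
  using assms
proof (induction w arbitrary: p)
  case Nil
  then show ?case by (auto simp flip: one_trace)
next
  case (Cons a w)
  have a: "a \<in> initials E I p" using Cons.prems by simp
  have "set w \<subseteq> initials E I (remainder E I a p)"
    using Cons.prems initials_independent(2)[OF a] by auto
  from Cons.IH[OF _ this remainder_closed[OF a]] Cons.prems(1)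
  obtain q where q: "q \<in> carrier M" "remainder E I a p = tr w \<otimes>\<^bsub>M\<^esub> q" by auto
  have w: "w \<in> lists E" using Cons.prems(2) initials_subset by auto
  have "p = letter E I a \<otimes>\<^bsub>M\<^esub> (tr w \<otimes>\<^bsub>M\<^esub> q)" using letter_remainder[OF a] q by simp
  also have "\<dots> = tr (a # w) \<otimes>\<^bsub>M\<^esub> q"
    using w q initials_subset[OF a] trace_class_carrier[OF w] by (simp add: letter_mult_tr m_assoc[symmetric])
  finally show ?case using q by blast
qed

lemma tr_cancel:
  assumes "w \<in> lists E" "p \<in> carrier M" "q \<in> carrier M" "tr w \<otimes>\<^bsub>M\<^esub> p = tr w \<otimes>\<^bsub>M\<^esub> q"
  shows "p = q"
  using assms
proof (induction w rule: list.induct)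
  case Nil
  then show ?case by (simp flip: one_trace)
next
  case (Cons a w)
  have aw: "a \<in> E" "w \<in> lists E" using Cons.prems(1) by auto
  have "letter E I a \<otimes>\<^bsub>M\<^esub> (tr w \<otimes>\<^bsub>M\<^esub> p) = letter E I a \<otimes>\<^bsub>M\<^esub> (tr w \<otimes>\<^bsub>M\<^esub> q)"
    using Cons.prems aw trace_class_carrier[OF aw(2)]
    by (simp add: m_assoc[symmetric] letter_mult_tr)
  then show ?case
    using letter_cancel[OF aw(1)] Cons.IH[OF aw(2) Cons.prems(2,3)] Cons.prems(2,3)
      trace_class_carrier[OF aw(2)] by simp
qed

text \<open>A letter of the clique is initial in the rest of the word by induction and can be pulled
  past the first letter, with which it commutes.\<close>

lemma initials_tr:
  assumes "clique I (set w)" "distinct w" "w \<in> lists E"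
  shows "set w \<subseteq> initials E I (tr w)"
  using assms
proof (induction w)
  case (Cons a w)
  have aw: "a \<in> E" "w \<in> lists E" using Cons.prems(3) by auto
  have "set w \<subseteq> initials E I (tr w)" using Cons by (auto simp: clique_def)
  moreover have "(a, b) \<in> I" if "b \<in> set w" for b using that Cons.prems by (auto simp: clique_def)
  ultimately have "set w \<subseteq> initials E I (letter E I a \<otimes>\<^bsub>M\<^esub> tr w)"
    using initials_letter_mult aw(1) by blast
  then show ?case
    using initials_letter[OF aw(1) trace_class_carrier[OF aw(2)]] aw by (simp add: letter_mult_tr)
qed simp

text \<open>Left division by a whole clique, unique by \<open>tr_cancel\<close>. It will be the
  arrow that carries a generating cube to a given one.\<close>

definition quotient_trace :: "'e set \<Rightarrow> 'e list set \<Rightarrow> 'e list set" where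
  "quotient_trace S p = (THE q. q \<in> carrier M \<and> p = clique_trace E I S \<otimes>\<^bsub>M\<^esub> q)"

lemma quotient_trace_mult:
  assumes "finite S" "S \<subseteq> E" "q \<in> carrier M"
  shows "quotient_trace S (clique_trace E I S \<otimes>\<^bsub>M\<^esub> q) = q"
proof -
  obtain w where w: "distinct w" "set w = S" "clique_trace E I S = tr w"
    using assms(1) by (rule clique_trace_word)
  then have "w \<in> lists E" using assms(2) by auto
  then show ?thesis
    unfolding quotient_trace_def w(3) using tr_cancel assms(3) by (intro the_equality) auto
qed

lemma
  assumes "finite S" "S \<subseteq> initials E I p" "p \<in> carrier M"
  shows quotient_trace_closed: "quotient_trace S p \<in> carrier M"
    and clique_trace_quotient: "clique_trace E I S \<otimes>\<^bsub>M\<^esub> quotient_trace S p = p"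
proof -
  obtain w where w: "distinct w" "set w = S" "clique_trace E I S = tr w"
    using assms(1) by (rule clique_trace_word)
  obtain q where q: "q \<in> carrier M" "p = clique_trace E I S \<otimes>\<^bsub>M\<^esub> q"
    using initials_factor[OF w(1) _ assms(3)] w assms(2) by auto
  moreover have "S \<subseteq> E" using assms(2) initials_subset by blast
  ultimately have "quotient_trace S p = q" using quotient_trace_mult assms(1) by blast
  then show "quotient_trace S p \<in> carrier M" "clique_trace E I S \<otimes>\<^bsub>M\<^esub> quotient_trace S p = p"
    using q by auto
qed

lemma initials_clique_trace:
  assumes "clique I S" "S \<subseteq> E"
  shows "S \<subseteq> initials E I (clique_trace E I S)"
proof -
  obtain w where "distinct w" "set w = S" "clique_trace E I S = tr w"
    using assms(1) unfolding clique_def by (meson clique_trace_word)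
  then show ?thesis using initials_tr[of w] assms by auto
qed

lemma clique_initials: "finite S \<Longrightarrow> S \<subseteq> initials E I p \<Longrightarrow> clique I S"
  unfolding clique_def by (meson initials_independent(1) subsetD)

end

section \<open>Functors with a basis\<close>

abbreviation keys :: "('b \<Rightarrow>\<^sub>0 int) \<Rightarrow> 'b set" where
  "keys \<equiv> Poly_Mapping.keys"

lemma hom_free_Abelian_group_eqI:
  assumes G: "group G" and f: "f \<in> hom (free_Abelian_group S) G" and g: "g \<in> hom (free_Abelian_group S) G"
    and eq: "\<And>b. b \<in> S \<Longrightarrow> f (frag_of b) = g (frag_of b)"
    and x: "keys x \<subseteq> S"
  shows "f x = g x"
proof -
  interpret f: group_hom "free_Abelian_group S" G f
    using G f by (simp add: group_hom_def group_hom_axioms_def)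
  interpret g: group_hom "free_Abelian_group S" G g
    using G g by (simp add: group_hom_def group_hom_axioms_def)
  show ?thesis
  proof (rule free_Abelian_group_induct[OF x])
    show "f 0 = g 0" using f.hom_one g.hom_one by simp
  next
    fix x y assume 2: "keys x \<subseteq> S" "keys y \<subseteq> S" "f x = g x" "f y = g y"
    have "x - y = x \<otimes>\<^bsub>free_Abelian_group S\<^esub> inv\<^bsub>free_Abelian_group S\<^esub> y" using 2 by simp
    then have diff: "h (x - y) = h x \<otimes>\<^bsub>G\<^esub> inv\<^bsub>G\<^esub> h y" if "group_hom (free_Abelian_group S) G h" for h
      using group_hom.hom_mult[OF that, of x "inv\<^bsub>free_Abelian_group S\<^esub> y"] group_hom.hom_inv[OF that, of y] 2
      by simp
    show "f (x - y) = g (x - y)"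
      by (simp add: diff[OF f.group_hom_axioms] diff[OF g.group_hom_axioms] 2)
  qed (rule eq)
qed

lemma frag_extend_hom:
  assumes "\<And>b. b \<in> S \<Longrightarrow> keys (f b) \<subseteq> T"
  shows "frag_extend f \<in> hom (free_Abelian_group S) (free_Abelian_group T)"
proof (rule homI)
  fix x assume "x \<in> carrier (free_Abelian_group S)"
  then show "frag_extend f x \<in> carrier (free_Abelian_group T)"
    using assms keys_frag_extend[of f x] by fastforce
qed (simp add: frag_extend_add)

text \<open>Induction on a finite set containing the support: the component at one object is split
  off as a \<open>summand_incl\<close>.\<close>

lemma hom_sum_group_eqI:
  assumes F: "ab_functor C F" and G: "group G"
    and h: "h \<in> hom (big_sum C F) G" and k: "k \<in> hom (big_sum C F) G"
    and eq: "\<And>c a. c \<in> Ob C \<Longrightarrow> a \<in> carrier (fob F c) \<Longrightarrow>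
      h (summand_incl C F c a) = k (summand_incl C F c a)"
    and u: "u \<in> carrier (big_sum C F)"
  shows "h u = k u"
proof -
  let ?S = "big_sum C F"
  interpret S: comm_group ?S by (rule ab_functor_sum[OF F])
  interpret h: group_hom ?S G h using G h by (simp add: group_hom_def group_hom_axioms_def S.is_group)
  interpret k: group_hom ?S G k using G k by (simp add: group_hom_def group_hom_axioms_def S.is_group)
  have gp: "group (fob F c)" if "c \<in> Ob C" for c by (rule ab_functor_group[OF F that])
  have one: "\<one>\<^bsub>fob F c\<^esub> \<in> carrier (fob F c)" if "c \<in> Ob C" for c
    by (rule monoid.one_closed[OF group.is_monoid[OF gp[OF that]]])
  have car: "u \<in> carrier ?S \<longleftrightarrow> u \<in> (\<Pi>\<^sub>E c\<in>Ob C. carrier (fob F c)) \<and> finite {c \<in> Ob C. u c \<noteq> \<one>\<^bsub>fob F c\<^esub>}" for u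
    using gp by (simp add: carrier_sum_group)
  have "h u = k u" if "finite A" "u \<in> carrier ?S" "{c \<in> Ob C. u c \<noteq> \<one>\<^bsub>fob F c\<^esub>} \<subseteq> A" for A u
    using that
  proof (induction A arbitrary: u)
    case empty
    then have "u = \<one>\<^bsub>?S\<^esub>" by (auto simp: car PiE_iff extensional_def fun_eq_iff)
    then show ?case using h.hom_one k.hom_one by (simp del: one_sum_group)
  next
    case (insert c A)
    show ?case
    proof (cases "c \<in> Ob C")
      case False
      then show ?thesis using insert by blast
    next
      case True
      define v where "v = (\<lambda>i\<in>Ob C. if i = c then \<one>\<^bsub>fob F i\<^esub> else u i)"
      have ui: "u i \<in> carrier (fob F i)" if "i \<in> Ob C" for i using insert.prems(1) that by (auto simp: car)
      have fv: "{i \<in> Ob C. v i \<noteq> \<one>\<^bsub>fob F i\<^esub>} \<subseteq> A" using insert.prems(2) by (auto simp: v_def)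
      have v: "v \<in> carrier ?S"
        using finite_subset[OF fv insert.hyps(1)] ui one by (auto simp: car v_def)
      have i: "summand_incl C F c (u c) \<in> carrier ?S"
        by (rule summand_incl_closed[OF F True ui[OF True]])
      have "u = v \<otimes>\<^bsub>?S\<^esub> summand_incl C F c (u c)"
      proof
        fix i
        show "u i = (v \<otimes>\<^bsub>?S\<^esub> summand_incl C F c (u c)) i"
        proof (cases "i \<in> Ob C")
          case True
          interpret group "fob F i" by (rule gp[OF True])
          show ?thesis
            using True l_one[OF ui[OF True]] r_one[OF ui[OF True]] by (auto simp: v_def summand_incl_def)
        next
          case False
          then show ?thesis using insert.prems(1) by (auto simp: car PiE_iff extensional_def)
        qed
      qed
      moreover have "h v = k v" by (rule insert.IH[OF v fv])
      moreover have "h (summand_incl C F c (u c)) = k (summand_incl C F c (u c))"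
        by (rule eq[OF True ui[OF True]])
      ultimately show ?thesis using h.hom_mult[OF v i] k.hom_mult[OF v i] by metis
    qed
  qed
  from this[OF _ u subset_refl] show ?thesis using u by (simp add: car)
qed

lemma summand_incl_hom:
  assumes F: "ab_functor C F" and c: "c \<in> Ob C"
  shows "summand_incl C F c \<in> hom (fob F c) (big_sum C F)"
proof (rule homI)
  fix a b assume "a \<in> carrier (fob F c)" "b \<in> carrier (fob F c)"
  then show "summand_incl C F c (a \<otimes>\<^bsub>fob F c\<^esub> b) =
      summand_incl C F c a \<otimes>\<^bsub>big_sum C F\<^esub> summand_incl C F c b"
    using monoid.l_one[OF group.is_monoid[OF ab_functor_group[OF F]]]
      monoid.one_closed[OF group.is_monoid[OF ab_functor_group[OF F]]]
    by (auto simp: summand_incl_def intro!: restrict_ext)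
qed (rule summand_incl_closed[OF F c])

definition free_functor :: "('o \<Rightarrow> 'b set) \<Rightarrow> ('a \<Rightarrow> 'b \<Rightarrow> 'b) \<Rightarrow> ('o, 'a, 'b \<Rightarrow>\<^sub>0 int) ab_fun" where
  "free_functor B mv =
     \<lparr>fob = (\<lambda>c. free_Abelian_group (B c)), far = (\<lambda>f. frag_extend (frag_of \<circ> mv f))\<rparr>"

text \<open>Every basis element \<open>b\<close> is the image of the generator \<open>root b\<close> under a unique arrow
  \<open>arr b\<close>, i.e. the functor is a direct sum of representable ones.\<close>

locale based_functor =
  fixes C :: "('o, 'a) small_cat" and B :: "'o \<Rightarrow> 'b set" and mv :: "'a \<Rightarrow> 'b \<Rightarrow> 'b"
    and J :: "'j set" and ob :: "'j \<Rightarrow> 'o" and gen :: "'j \<Rightarrow> 'b" and root :: "'b \<Rightarrow> 'j" and arr :: "'b \<Rightarrow> 'a"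
  assumes C: "has_endpoints C"
    and mv_in: "f \<in> Ar C \<Longrightarrow> b \<in> B (Dom C f) \<Longrightarrow> mv f b \<in> B (Cod C f)"
    and mv_id: "c \<in> Ob C \<Longrightarrow> b \<in> B c \<Longrightarrow> mv (Ident C c) b = b"
    and mv_comp: "f \<in> Ar C \<Longrightarrow> g \<in> Ar C \<Longrightarrow> Cod C f = Dom C g \<Longrightarrow> b \<in> B (Dom C f) \<Longrightarrow>
      mv (Comp C g f) b = mv g (mv f b)"
    and gen_in: "j \<in> J \<Longrightarrow> ob j \<in> Ob C" "j \<in> J \<Longrightarrow> gen j \<in> B (ob j)"
    and root_in: "c \<in> Ob C \<Longrightarrow> b \<in> B c \<Longrightarrow> root b \<in> J"
    and arr_in: "c \<in> Ob C \<Longrightarrow> b \<in> B c \<Longrightarrow> arr b \<in> Ar C"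
      "c \<in> Ob C \<Longrightarrow> b \<in> B c \<Longrightarrow> Dom C (arr b) = ob (root b)"
      "c \<in> Ob C \<Longrightarrow> b \<in> B c \<Longrightarrow> Cod C (arr b) = c"
    and mv_arr: "c \<in> Ob C \<Longrightarrow> b \<in> B c \<Longrightarrow> mv (arr b) (gen (root b)) = b"
    and root_mv: "f \<in> Ar C \<Longrightarrow> b \<in> B (Dom C f) \<Longrightarrow> root (mv f b) = root b"
    and arr_mv: "f \<in> Ar C \<Longrightarrow> b \<in> B (Dom C f) \<Longrightarrow> arr (mv f b) = Comp C f (arr b)"
    and root_gen: "j \<in> J \<Longrightarrow> root (gen j) = j"
begin

abbreviation "P \<equiv> free_functor B mv"

lemma fob_P [simp]: "fob P c = free_Abelian_group (B c)"
  and far_P [simp]: "far P f = frag_extend (frag_of \<circ> mv f)"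
  by (simp_all add: free_functor_def)

lemma DomCod: "f \<in> Ar C \<Longrightarrow> Dom C f \<in> Ob C" "f \<in> Ar C \<Longrightarrow> Cod C f \<in> Ob C"
  using C by (auto simp: has_endpoints_def)

lemma far_P_hom:
  "f \<in> Ar C \<Longrightarrow> far P f \<in> hom (free_Abelian_group (B (Dom C f))) (free_Abelian_group (B (Cod C f)))"
  unfolding far_P by (rule frag_extend_hom) (simp add: mv_in)

lemma ab_functor_P: "ab_functor C P"
  unfolding ab_functor_def
proof (intro conjI ballI impI)
  fix c a assume c: "c \<in> Ob C" and a: "a \<in> carrier (fob P c)"
  have "frag_extend (frag_of \<circ> mv (Ident C c)) a = frag_extend frag_of a"
    by (rule frag_extend_eq) (use a mv_id[OF c] in auto)
  then show "far P (Ident C c) a = a" by (simp flip: frag_expansion)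
next
  fix f g a assume f: "f \<in> Ar C" and g: "g \<in> Ar C" and fg: "Cod C f = Dom C g"
    and a: "a \<in> carrier (fob P (Dom C f))"
  have "frag_extend (frag_of \<circ> mv (Comp C g f)) a = frag_extend ((frag_of \<circ> mv g) \<circ> mv f) a"
    by (rule frag_extend_eq) (use a mv_comp[OF f g fg] in auto)
  then show "far P (Comp C g f) a = far P g (far P f a)"
    by (simp add: frag_extend_compose)
qed (simp_all add: abelian_free_Abelian_group far_P_hom[unfolded far_P])

text \<open>Yoneda's argument: lift the image of each generator \<open>gen j\<close> by an arbitrary
  choice, and send a basis element \<open>b\<close> to the translate of the chosen lift along
  \<open>arr b\<close>. Naturality is what \<open>root_mv\<close> and \<open>arr_mv\<close> are
  for.\<close>

lemma projective_P: "projective_functor C P"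
  unfolding projective_functor_def
proof (intro conjI allI impI ab_functor_P)
  fix A D :: "('o, 'a, 'b \<Rightarrow>\<^sub>0 int) ab_fun" and \<pi> \<phi>
  assume asm: "ab_functor C A \<and> ab_functor C D \<and> epi_transf C A D \<pi> \<and> nat_transf C P D \<phi>"
  then have A: "ab_functor C A" and D: "ab_functor C D" and \<phi>: "nat_transf C P D \<phi>"
    and \<pi>: "nat_transf C A D \<pi>" and epi: "\<And>c. c \<in> Ob C \<Longrightarrow> \<pi> c ` carrier (fob A c) = carrier (fob D c)"
    by (auto simp: epi_transf_def)
  have "\<exists>x. x \<in> carrier (fob A (ob j)) \<and> \<pi> (ob j) x = \<phi> (ob j) (frag_of (gen j))" if j: "j \<in> J" for j
  proof -
    have "frag_of (gen j) \<in> carrier (fob P (ob j))" using gen_in(2)[OF j] by simp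
    then have "\<phi> (ob j) (frag_of (gen j)) \<in> carrier (fob D (ob j))"
      by (rule nat_transf_closed[OF \<phi> gen_in(1)[OF j]])
    then show ?thesis using epi[OF gen_in(1)[OF j]] by (metis imageE)
  qed
  then obtain x where x: "\<And>j. j \<in> J \<Longrightarrow> x j \<in> carrier (fob A (ob j))"
    "\<And>j. j \<in> J \<Longrightarrow> \<pi> (ob j) (x j) = \<phi> (ob j) (frag_of (gen j))" by metis
  have xa: "far A (arr b) (x (root b)) \<in> carrier (fob A c)" if "c \<in> Ob C" "b \<in> B c" for c b
    using far_closed[OF A arr_in(1)[OF that]] arr_in(2,3)[OF that] x(1)[OF root_in[OF that]] by simp
  have "\<exists>h. h \<in> hom (free_Abelian_group (B c)) (fob A c) \<and>
      (\<forall>b\<in>B c. h (frag_of b) = far A (arr b) (x (root b)))" if c: "c \<in> Ob C" for c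
  proof -
    interpret comm_group "fob A c" using A c by (simp add: ab_functor_def)
    have "(\<lambda>b. far A (arr b) (x (root b))) ` B c \<subseteq> carrier (fob A c)" using xa[OF c] by blast
    from free_Abelian_group_universal[OF this] show ?thesis by metis
  qed
  then obtain \<psi> where \<psi>: "\<And>c. c \<in> Ob C \<Longrightarrow> \<psi> c \<in> hom (free_Abelian_group (B c)) (fob A c)"
    "\<And>c b. c \<in> Ob C \<Longrightarrow> b \<in> B c \<Longrightarrow> \<psi> c (frag_of b) = far A (arr b) (x (root b))" by metis
  have "\<psi> (Cod C f) (far P f a) = far A f (\<psi> (Dom C f) a)"
    if f: "f \<in> Ar C" and a: "a \<in> carrier (fob P (Dom C f))" for f a
  proof -
    note DC = DomCod[OF f]
    have fA: "far A f \<in> hom (fob A (Dom C f)) (fob A (Cod C f))" using A f by (simp add: ab_functor_def)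
    have "(\<psi> (Cod C f) \<circ> far P f) a = (far A f \<circ> \<psi> (Dom C f)) a"
    proof (rule hom_free_Abelian_group_eqI[where S = "B (Dom C f)" and f = "\<psi> (Cod C f) \<circ> far P f"
          and g = "far A f \<circ> \<psi> (Dom C f)"])
      show "group (fob A (Cod C f))" by (rule ab_functor_group[OF A DC(2)])
      show "\<psi> (Cod C f) \<circ> far P f \<in> hom (free_Abelian_group (B (Dom C f))) (fob A (Cod C f))"
        by (rule hom_compose[OF far_P_hom[OF f] \<psi>(1)[OF DC(2)]])
      show "far A f \<circ> \<psi> (Dom C f) \<in> hom (free_Abelian_group (B (Dom C f))) (fob A (Cod C f))"
        by (rule hom_compose[OF \<psi>(1)[OF DC(1)] fA])
      show "keys a \<subseteq> B (Dom C f)" using a by simp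
      fix b assume b: "b \<in> B (Dom C f)"
      have "far A (Comp C f (arr b)) (x (root b)) = far A f (far A (arr b) (x (root b)))"
        using A arr_in[OF DC(1) b] f x(1)[OF root_in[OF DC(1) b]] by (simp add: ab_functor_def)
      then show "(\<psi> (Cod C f) \<circ> far P f) (frag_of b) = (far A f \<circ> \<psi> (Dom C f)) (frag_of b)"
        using \<psi>(2)[OF DC(2) mv_in[OF f b]] \<psi>(2)[OF DC(1) b] by (simp add: root_mv[OF f b] arr_mv[OF f b])
    qed
    then show ?thesis by simp
  qed
  then have nat: "nat_transf C P A \<psi>" using \<psi>(1) by (simp add: nat_transf_def)
  have "\<pi> c (\<psi> c a) = \<phi> c a" if c: "c \<in> Ob C" and a: "a \<in> carrier (fob P c)" for c a
  proof -
    have "(\<pi> c \<circ> \<psi> c) a = \<phi> c a"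
    proof (rule hom_free_Abelian_group_eqI[where S = "B c" and f = "\<pi> c \<circ> \<psi> c" and g = "\<phi> c"])
      show "group (fob D c)" by (rule ab_functor_group[OF D c])
      show "\<pi> c \<circ> \<psi> c \<in> hom (free_Abelian_group (B c)) (fob D c)"
        by (rule hom_compose[OF \<psi>(1)[OF c] nat_transf_hom[OF \<pi> c]])
      show "\<phi> c \<in> hom (free_Abelian_group (B c)) (fob D c)"
        using nat_transf_hom[OF \<phi> c] by simp
      show "keys a \<subseteq> B c" using a by simp
      fix b assume b: "b \<in> B c"
      note arr = arr_in[OF c b] and j = root_in[OF c b]
      have "\<pi> c (far A (arr b) (x (root b))) = far D (arr b) (\<pi> (ob (root b)) (x (root b)))"
        using nat_transf_naturality[OF \<pi> arr(1)] x(1)[OF j] by (simp add: arr)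
      also have "\<dots> = \<phi> c (far P (arr b) (frag_of (gen (root b))))"
        using nat_transf_naturality[OF \<phi> arr(1), of "frag_of (gen (root b))"] x(2)[OF j] gen_in(2)[OF j]
        by (simp add: arr)
      also have "\<dots> = \<phi> c (frag_of b)" by (simp add: mv_arr[OF c b])
      finally show "(\<pi> c \<circ> \<psi> c) (frag_of b) = \<phi> c (frag_of b)" by (simp add: \<psi>(2)[OF c b])
    qed
    then show ?thesis by simp
  qed
  with nat show "\<exists>\<psi>. nat_transf C P A \<psi> \<and> (\<forall>c\<in>Ob C. \<forall>a\<in>carrier (fob P c). \<pi> c (\<psi> c a) = \<phi> c a)"
    by blast
qed

text \<open>The map that induces the isomorphism from the colimit to the free group on the
  generators. The product is a \<open>gfinprod\<close> because \<open>Ob C\<close> may be infinite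
  while only finitely many components of \<open>u\<close> are nontrivial.\<close>

definition collapse_sum :: "('o \<Rightarrow> 'b \<Rightarrow>\<^sub>0 int) \<Rightarrow> 'j \<Rightarrow>\<^sub>0 int" where
  "collapse_sum u = gfinprod (free_Abelian_group J) (\<lambda>c. frag_extend (frag_of \<circ> root) (u c)) (Ob C)"

lemma collapse_sum_hom: "collapse_sum \<in> hom (big_sum C P) (free_Abelian_group J)"
proof -
  interpret comm_group "free_Abelian_group J" by (rule abelian_free_Abelian_group)
  have "(\<lambda>u. gfinprod (free_Abelian_group J) (\<lambda>c. frag_extend (frag_of \<circ> root) (u c)) (Ob C))
      \<in> hom (big_sum C P) (free_Abelian_group J)"
  proof (rule hom_group_sum)
    fix c assume "c \<in> Ob C"
    then show "frag_extend (frag_of \<circ> root) \<in> hom (fob P c) (free_Abelian_group J)"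
      unfolding fob_P by (intro frag_extend_hom) (simp add: root_in)
  qed simp
  then show ?thesis by (simp add: collapse_sum_def[abs_def])
qed

sublocale S: comm_group "big_sum C P"
  by (rule ab_functor_sum[OF ab_functor_P])

sublocale h: group_hom "big_sum C P" "free_Abelian_group J" collapse_sum
  by (simp add: group_hom_def group_hom_axioms_def S.is_group collapse_sum_hom)

lemma collapse_sum_incl:
  assumes "c \<in> Ob C" "keys a \<subseteq> B c"
  shows "collapse_sum (summand_incl C P c a) = frag_extend (frag_of \<circ> root) a"
proof -
  interpret comm_group "free_Abelian_group J" by (rule abelian_free_Abelian_group)
  let ?f = "\<lambda>i. frag_extend (frag_of \<circ> root) (summand_incl C P c a i)"
  have a: "frag_extend (frag_of \<circ> root) a \<in> carrier (free_Abelian_group J)"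
    using assms(2) keys_frag_extend[of "frag_of \<circ> root" a] root_in[OF assms(1)] by fastforce
  have "gfinprod (free_Abelian_group J) ?f (Ob C) = gfinprod (free_Abelian_group J) ?f {c}"
    by (rule gfinprod_mono_neutral_cong_right) (use assms a in \<open>auto simp: summand_incl_def\<close>)
  also have "\<dots> = ?f c"
    using assms a by (subst gfinprod_eq_finprod) (auto simp: summand_incl_def)
  finally show ?thesis using assms by (simp add: collapse_sum_def summand_incl_def)
qed

text \<open>Translation keeps the root, so relations are killed. Conversely, sending
  \<open>j\<close> to the class of its generator gives \<open>\<psi>\<close> with
  \<open>\<psi> \<circ> collapse_sum\<close> equal to the quotient map, since \<open>arr b\<close>
  relates \<open>b\<close> to the generator of its root; hence a vanishing collapse forces a trivial
  class.\<close>

lemma kernel_collapse_sum: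
  "kernel (big_sum C P) (free_Abelian_group J) collapse_sum = colim_rel C P"
proof
  let ?S = "big_sum C P"
  show "colim_rel C P \<subseteq> kernel ?S (free_Abelian_group J) collapse_sum"
    unfolding colim_rel_def Let_def
  proof (rule S.generate_subgroup_incl[OF _ h.subgroup_kernel], safe)
    fix f a assume f: "f \<in> Ar C" and a: "a \<in> carrier (fob P (Dom C f))"
    note DC = DomCod[OF f]
    have fa: "far P f a \<in> carrier (fob P (Cod C f))" by (rule far_closed[OF ab_functor_P f a])
    have "frag_extend (frag_of \<circ> root) (far P f a) = frag_extend ((frag_of \<circ> root) \<circ> mv f) a"
      by (simp add: frag_extend_compose)
    also have "\<dots> = frag_extend (frag_of \<circ> root) a"
      by (rule frag_extend_eq) (use a root_mv[OF f] in auto)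
    finally have eq: "collapse_sum (summand_incl C P (Cod C f) (far P f a)) =
        collapse_sum (summand_incl C P (Dom C f) a)"
      using a fa by (simp add: collapse_sum_incl DC del: far_P)
    have i: "summand_incl C P (Cod C f) (far P f a) \<in> carrier ?S" "summand_incl C P (Dom C f) a \<in> carrier ?S"
      by (rule summand_incl_closed[OF ab_functor_P DC(2) fa], rule summand_incl_closed[OF ab_functor_P DC(1) a])
    have "collapse_sum (summand_incl C P (Cod C f) (far P f a) \<otimes>\<^bsub>?S\<^esub> inv\<^bsub>?S\<^esub> summand_incl C P (Dom C f) a) =
        \<one>\<^bsub>free_Abelian_group J\<^esub>"
      using h.hom_mult[OF i(1) S.inv_closed[OF i(2)]] h.hom_inv[OF i(2)]
        group.r_inv[OF group_free_Abelian_group h.hom_closed[OF i(2)]] eq by metis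
    then show "summand_incl C P (Cod C f) (far P f a) \<otimes>\<^bsub>?S\<^esub> inv\<^bsub>?S\<^esub> summand_incl C P (Dom C f) a
        \<in> kernel ?S (free_Abelian_group J) collapse_sum"
      unfolding kernel_def using S.m_closed[OF i(1) S.inv_closed[OF i(2)]] by blast
  qed
  show "kernel ?S (free_Abelian_group J) collapse_sum \<subseteq> colim_rel C P"
  proof
    interpret Q: comm_group "colim C P" by (rule comm_group_colim[OF C ab_functor_P])
    let ?R = "\<lambda>u. colim_rel C P #>\<^bsub>?S\<^esub> u"
    have R: "?R \<in> hom ?S (colim C P)"
      unfolding colim_def
      by (rule normal.r_coset_hom_Mod[OF S.subgroup_imp_normal[OF colim_rel_subgroup[OF C ab_functor_P]]])
    have gi: "summand_incl C P (ob j) (frag_of (gen j)) \<in> carrier ?S" if "j \<in> J" for j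
      by (rule summand_incl_closed[OF ab_functor_P gen_in(1)[OF that]]) (use gen_in(2)[OF that] in simp)
    then have "(\<lambda>j. ?R (summand_incl C P (ob j) (frag_of (gen j)))) ` J \<subseteq> carrier (colim C P)"
      using coset_in_colim by blast
    then obtain \<psi> where \<psi>: "\<psi> \<in> hom (free_Abelian_group J) (colim C P)"
      "\<And>j. j \<in> J \<Longrightarrow> \<psi> (frag_of j) = ?R (summand_incl C P (ob j) (frag_of (gen j)))"
      by (rule Q.free_Abelian_group_universal) blast
    fix u assume "u \<in> kernel ?S (free_Abelian_group J) collapse_sum"
    then have u: "u \<in> carrier ?S" "collapse_sum u = 0" by (auto simp: kernel_def)
    have "(\<psi> \<circ> collapse_sum) u = ?R u"
    proof (rule hom_sum_group_eqI[OF ab_functor_P Q.is_group hom_compose[OF collapse_sum_hom \<psi>(1)] R _ u(1)])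
      fix c a assume c: "c \<in> Ob C" and a: "a \<in> carrier (fob P c)"
      have "((\<psi> \<circ> collapse_sum) \<circ> summand_incl C P c) a = (?R \<circ> summand_incl C P c) a"
      proof (rule hom_free_Abelian_group_eqI[where S = "B c" and f = "(\<psi> \<circ> collapse_sum) \<circ> summand_incl C P c"
            and g = "?R \<circ> summand_incl C P c", OF Q.is_group])
        have i: "summand_incl C P c \<in> hom (free_Abelian_group (B c)) ?S"
          using summand_incl_hom[OF ab_functor_P c] by simp
        show "(\<psi> \<circ> collapse_sum) \<circ> summand_incl C P c \<in> hom (free_Abelian_group (B c)) (colim C P)"
          by (rule hom_compose[OF i hom_compose[OF collapse_sum_hom \<psi>(1)]])
        show "?R \<circ> summand_incl C P c \<in> hom (free_Abelian_group (B c)) (colim C P)"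
          by (rule hom_compose[OF i R])
        show "keys a \<subseteq> B c" using a by simp
        fix b assume b: "b \<in> B c"
        note j = root_in[OF c b] and arr = arr_in[OF c b]
        let ?g = "summand_incl C P (ob (root b)) (frag_of (gen (root b)))"
        let ?b = "summand_incl C P c (frag_of b)"
        have bS: "?b \<in> carrier ?S" by (rule summand_incl_closed[OF ab_functor_P c]) (use b in simp)
        have "summand_incl C P (Cod C (arr b)) (far P (arr b) (frag_of (gen (root b)))) \<otimes>\<^bsub>?S\<^esub>
            inv\<^bsub>?S\<^esub> summand_incl C P (Dom C (arr b)) (frag_of (gen (root b))) \<in> colim_rel C P"
          unfolding colim_rel_def Let_def
        proof (rule generate.incl, rule CollectI, intro exI conjI)
          show "frag_of (gen (root b)) \<in> carrier (fob P (Dom C (arr b)))"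
            using gen_in(2)[OF j] by (simp add: arr)
        qed (rule HOL.refl arr)+
        then have rel: "?b \<otimes>\<^bsub>?S\<^esub> inv\<^bsub>?S\<^esub> ?g \<in> colim_rel C P"
          by (simp add: arr mv_arr[OF c b] del: mult_sum_group inv_sum_group)
        have "?b = (?b \<otimes>\<^bsub>?S\<^esub> inv\<^bsub>?S\<^esub> ?g) \<otimes>\<^bsub>?S\<^esub> ?g"
          using bS gi[OF j] by (simp add: S.m_assoc del: mult_sum_group inv_sum_group one_sum_group)
        with rel have "?b \<in> ?R ?g" unfolding r_coset_def by blast
        then have "?R ?g = ?R ?b"
          by (rule S.repr_independence[OF _ gi[OF j] colim_rel_subgroup[OF C ab_functor_P]])
        then show "((\<psi> \<circ> collapse_sum) \<circ> summand_incl C P c) (frag_of b) = (?R \<circ> summand_incl C P c) (frag_of b)"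
          using b by (simp add: collapse_sum_incl[OF c] \<psi>(2)[OF j])
      qed
      then show "(\<psi> \<circ> collapse_sum) (summand_incl C P c a) = ?R (summand_incl C P c a)" by simp
    qed
    moreover have "\<psi> 0 = \<one>\<^bsub>colim C P\<^esub>"
      using hom_one[OF \<psi>(1) group_free_Abelian_group Q.is_group] by simp
    ultimately have "?R u = colim_rel C P" using u(2) by (simp add: colim_def)
    then show "u \<in> colim_rel C P"
      using S.coset_join1[OF _ u(1) colim_rel_subgroup[OF C ab_functor_P]] by blast
  qed
qed

text \<open>The induced map on cosets, in the form produced by \<open>FactGroup_iso_set\<close>; the
  image is a singleton because \<open>collapse_sum\<close> is constant on each coset.\<close>

definition colim_collapse :: "('o \<Rightarrow> 'b \<Rightarrow>\<^sub>0 int) set \<Rightarrow> 'j \<Rightarrow>\<^sub>0 int" where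
  "colim_collapse X = the_elem (collapse_sum ` X)"

lemma colim_collapse_coset:
  assumes u: "u \<in> carrier (big_sum C P)"
  shows "colim_collapse (colim_rel C P #>\<^bsub>big_sum C P\<^esub> u) = collapse_sum u"
proof -
  let ?S = "big_sum C P"
  have "collapse_sum v = collapse_sum u" if v: "v \<in> colim_rel C P #>\<^bsub>?S\<^esub> u" for v
  proof -
    obtain w where w: "w \<in> colim_rel C P" "v = w \<otimes>\<^bsub>?S\<^esub> u" using v unfolding r_coset_def by blast
    then have "w \<in> carrier ?S" "collapse_sum w = 0"
      unfolding kernel_collapse_sum[symmetric] by (auto simp: kernel_def)
    then show ?thesis unfolding w(2) using h.hom_mult[OF _ u] by simp
  qed
  moreover have "u \<in> colim_rel C P #>\<^bsub>?S\<^esub> u"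
    by (rule S.rcos_self[OF u colim_rel_subgroup[OF C ab_functor_P]])
  ultimately have "collapse_sum ` (colim_rel C P #>\<^bsub>?S\<^esub> u) = {collapse_sum u}" by blast
  then show ?thesis by (simp add: colim_collapse_def)
qed

lemma colim_collapse_iso: "colim_collapse \<in> iso (colim C P) (free_Abelian_group J)"
proof -
  let ?S = "big_sum C P"
  have "x \<in> collapse_sum ` carrier ?S" if x: "keys x \<subseteq> J" for x
  proof (rule free_Abelian_group_induct[OF x])
    show "0 \<in> collapse_sum ` carrier ?S"
      using h.hom_one S.one_closed by (metis imageI one_free_Abelian_group)
  next
    fix x y assume 2: "keys x \<subseteq> J" "keys y \<subseteq> J"
      "x \<in> collapse_sum ` carrier ?S" "y \<in> collapse_sum ` carrier ?S"
    then obtain u v where uv: "u \<in> carrier ?S" "v \<in> carrier ?S" "x = collapse_sum u" "y = collapse_sum v"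
      by blast
    then have "x - y = collapse_sum (u \<otimes>\<^bsub>?S\<^esub> inv\<^bsub>?S\<^esub> v)"
      using h.hom_mult[OF uv(1) S.inv_closed[OF uv(2)]] h.hom_inv[OF uv(2)] 2 by simp
    then show "x - y \<in> collapse_sum ` carrier ?S" using uv S.m_closed S.inv_closed by blast
  next
    fix j assume 3: "j \<in> J"
    have "collapse_sum (summand_incl C P (ob j) (frag_of (gen j))) = frag_of j"
      using gen_in[OF 3] by (simp add: collapse_sum_incl root_gen[OF 3])
    moreover have "summand_incl C P (ob j) (frag_of (gen j)) \<in> carrier ?S"
      by (rule summand_incl_closed[OF ab_functor_P gen_in(1)[OF 3]]) (use gen_in(2)[OF 3] in simp)
    ultimately show "frag_of j \<in> collapse_sum ` carrier ?S" by (metis imageI)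
  qed
  then have "collapse_sum ` carrier ?S = carrier (free_Abelian_group J)"
    using h.hom_closed by auto
  from h.FactGroup_iso_set[OF this] show ?thesis
    by (simp add: kernel_collapse_sum colim_def colim_collapse_def[abs_def])
qed

end

text \<open>Stated outside the locale because two based functors over one category take part. It
  reduces the map of colimits to a check on basis elements.\<close>

lemma colim_collapse_colim_map:
  fixes \<eta> :: "'o \<Rightarrow> ('b \<Rightarrow>\<^sub>0 int) \<Rightarrow> ('d \<Rightarrow>\<^sub>0 int)" and C :: "('o, 'a) small_cat"
  assumes "based_functor C B mv J ob gen root arr" and "based_functor C B' mv' J' ob' gen' root' arr'"
    and \<eta>: "nat_transf C (free_functor B mv) (free_functor B' mv') \<eta>"
    and \<theta>: "\<theta> \<in> hom (free_Abelian_group J) (free_Abelian_group J')"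
    and eq: "\<And>c b. c \<in> Ob C \<Longrightarrow> b \<in> B c \<Longrightarrow>
      frag_extend (frag_of \<circ> root') (\<eta> c (frag_of b)) = \<theta> (frag_of (root b))"
    and x: "x \<in> carrier (colim C (free_functor B mv))"
  shows "based_functor.colim_collapse C J' root' (colim_map C (free_functor B mv) (free_functor B' mv') \<eta> x) =
    \<theta> (based_functor.colim_collapse C J root x)"
proof -
  interpret F: based_functor C B mv J ob gen root arr by fact
  interpret G: based_functor C B' mv' J' ob' gen' root' arr' by fact
  obtain u where u: "u \<in> carrier (big_sum C F.P)"
    "x = colim_rel C F.P #>\<^bsub>big_sum C F.P\<^esub> u" using x by (rule carrier_colimE)
  note sm = nat_transf_sum_hom[OF F.ab_functor_P G.ab_functor_P \<eta>]
  have v: "sum_map C \<eta> u \<in> carrier (big_sum C G.P)"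
    using sm u(1) unfolding hom_def by blast
  have "(G.collapse_sum \<circ> sum_map C \<eta>) u = (\<theta> \<circ> F.collapse_sum) u"
  proof (rule hom_sum_group_eqI[OF F.ab_functor_P group_free_Abelian_group
        hom_compose[OF sm G.collapse_sum_hom] hom_compose[OF F.collapse_sum_hom \<theta>] _ u(1)])
    fix c a assume c: "c \<in> Ob C" and a: "a \<in> carrier (fob F.P c)"
    have \<eta>c: "\<eta> c \<in> hom (free_Abelian_group (B c)) (free_Abelian_group (B' c))"
      using nat_transf_hom[OF \<eta> c] by simp
    have "(frag_extend (frag_of \<circ> root') \<circ> \<eta> c) a = (\<theta> \<circ> frag_extend (frag_of \<circ> root)) a"
    proof (rule hom_free_Abelian_group_eqI[where S = "B c" and f = "frag_extend (frag_of \<circ> root') \<circ> \<eta> c"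
          and g = "\<theta> \<circ> frag_extend (frag_of \<circ> root)", OF group_free_Abelian_group])
      have "frag_extend (frag_of \<circ> root') \<in> hom (free_Abelian_group (B' c)) (free_Abelian_group J')"
        by (rule frag_extend_hom) (use G.root_in[OF c] in simp)
      then show "frag_extend (frag_of \<circ> root') \<circ> \<eta> c \<in> hom (free_Abelian_group (B c)) (free_Abelian_group J')"
        by (rule hom_compose[OF \<eta>c])
      have "frag_extend (frag_of \<circ> root) \<in> hom (free_Abelian_group (B c)) (free_Abelian_group J)"
        by (rule frag_extend_hom) (use F.root_in[OF c] in simp)
      then show "\<theta> \<circ> frag_extend (frag_of \<circ> root) \<in> hom (free_Abelian_group (B c)) (free_Abelian_group J')"
        by (rule hom_compose[OF _ \<theta>])
    qed (use a eq[OF c] in simp_all)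
    moreover have "\<eta> c a \<in> carrier (free_Abelian_group (B' c))" using nat_transf_closed[OF \<eta> c a] by simp
    ultimately show "(G.collapse_sum \<circ> sum_map C \<eta>) (summand_incl C F.P c a) =
        (\<theta> \<circ> F.collapse_sum) (summand_incl C F.P c a)"
      using a sum_map_summand_incl[OF F.ab_functor_P G.ab_functor_P \<eta>]
      by (simp add: F.collapse_sum_incl[OF c] G.collapse_sum_incl[OF c])
  qed
  then show ?thesis
    unfolding u(2) colim_map_coset[OF F.C F.ab_functor_P G.ab_functor_P \<eta> u(1)]
      F.colim_collapse_coset[OF u(1)] G.colim_collapse_coset[OF v] by simp
qed

section \<open>Incidence signs\<close>

lemma frag_extend_sum_all: "frag_extend f (\<Sum>i\<in>I. g i) = (\<Sum>i\<in>I. frag_extend f (g i))"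
  by (cases "finite I") (simp_all add: frag_extend_sum comp_def)

lemma frag_cmul_diff: "frag_cmul k (a - b) = frag_cmul k a - frag_cmul k b"
  by (rule poly_mapping_eqI) (simp add: lookup_minus right_diff_distrib)

lemma frag_cmul_minus: "frag_cmul k (- a) = frag_cmul (- k) a"
  by (rule poly_mapping_eqI) simp

text \<open>The sign in \<open>simplex_boundary\<close>. As only elements other than
  \<open>e\<close> are counted, it also makes sense for \<open>e\<close> outside \<open>S\<close>,
  where it is the sign of \<open>e\<close> in \<open>insert e S\<close>; the contraction below uses
  it so.\<close>

definition incidence :: "('e \<times> 'e) set \<Rightarrow> 'e set \<Rightarrow> 'e \<Rightarrow> int" where
  "incidence r S e = (-1) ^ card {u \<in> S. u \<noteq> e \<and> (u, e) \<in> r}"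

lemma incidence_square [simp]: "incidence r S e * incidence r S e = 1"
  by (simp add: incidence_def flip: power_add mult_2)

lemma incidence_insert_self [simp]: "incidence r (insert e S) e = incidence r S e"
  unfolding incidence_def by (rule arg_cong[where f = "\<lambda>A. (-1) ^ card A"]) auto

text \<open>Deleting the larger of the two elements leaves the position of the smaller one alone,
  whereas deleting the smaller one lowers the position of the larger one by 1.\<close>

lemma incidence_face:
  assumes r: "linear_order_on E r" and S: "finite S" "S \<subseteq> E" and ef: "e \<in> S" "f \<in> S" "e \<noteq> f"
  shows "incidence r S e * incidence r (S - {e}) f = - (incidence r S f * incidence r (S - {f}) e)"
proof -
  have *: "incidence r S e * incidence r (S - {e}) f = - (incidence r S f * incidence r (S - {f}) e)"
    if "(e, f) \<in> r" "e \<in> S" "f \<in> S" "e \<noteq> f" for e f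
  proof -
    have nr: "(f, e) \<notin> r"
      using r that by (auto simp: linear_order_on_def partial_order_on_def antisym_def)
    have "{u \<in> S - {f}. u \<noteq> e \<and> (u, e) \<in> r} = {u \<in> S. u \<noteq> e \<and> (u, e) \<in> r}" using nr by auto
    then have 1: "incidence r (S - {f}) e = incidence r S e" by (simp add: incidence_def)
    have "{u \<in> S. u \<noteq> f \<and> (u, f) \<in> r} = insert e {u \<in> S - {e}. u \<noteq> f \<and> (u, f) \<in> r}"
      using that by auto
    then have "incidence r S f = - incidence r (S - {e}) f" using S(1) by (simp add: incidence_def)
    then show ?thesis using 1 by simp
  qed
  have "(e, f) \<in> r \<or> (f, e) \<in> r" using r S(2) ef by (auto simp: linear_order_on_def total_on_def)
  then show ?thesis using *[of e f] *[of f e] ef by auto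
qed

lemma frag_eq_minus:
  fixes z :: "'b \<Rightarrow>\<^sub>0 int"
  assumes "z = - z"
  shows "z = 0"
proof (rule poly_mapping_eqI)
  fix k
  have "Poly_Mapping.lookup z k = - Poly_Mapping.lookup z k" using assms by (metis lookup_uminus)
  then show "Poly_Mapping.lookup z k = Poly_Mapping.lookup 0 k" by simp
qed

text \<open>Exchanging \<open>e\<close> and \<open>f\<close> reverses every sign, so the sum equals
  its own negative, and free abelian groups have no 2-torsion. With a general symmetric
  \<open>G\<close> it covers both cubes and simplices.\<close>

lemma double_face_sum:
  assumes r: "linear_order_on E r" and S: "finite S" "S \<subseteq> E"
    and G: "\<And>e f. e \<in> S \<Longrightarrow> f \<in> S \<Longrightarrow> e \<noteq> f \<Longrightarrow> G e f = G f e"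
  shows "(\<Sum>e\<in>S. frag_cmul (incidence r S e) (\<Sum>f\<in>S - {e}. frag_cmul (incidence r (S - {e}) f) (G e f))) = 0"
    (is "?T = 0")
proof -
  let ?D = "Sigma S (\<lambda>e. S - {e})"
  let ?g = "\<lambda>(e, f). frag_cmul (incidence r S e * incidence r (S - {e}) f) (G e f)"
  have T: "?T = sum ?g ?D"
    using S(1) by (simp add: frag_cmul_sum sum.Sigma)
  also have "\<dots> = sum (?g \<circ> prod.swap) ?D"
    by (rule sum.reindex_bij_witness[of _ prod.swap prod.swap]) auto
  also have "\<dots> = sum (\<lambda>x. - ?g x) ?D"
  proof (rule sum.cong[OF HOL.refl])
    fix x assume "x \<in> ?D"
    then obtain e f where "x = (e, f)" "e \<in> S" "f \<in> S" "e \<noteq> f" by auto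
    then show "(?g \<circ> prod.swap) x = - ?g x"
      using incidence_face[OF r S, of e f] G[of e f] by simp
  qed
  also have "\<dots> = - ?T" by (simp add: T sum_negf)
  finally show ?thesis by (rule frag_eq_minus)
qed

section \<open>The cubical resolution\<close>

type_synonym ('x, 'e) cube = "('x \<times> 'e list set \<times> 'x) list"

text \<open>A cube with corner \<open>x\<close>, sides \<open>S\<close> and remaining trace \<open>p\<close>, as an element of the type from
  which the resolutions in the definition of the derived functors take their basis elements.\<close>

definition cube :: "'x \<Rightarrow> 'e set \<Rightarrow> 'e list set \<Rightarrow> ('x, 'e) cube" where
  "cube x S p = [(x, (\<lambda>e. [e]) ` S, x), (x, p, x)]"

definition corner :: "('x, 'e) cube \<Rightarrow> 'x" where
  "corner b = fst (b ! 0)"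

text \<open>The middle entry of a triple has the type of traces, so \<open>S\<close> is stored there
  as a set of one-letter words. This entry is only a container and need not be a trace.\<close>

definition sides :: "('x, 'e) cube \<Rightarrow> 'e set" where
  "sides b = {e. [e] \<in> fst (snd (b ! 0))}"

definition tail :: "('x, 'e) cube \<Rightarrow> 'e list set" where
  "tail b = fst (snd (b ! 1))"

lemma cube_select [simp]:
  "corner (cube x S p) = x" "sides (cube x S p) = S" "tail (cube x S p) = p"
  by (auto simp: cube_def corner_def sides_def tail_def)

text \<open>Pushing all basis elements to one point makes additivity immediate, with no bookkeeping
  of changing supports.\<close>

definition coeff_sum :: "('b \<Rightarrow>\<^sub>0 int) \<Rightarrow> int" where
  "coeff_sum z = Poly_Mapping.lookup (frag_extend (\<lambda>_. frag_of ()) z) ()"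

lemma coeff_sum_simps [simp]:
  "coeff_sum (a + b) = coeff_sum a + coeff_sum b" "coeff_sum (a - b) = coeff_sum a - coeff_sum b"
  "coeff_sum (frag_cmul k a) = k * coeff_sum a" "coeff_sum (frag_of i) = 1" "coeff_sum 0 = 0"
  by (simp_all add: coeff_sum_def frag_extend_add frag_extend_diff frag_extend_cmul lookup_add lookup_minus)

lemma coeff_sum_sum: "coeff_sum (\<Sum>i\<in>I. g i) = (\<Sum>i\<in>I. coeff_sum (g i))"
  by (induction I rule: infinite_finite_induct) auto

lemma frag_additive_eqI:
  assumes "keys z \<subseteq> S" "f 0 = g 0"
    and "\<And>a b. f (a - b) = f a - f b" "\<And>a b. g (a - b) = g a - g b"
    and "\<And>b. b \<in> S \<Longrightarrow> f (frag_of b) = g (frag_of b)"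
  shows "f z = (g z :: 'c :: ab_group_add)"
  using assms(1) by (induction rule: frag_induction) (use assms in auto)

locale trace_action_system = commutation E I for E :: "'e set" and I +
  fixes r :: "('e \<times> 'e) set" and X :: "('x, 'e list set) rset"
  assumes r: "linear_order_on E r" and X: "right_pointed_set M X"
begin

abbreviation C where "C \<equiv> K_cat M X"

abbreviation step where "step x e \<equiv> act X x (letter E I e)"

lemma act_closed [simp]: "x \<in> points X \<Longrightarrow> p \<in> carrier M \<Longrightarrow> act X x p \<in> points X"
  and act_one [simp]: "x \<in> points X \<Longrightarrow> act X x \<one>\<^bsub>M\<^esub> = x"
  and act_mult: "x \<in> points X \<Longrightarrow> p \<in> carrier M \<Longrightarrow> q \<in> carrier M \<Longrightarrow>
    act X x (p \<otimes>\<^bsub>M\<^esub> q) = act X (act X x p) q"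
  using X by (auto simp: right_pointed_set_def)

lemma step_remainder:
  "x \<in> points X \<Longrightarrow> e \<in> initials E I p \<Longrightarrow> act X (step x e) (remainder E I e p) = act X x p"
  using act_mult[of x "letter E I e" "remainder E I e p"]
  by (simp add: remainder_closed letter_remainder initials_subset)

lemma step_commute:
  assumes "x \<in> points X" "(e, f) \<in> I" "e \<in> E" "f \<in> E"
  shows "step (step x e) f = step (step x f) e"
  using letter_commute[OF assms(2-4) one_closed] assms by (simp flip: act_mult)

text \<open>The object \<open>y\<close> is where \<open>p\<close> leads from \<open>x\<close>. Front
  faces replace \<open>x\<close> and \<open>p\<close> by x e and the remainder of \<open>p\<close>,
  which leads to the same \<open>y\<close>, and arrows out of \<open>y\<close> act by prolonging
  \<open>p\<close>.\<close>

definition cubes :: "nat \<Rightarrow> 'x \<Rightarrow> ('x, 'e) cube set" where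
  "cubes n y = {cube x S p |x S p. x \<in> points X \<and> p \<in> carrier M \<and> act X x p = y \<and>
     finite S \<and> S \<subseteq> initials E I p \<and> card S = n}"

lemma cubesE:
  assumes "b \<in> cubes n y"
  obtains x S p where "b = cube x S p" "x \<in> points X" "p \<in> carrier M" "act X x p = y"
    "finite S" "S \<subseteq> initials E I p" "card S = n"
  using assms by (auto simp: cubes_def)

lemma cube_in_cubes:
  "x \<in> points X \<Longrightarrow> p \<in> carrier M \<Longrightarrow> act X x p = y \<Longrightarrow> finite S \<Longrightarrow> S \<subseteq> initials E I p \<Longrightarrow> card S = n \<Longrightarrow>
    cube x S p \<in> cubes n y"
  by (auto simp: cubes_def)

section \<open>Faces and the boundary of cubes\<close>

definition back_face :: "(('x, 'e) cube \<Rightarrow>\<^sub>0 int) \<Rightarrow> (('x, 'e) cube \<Rightarrow>\<^sub>0 int)" where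
  "back_face = frag_extend (\<lambda>b. \<Sum>e\<in>sides b. frag_cmul (incidence r (sides b) e)
     (frag_of (cube (corner b) (sides b - {e}) (tail b))))"

definition front_face :: "(('x, 'e) cube \<Rightarrow>\<^sub>0 int) \<Rightarrow> (('x, 'e) cube \<Rightarrow>\<^sub>0 int)" where
  "front_face = frag_extend (\<lambda>b. \<Sum>e\<in>sides b. frag_cmul (incidence r (sides b) e)
     (frag_of (cube (step (corner b) e) (sides b - {e}) (remainder E I e (tail b)))))"

definition bd :: "(('x, 'e) cube \<Rightarrow>\<^sub>0 int) \<Rightarrow> (('x, 'e) cube \<Rightarrow>\<^sub>0 int)" where
  "bd z = front_face z - back_face z"

lemma back_cube: "back_face (frag_of (cube x S p)) =
    (\<Sum>e\<in>S. frag_cmul (incidence r S e) (frag_of (cube x (S - {e}) p)))"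
  and front_cube: "front_face (frag_of (cube x S p)) =
    (\<Sum>e\<in>S. frag_cmul (incidence r S e) (frag_of (cube (step x e) (S - {e}) (remainder E I e p))))"
  by (simp_all add: back_face_def front_face_def)

lemma bd_cube: "bd (frag_of (cube x S p)) =
    (\<Sum>e\<in>S. frag_cmul (incidence r S e)
      (frag_of (cube (step x e) (S - {e}) (remainder E I e p)) - frag_of (cube x (S - {e}) p)))"
  by (simp add: bd_def back_cube front_cube frag_cmul_diff sum_subtractf)

lemma bd_simps [simp]:
  "bd 0 = 0" "bd (- a) = - bd a" "bd (a - b) = bd a - bd b" "bd (a + b) = bd a + bd b"
  "bd (frag_cmul k a) = frag_cmul k (bd a)" "bd (\<Sum>i\<in>A. g i) = (\<Sum>i\<in>A. bd (g i))"
  by (simp_all add: bd_def back_face_def front_face_def frag_extend_minus frag_extend_diff frag_extend_add frag_extend_cmul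
      frag_extend_sum_all frag_cmul_diff sum_subtractf)

lemma face_in_cubes:
  assumes "x \<in> points X" "p \<in> carrier M" "act X x p = y" "finite S" "S \<subseteq> initials E I p" "card S = Suc n" "e \<in> S"
  shows "cube x (S - {e}) p \<in> cubes n y"
    and "cube (step x e) (S - {e}) (remainder E I e p) \<in> cubes n y"
proof -
  have e: "e \<in> initials E I p" using assms by blast
  show "cube x (S - {e}) p \<in> cubes n y" using assms by (intro cube_in_cubes) auto
  show "cube (step x e) (S - {e}) (remainder E I e p) \<in> cubes n y"
  proof (rule cube_in_cubes)
    show "S - {e} \<subseteq> initials E I (remainder E I e p)"
      using initials_independent(2)[OF e] assms(5) by auto
  qed (use assms step_remainder[OF assms(1) e] remainder_closed[OF e] initials_subset[OF e] in simp_all)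
qed

lemma keys_bd:
  assumes "keys z \<subseteq> cubes (Suc n) y"
  shows "keys (bd z) \<subseteq> cubes n y"
  using assms
proof (induction rule: frag_induction)
  case (one b)
  then obtain x S p where b: "b = cube x S p" "x \<in> points X" "p \<in> carrier M" "act X x p = y"
    "finite S" "S \<subseteq> initials E I p" "card S = Suc n" by (rule cubesE)
  have "keys (frag_cmul (incidence r S e)
      (frag_of (cube (step x e) (S - {e}) (remainder E I e p)) - frag_of (cube x (S - {e}) p))) \<subseteq> cubes n y"
    if "e \<in> S" for e
    using face_in_cubes[OF b(2-7) that] by (intro order_trans[OF keys_cmul] order_trans[OF keys_diff]) auto
  then show ?case unfolding b(1) bd_cube by (intro order_trans[OF keys_sum]) blast
next
  case (diff a b)
  then show ?case using keys_diff[of "bd a" "bd b"] by auto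
qed simp

lemma bd_bd:
  assumes "keys z \<subseteq> cubes n y"
  shows "bd (bd z) = 0"
  using assms
proof (induction rule: frag_induction)
  case (one b)
  then obtain x S p where b: "b = cube x S p" "x \<in> points X" "p \<in> carrier M" "act X x p = y"
    "finite S" "S \<subseteq> initials E I p" "card S = n" by (rule cubesE)
  have SE: "S \<subseteq> E" using b(6) initials_subset by blast
  \<comment> \<open>The four combinations of front and back faces in the directions \<open>e\<close>
    and \<open>f\<close>. The whole is symmetric because the letters commute, although the two mixed
    terms are exchanged.\<close>
  let ?G = "\<lambda>e f. frag_of (cube (step (step x e) f) (S - {e} - {f}) (remainder E I f (remainder E I e p)))
      - frag_of (cube (step x e) (S - {e} - {f}) (remainder E I e p))
      - frag_of (cube (step x f) (S - {e} - {f}) (remainder E I f p))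
      + frag_of (cube x (S - {e} - {f}) p)"
  have "bd (bd (frag_of b)) = (\<Sum>e\<in>S. frag_cmul (incidence r S e)
      (\<Sum>f\<in>S - {e}. frag_cmul (incidence r (S - {e}) f) (?G e f)))"
    unfolding b(1) by (simp add: bd_cube frag_cmul_diff frag_cmul_distrib2 sum_subtractf sum.distrib
        algebra_simps)
  also have "\<dots> = 0"
  proof (rule double_face_sum[OF r b(5) SE])
    fix e f assume ef: "e \<in> S" "f \<in> S" "e \<noteq> f"
    then have i: "e \<in> initials E I p" "f \<in> initials E I p" using b(6) by auto
    have "S - {e} - {f} = S - {f} - {e}" by auto
    then show "?G e f = ?G f e"
      using step_commute[OF b(2) initials_independent(1)[OF i ef(3)]]
        initials_independent(3)[OF i ef(3)] i[THEN initials_subset] by simp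
  qed
  finally show ?case .
qed simp_all

text \<open>Adding a chosen initial letter to the sides is a contracting homotopy for \<open>back_face\<close>, whereas
  \<open>front_face\<close> shortens the trace.\<close>

definition first_letter :: "'e list set \<Rightarrow> 'e" where
  "first_letter p = (SOME a. a \<in> initials E I p)"

definition contraction ::
    "(('x, 'e) cube \<Rightarrow>\<^sub>0 int) \<Rightarrow> (('x, 'e) cube \<Rightarrow>\<^sub>0 int)" where
  "contraction = frag_extend (\<lambda>b.
     let a = first_letter (tail b) in
     if trace_length (tail b) = 0 \<or> a \<in> sides b then 0
     else frag_cmul (incidence r (sides b) a) (frag_of (cube (corner b) (insert a (sides b)) (tail b))))"

lemma contraction_cube: "contraction (frag_of (cube x S p)) =
    (if trace_length p = 0 \<or> first_letter p \<in> S then 0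
     else frag_cmul (incidence r S (first_letter p)) (frag_of (cube x (insert (first_letter p) S) p)))"
  by (simp add: contraction_def Let_def)

lemma contraction_simps [simp]:
  "contraction 0 = 0" "contraction (a - b) = contraction a - contraction b"
  "contraction (a + b) = contraction a + contraction b"
  "contraction (frag_cmul k a) = frag_cmul k (contraction a)"
  "contraction (\<Sum>i\<in>A. g i) = (\<Sum>i\<in>A. contraction (g i))"
  by (simp_all add: contraction_def frag_extend_diff frag_extend_add frag_extend_cmul frag_extend_sum_all)

lemma first_letter_initial:
  "p \<in> carrier M \<Longrightarrow> trace_length p > 0 \<Longrightarrow> first_letter p \<in> initials E I p"
  by (simp add: first_letter_def some_in_eq initials_nonempty)

lemma keys_contraction:
  assumes "keys z \<subseteq> cubes n y"
  shows "keys (contraction z) \<subseteq> cubes (Suc n) y"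
  using assms
proof (induction rule: frag_induction)
  case (one b)
  then obtain x S p where b: "b = cube x S p" "x \<in> points X" "p \<in> carrier M" "act X x p = y"
    "finite S" "S \<subseteq> initials E I p" "card S = n" by (rule cubesE)
  have "cube x (insert (first_letter p) S) p \<in> cubes (Suc n) y"
    if "trace_length p > 0" "first_letter p \<notin> S"
    using b that first_letter_initial[OF b(3)] by (intro cube_in_cubes) auto
  then show ?case
    unfolding b(1) contraction_cube by (auto simp: keys_cmul_iff dest: subsetD[OF keys_cmul])
next
  case (diff a b)
  then show ?case using keys_diff[of "contraction a" "contraction b"] by auto
qed simp

text \<open>Cone homotopy of a simplex with apex \<open>first_letter p\<close>. If the apex is a
  side, only the face opposite to it survives the contraction and returns the cube. Otherwise the
  face opposite to the apex returns the cube and all other faces cancel.\<close>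

lemma back_contraction:
  assumes p: "p \<in> carrier M" "trace_length p > 0" and S: "finite S" "S \<subseteq> initials E I p"
  shows "back_face (contraction (frag_of (cube x S p))) + contraction (back_face (frag_of (cube x S p))) =
    frag_of (cube x S p)"
proof -
  let ?a = "first_letter p"
  have a: "?a \<in> initials E I p" by (rule first_letter_initial[OF p])
  have SE: "insert ?a S \<subseteq> E" using S(2) a initials_subset by blast
  show ?thesis
  proof (cases "?a \<in> S")
    case True
    have "contraction (back_face (frag_of (cube x S p))) =
        (\<Sum>e\<in>S. frag_cmul (incidence r S e) (contraction (frag_of (cube x (S - {e}) p))))"
      by (simp add: back_cube)
    also have "\<dots> = (\<Sum>e\<in>S. if e = ?a then frag_of (cube x S p) else 0)"
    proof (rule sum.cong[OF HOL.refl])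
      fix e assume e: "e \<in> S"
      have "incidence r (S - {?a}) ?a = incidence r S ?a"
        using incidence_insert_self[of r ?a "S - {?a}"] True by (simp add: insert_absorb)
      then show "frag_cmul (incidence r S e) (contraction (frag_of (cube x (S - {e}) p))) =
          (if e = ?a then frag_of (cube x S p) else 0)"
        using True p(2) by (auto simp: contraction_cube insert_absorb)
    qed
    also have "\<dots> = frag_of (cube x S p)" using S(1) True by simp
    finally show ?thesis using True by (simp add: contraction_cube back_face_def)
  next
    case False
    have "contraction (back_face (frag_of (cube x S p))) =
        (\<Sum>e\<in>S. frag_cmul (incidence r S e) (contraction (frag_of (cube x (S - {e}) p))))"
      by (simp add: back_cube)
    also have "\<dots> = - (\<Sum>e\<in>S. frag_cmul (incidence r S ?a * incidence r (insert ?a S) e)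
        (frag_of (cube x (insert ?a S - {e}) p)))"
      unfolding sum_negf[symmetric]
    proof (rule sum.cong[OF HOL.refl])
      fix e assume e: "e \<in> S"
      then have ne: "e \<noteq> ?a" using False by blast
      have "incidence r (insert ?a S) ?a * incidence r (insert ?a S - {?a}) e =
          - (incidence r (insert ?a S) e * incidence r (insert ?a S - {e}) ?a)"
        using incidence_face[OF r _ SE, of ?a e] S(1) e ne by simp
      moreover have "insert ?a S - {?a} = S" using False by auto
      moreover have "incidence r (insert ?a S - {e}) ?a = incidence r (S - {e}) ?a"
        using ne by (simp add: insert_Diff_if)
      ultimately have 2: "incidence r S ?a * incidence r S e =
          - (incidence r (insert ?a S) e * incidence r (S - {e}) ?a)" by simp
      \<comment> \<open>The square of \<open>incidence r S ?a\<close>, which is 1, is inserted so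
        that the exchange rule \<open>2\<close> becomes applicable.\<close>
      have "incidence r S e * incidence r (S - {e}) ?a =
          incidence r S ?a * (incidence r S ?a * incidence r S e) * incidence r (S - {e}) ?a"
        by (simp add: mult.assoc[symmetric])
      also have "\<dots> = - (incidence r S ?a * incidence r (insert ?a S) e *
          (incidence r (S - {e}) ?a * incidence r (S - {e}) ?a))"
        unfolding 2 by (simp only: ac_simps mult_minus_left mult_minus_right)
      finally have 3: "incidence r S e * incidence r (S - {e}) ?a =
          - (incidence r S ?a * incidence r (insert ?a S) e)" by simp
      show "frag_cmul (incidence r S e) (contraction (frag_of (cube x (S - {e}) p))) =
          - frag_cmul (incidence r S ?a * incidence r (insert ?a S) e) (frag_of (cube x (insert ?a S - {e}) p))"
        using False ne p(2) by (simp add: contraction_cube 3 insert_Diff_if)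
    qed
    finally have "contraction (back_face (frag_of (cube x S p))) =
      - (\<Sum>e\<in>S. frag_cmul (incidence r S ?a * incidence r (insert ?a S) e)
        (frag_of (cube x (insert ?a S - {e}) p)))" .
    moreover have "back_face (contraction (frag_of (cube x S p))) = frag_of (cube x S p) +
      (\<Sum>e\<in>S. frag_cmul (incidence r S ?a * incidence r (insert ?a S) e)
        (frag_of (cube x (insert ?a S - {e}) p)))"
    proof -
      have "back_face (contraction (frag_of (cube x S p))) =
          frag_cmul (incidence r S ?a) (back_face (frag_of (cube x (insert ?a S) p)))"
        using False p(2) by (simp add: contraction_cube back_face_def frag_extend_cmul)
      also have "\<dots> = frag_cmul (incidence r S ?a * incidence r (insert ?a S) ?a)
            (frag_of (cube x (insert ?a S - {?a}) p)) +
          (\<Sum>e\<in>S. frag_cmul (incidence r S ?a * incidence r (insert ?a S) e)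
            (frag_of (cube x (insert ?a S - {e}) p)))"
        unfolding back_cube using S(1) False by (simp add: frag_cmul_distrib2 frag_cmul_sum)
      also have "insert ?a S - {?a} = S" using False by auto
      finally show ?thesis by simp
    qed
    ultimately show ?thesis by simp
  qed
qed

section \<open>Filtration by trace length and exactness\<close>

definition shorter :: "nat \<Rightarrow> ('x, 'e) cube set" where
  "shorter N = {b. trace_length (tail b) < N}"

text \<open>A front face divides the trace by a letter, and the contraction leaves the trace alone,
  so in either order the length drops.\<close>

lemma keys_front_contraction:
  assumes p: "p \<in> carrier M" "trace_length p > 0" and S: "finite S" "S \<subseteq> initials E I p"
  shows "keys (front_face (contraction (frag_of (cube x S p)))) \<subseteq> shorter (trace_length p)"
    and "keys (contraction (front_face (frag_of (cube x S p)))) \<subseteq> shorter (trace_length p)"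
proof -
  let ?a = "first_letter p"
  have a: "?a \<in> initials E I p" by (rule first_letter_initial[OF p])
  have rem: "trace_length (remainder E I e p) < trace_length p" if "e \<in> initials E I p" for e
    using trace_length_remainder[OF that] by simp
  have 1: "keys (front_face (frag_of (cube x T p))) \<subseteq> shorter (trace_length p)"
    if "T \<subseteq> initials E I p" for T
    unfolding front_cube by (rule order_trans[OF keys_sum]) (use that rem in \<open>auto simp: shorter_def\<close>)
  show "keys (front_face (contraction (frag_of (cube x S p)))) \<subseteq> shorter (trace_length p)"
    using 1[of "insert ?a S"] a S(2)
    by (auto simp: contraction_cube front_face_def frag_extend_cmul dest: subsetD[OF keys_cmul])
  have "keys (contraction (frag_of (cube y T q))) \<subseteq> shorter (trace_length p)"
    if "trace_length q < trace_length p" for y T q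
    using that by (auto simp: contraction_cube shorter_def)
  then have "keys (frag_cmul k (contraction (frag_of (cube y T (remainder E I e p)))))
      \<subseteq> shorter (trace_length p)" if "e \<in> S" for y T k e
    using rem[of e] S(2) that by (intro order_trans[OF keys_cmul]) auto
  then show "keys (contraction (front_face (frag_of (cube x S p)))) \<subseteq> shorter (trace_length p)"
    unfolding front_cube contraction_simps by (intro order_trans[OF keys_sum]) blast
qed

text \<open>Back faces enter \<open>bd\<close> with a minus sign, so their part of bd h + h bd, with
  h the contraction, cancels z and only front terms remain, which are shorter. Cubes with empty
  trace are left unchanged; hence the bound \<open>Suc N\<close>, which still admits length
  0.\<close>

lemma keys_contraction_residue:
  assumes "keys z \<subseteq> cubes n y \<inter> shorter (Suc (Suc N))"
  shows "keys (z + bd (contraction z) + contraction (bd z)) \<subseteq> shorter (Suc N)"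
  using assms
proof (induction rule: frag_induction)
  case (one b)
  then obtain x S p where b: "b = cube x S p" "x \<in> points X" "p \<in> carrier M" "act X x p = y"
    "finite S" "S \<subseteq> initials E I p" "card S = n" by (auto elim: cubesE)
  show ?case
  proof (cases "trace_length p = 0")
    case True
    then have "S = {}" using trace_length_remainder b(6) by fastforce
    then show ?thesis using True b(1) by (simp add: contraction_cube bd_cube shorter_def)
  next
    case False
    let ?z = "frag_of (cube x S p)"
    have "?z + bd (contraction ?z) + contraction (bd ?z) =
        front_face (contraction ?z) + contraction (front_face ?z)"
      using back_contraction[OF b(3) _ b(5,6), of x] False
      by (simp add: bd_def algebra_simps)
    moreover have "keys (front_face (contraction ?z) + contraction (front_face ?z)) \<subseteq> shorter (trace_length p)"
      using keys_front_contraction[OF b(3) _ b(5,6), of x] False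
        keys_add[of "front_face (contraction ?z)" "contraction (front_face ?z)"] by auto
    moreover have "shorter (trace_length p) \<subseteq> shorter (Suc N)"
      using one b(1) by (auto simp: shorter_def)
    ultimately show ?thesis unfolding b(1) by auto
  qed
next
  case (diff a b)
  let ?R = "\<lambda>z. z + bd (contraction z) + contraction (bd z)"
  have "?R (a - b) = ?R a - ?R b" by simp
  then have "keys (?R (a - b)) \<subseteq> keys (?R a) \<union> keys (?R b)"
    using keys_diff[of "?R a" "?R b"] by (simp only:)
  then show ?case using diff by blast
qed simp

text \<open>On a cycle the residue above is z + bd h, so each round lowers the length bound by one
  within the homology class. \<open>shorter (Suc 0)\<close> means that the trace is empty.\<close>

lemma cycle_homologous_short_bounded:
  assumes "keys z \<subseteq> cubes n y \<inter> shorter (Suc N)" "bd z = 0"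
  shows "\<exists>w. keys w \<subseteq> cubes (Suc n) y \<and>
    keys (z + bd w) \<subseteq> cubes n y \<inter> shorter (Suc 0)"
  using assms
proof (induction N arbitrary: z)
  case 0
  then show ?case by (intro exI[of _ 0]) simp
next
  case (Suc N)
  let ?h = "contraction z"
  have h: "keys ?h \<subseteq> cubes (Suc n) y" using keys_contraction Suc.prems(1) by blast
  have "keys (z + bd ?h) \<subseteq> cubes n y"
    using keys_bd[OF h] Suc.prems(1) keys_add[of z "bd ?h"] by auto
  moreover have "keys (z + bd ?h) \<subseteq> shorter (Suc N)"
    using keys_contraction_residue[OF Suc.prems(1)] Suc.prems(2) by simp
  moreover have "bd (z + bd ?h) = 0" using Suc.prems(2) bd_bd[OF h] by simp
  ultimately obtain w where w: "keys w \<subseteq> cubes (Suc n) y"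
    "keys (z + bd ?h + bd w) \<subseteq> cubes n y \<inter> shorter (Suc 0)"
    using Suc.IH[of "z + bd ?h"] by auto
  then show ?case
    using h keys_add[of ?h w] by (intro exI[of _ "?h + w"]) (auto simp: add.assoc)
qed

lemma cycle_homologous_short:
  assumes "keys z \<subseteq> cubes n y" "bd z = 0"
  shows "\<exists>w. keys w \<subseteq> cubes (Suc n) y \<and>
    keys (z + bd w) \<subseteq> cubes n y \<inter> shorter (Suc 0)"
proof (rule cycle_homologous_short_bounded)
  \<comment> \<open>The support is finite, so traces in it have bounded length; for an empty support
    the inclusion is trivial whatever \<open>Max\<close> returns.\<close>
  let ?N = "Max ((\<lambda>b. trace_length (tail b)) ` keys z)"
  show "keys z \<subseteq> cubes n y \<inter> shorter (Suc ?N)"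
    using assms(1) by (auto simp: shorter_def less_Suc_eq_le)
qed fact

text \<open>An empty trace has no initial letters, hence no sides. So reduction to empty traces
  kills cycles of positive degree and leaves multiples of a single cube in degree 0.\<close>

lemma short_cube:
  assumes "b \<in> cubes n y \<inter> shorter (Suc 0)"
  shows "n = 0" and "b = cube y {} \<one>\<^bsub>M\<^esub>"
proof -
  obtain x S p where b: "b = cube x S p" "x \<in> points X" "p \<in> carrier M" "act X x p = y"
    "finite S" "S \<subseteq> initials E I p" "card S = n" using assms by (auto elim: cubesE)
  have p: "trace_length p = 0" using assms b(1) by (simp add: shorter_def)
  then have "S = {}" using trace_length_remainder b(6) by fastforce
  then show "n = 0" "b = cube y {} \<one>\<^bsub>M\<^esub>" using b trace_length_eq_0[OF b(3) p] by auto
qed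

lemma exact_positive:
  assumes "keys z \<subseteq> cubes (Suc n) y" "bd z = 0"
  shows "\<exists>w. keys w \<subseteq> cubes (Suc (Suc n)) y \<and> z = bd w"
proof -
  obtain w where w: "keys w \<subseteq> cubes (Suc (Suc n)) y"
    "keys (z + bd w) \<subseteq> cubes (Suc n) y \<inter> shorter (Suc 0)"
    using cycle_homologous_short[OF assms] by blast
  then have "keys (z + bd w) = {}" using short_cube(1) by blast
  then have "z = bd (- w)" by (simp add: eq_neg_iff_add_eq_0)
  then show ?thesis using w(1) by (intro exI[of _ "- w"]) simp
qed

lemma coeff_sum_bd:
  assumes "keys z \<subseteq> cubes n y"
  shows "coeff_sum (bd z) = 0"
  by (rule frag_additive_eqI[OF assms, of "\<lambda>z. coeff_sum (bd z)" "\<lambda>z. 0"])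
    (auto elim!: cubesE simp: bd_cube coeff_sum_sum)

text \<open>After reduction only a multiple of the cube with empty trace is left; its coefficient is
  \<open>coeff_sum\<close>, which boundaries do not change.\<close>

lemma exact_zero:
  assumes z: "keys z \<subseteq> cubes 0 y" and "coeff_sum z = 0"
  shows "\<exists>w. keys w \<subseteq> cubes (Suc 0) y \<and> z = bd w"
proof -
  have "bd z = 0"
    by (rule frag_additive_eqI[OF z, of bd "\<lambda>z. 0"]) (auto elim!: cubesE simp: bd_cube)
  then obtain w where w: "keys w \<subseteq> cubes (Suc 0) y"
    "keys (z + bd w) \<subseteq> cubes 0 y \<inter> shorter (Suc 0)"
    using cycle_homologous_short[OF z] by blast
  let ?v = "z + bd w" and ?b = "cube y {} \<one>\<^bsub>M\<^esub>"
  have k: "keys ?v \<subseteq> {?b}" using w(2) short_cube(2) by blast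
  then have v: "?v = frag_cmul (Poly_Mapping.lookup ?v ?b) (frag_of ?b)"
    by (intro poly_mapping_eqI) (auto simp: in_keys_iff)
  have "coeff_sum ?v = 0" using assms(2) coeff_sum_bd[OF w(1)] by simp
  then have "Poly_Mapping.lookup ?v ?b = 0" using arg_cong[OF v, of coeff_sum] by simp
  then have "?v = 0" using v by simp
  then have "z = bd (- w)" by (simp add: eq_neg_iff_add_eq_0)
  then show ?thesis using w(1) by (intro exI[of _ "- w"]) simp
qed

section \<open>Cells as generators, and the colimit of the resolution\<close>

definition cells :: "nat \<Rightarrow> ('x \<times> 'e set) set" where
  "cells n = {(x, S). x \<in> points X \<and> S \<subseteq> E \<and> clique I S \<and> card S = n}"

definition translate :: "'x \<times> 'e list set \<times> 'x \<Rightarrow> ('x, 'e) cube \<Rightarrow> ('x, 'e) cube" where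
  "translate f b = cube (corner b) (sides b) (tail b \<otimes>\<^bsub>M\<^esub> fst (snd f))"

text \<open>The product of \<open>S\<close> is the shortest trace having all of \<open>S\<close> as
  initial letters, so the generating cube for \<open>S\<close> with corner \<open>x\<close> lives
  over the point to which this product moves \<open>x\<close>.\<close>

definition cell_object :: "'x \<times> 'e set \<Rightarrow> 'x" where
  "cell_object = (\<lambda>(x, S). act X x (clique_trace E I S))"

definition cell_cube :: "'x \<times> 'e set \<Rightarrow> ('x, 'e) cube" where
  "cell_cube = (\<lambda>(x, S). cube x S (clique_trace E I S))"

definition cube_cell :: "('x, 'e) cube \<Rightarrow> 'x \<times> 'e set" where
  "cube_cell b = (corner b, sides b)"

definition cube_arrow :: "('x, 'e) cube \<Rightarrow> 'x \<times> 'e list set \<times> 'x" where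
  "cube_arrow b = (cell_object (cube_cell b), quotient_trace (sides b) (tail b), act X (corner b) (tail b))"

lemma K_cat_simps:
  "Ob C = points X" "Ident C x = (x, \<one>\<^bsub>M\<^esub>, x)" "Comp C (y, q, z) (x, p, y') = (x, p \<otimes>\<^bsub>M\<^esub> q, z)"
  "Dom C (x, p, y) = x" "Cod C (x, p, y) = y"
  "(x, p, y) \<in> Ar C \<longleftrightarrow> x \<in> points X \<and> p \<in> carrier M \<and> y = act X x p"
  by (auto simp: K_cat_def)

text \<open>Unique division by \<open>clique_trace E I S\<close> is the whole content: the trace of
  a cube is the product of its sides times \<open>quotient_trace\<close>, and prolonging the trace
  prolongs the quotient.\<close>

sublocale based_functor C "cubes n" translate "cells n" cell_object cell_cube cube_cell cube_arrow for n
proof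
  show "has_endpoints C"
    by (auto simp: has_endpoints_def K_cat_simps)
next
  fix f b assume f: "f \<in> Ar C" and b: "b \<in> cubes n (Dom C f)"
  obtain y q z where fq: "f = (y, q, z)" by (cases f)
  with f have q: "y \<in> points X" "q \<in> carrier M" "z = act X y q" by (auto simp: K_cat_simps)
  obtain x S p where b: "b = cube x S p" "x \<in> points X" "p \<in> carrier M" "act X x p = y"
    "finite S" "S \<subseteq> initials E I p" "card S = n" using b by (auto simp: fq K_cat_simps elim: cubesE)
  have SE: "S \<subseteq> E" using b(6) initials_subset by blast
  show "translate f b \<in> cubes n (Cod C f)"
    using b q initials_mult(1)[OF _ q(2)]
    by (auto simp: fq K_cat_simps translate_def act_mult intro!: cube_in_cubes)
  show "cube_cell (translate f b) = cube_cell b" by (simp add: cube_cell_def translate_def)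
  note qt = quotient_trace_closed[OF b(5,6,3)] clique_trace_quotient[OF b(5,6,3)]
  have "quotient_trace S (p \<otimes>\<^bsub>M\<^esub> q) = quotient_trace S p \<otimes>\<^bsub>M\<^esub> q"
    using quotient_trace_mult[OF b(5) SE, of "quotient_trace S p \<otimes>\<^bsub>M\<^esub> q"] qt q(2)
      clique_trace_closed[OF b(5) SE] by (simp flip: m_assoc)
  then show "cube_arrow (translate f b) = Comp C f (cube_arrow b)"
    using b q by (simp add: fq K_cat_simps translate_def cube_arrow_def cube_cell_def act_mult)
  fix g assume "g \<in> Ar C" "Cod C f = Dom C g"
  then show "translate (Comp C g f) b = translate g (translate f b)"
    using b q by (cases g) (simp add: fq K_cat_simps translate_def m_assoc)
next
  fix c b assume "c \<in> Ob C" "b \<in> cubes n c"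
  then obtain x S p where b: "b = cube x S p" "x \<in> points X" "p \<in> carrier M" "act X x p = c"
    "finite S" "S \<subseteq> initials E I p" "card S = n" by (auto elim: cubesE)
  have SE: "S \<subseteq> E" using b(6) initials_subset by blast
  note qt = quotient_trace_closed[OF b(5,6,3)] clique_trace_quotient[OF b(5,6,3)]
  note cl = clique_trace_closed[OF b(5) SE]
  show "translate (Ident C c) b = b" using b by (simp add: K_cat_simps translate_def)
  show "cube_cell b \<in> cells n"
    using b SE clique_initials[OF b(5,6)] by (simp add: cube_cell_def cells_def)
  have "act X x p = act X (act X x (clique_trace E I S)) (quotient_trace S p)"
    using act_mult[OF b(2) cl qt(1)] qt(2) by simp
  then show "cube_arrow b \<in> Ar C"
    using b qt cl by (simp add: cube_arrow_def K_cat_simps cell_object_def cube_cell_def)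
  show "Dom C (cube_arrow b) = cell_object (cube_cell b)" by (simp add: cube_arrow_def K_cat_simps)
  show "Cod C (cube_arrow b) = c" using b by (simp add: cube_arrow_def K_cat_simps)
  show "translate (cube_arrow b) (cell_cube (cube_cell b)) = b"
    using qt b by (simp add: translate_def cube_arrow_def cell_cube_def cube_cell_def)
next
  fix j assume "j \<in> cells n"
  then obtain x S where j: "j = (x, S)" "x \<in> points X" "S \<subseteq> E" "clique I S" "card S = n"
    by (auto simp: cells_def)
  have S: "finite S" using j(4) by (simp add: clique_def)
  note cl = clique_trace_closed[OF S j(3)]
  show "cell_object j \<in> Ob C" using j cl by (simp add: cell_object_def K_cat_simps)
  show "cell_cube j \<in> cubes n (cell_object j)"
    using j S cl initials_clique_trace[OF j(4,3)] by (auto simp: cell_cube_def cell_object_def intro!: cube_in_cubes)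
  show "cube_cell (cell_cube j) = j" using j by (simp add: cube_cell_def cell_cube_def)
qed

abbreviation "cube_functor n \<equiv> free_functor (cubes n) translate"

lemma bd_hom: "bd \<in> hom (free_Abelian_group (cubes (Suc n) y)) (free_Abelian_group (cubes n y))"
  by (rule homI) (use keys_bd in auto)

text \<open>Prolonging a trace on the right keeps its initial letters and commutes with dividing by
  them on the left (\<open>initials_mult\<close>), so faces commute with translation.\<close>

lemma nat_transf_bd: "nat_transf C (cube_functor (Suc n)) (cube_functor n) (\<lambda>_. bd)"
  unfolding nat_transf_def
proof (intro conjI ballI)
  show "bd \<in> hom (fob (cube_functor (Suc n)) c) (fob (cube_functor n) c)" for c
    using bd_hom by simp
  fix f a assume f: "f \<in> Ar C" and a: "a \<in> carrier (fob (cube_functor (Suc n)) (Dom C f))"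
  obtain y q z where fq: "f = (y, q, z)" by (cases f)
  with f have q: "y \<in> points X" "q \<in> carrier M" "z = act X y q" by (auto simp: K_cat_simps)
  have "bd (frag_extend (frag_of \<circ> translate f) a) = frag_extend (frag_of \<circ> translate f) (bd a)"
  proof (rule frag_additive_eqI[where f = "\<lambda>a. bd (frag_extend (frag_of \<circ> translate f) a)"])
    show "keys a \<subseteq> cubes (Suc n) y" using a by (simp add: fq K_cat_simps)
    fix b assume "b \<in> cubes (Suc n) y"
    then obtain x S p where b: "b = cube x S p" "x \<in> points X" "p \<in> carrier M" "act X x p = y"
      "finite S" "S \<subseteq> initials E I p" "card S = Suc n" by (rule cubesE)
    show "bd (frag_extend (frag_of \<circ> translate f) (frag_of b)) =
        frag_extend (frag_of \<circ> translate f) (bd (frag_of b))"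
      using b(6) initials_mult(2)[OF _ q(2)]
      by (auto simp: b(1) bd_cube frag_extend_sum_all frag_extend_cmul frag_extend_diff translate_def fq
          intro!: sum.cong)
  qed (simp_all add: frag_extend_diff)
  then show "bd (far (cube_functor (Suc n)) f a) = far (cube_functor n) f (bd a)" by simp
qed

lemma projective_resolution_cubes:
  "projective_resolution C const_int cube_functor (\<lambda>_ _. bd) (\<lambda>_. coeff_sum)"
  unfolding projective_resolution_def
proof (intro conjI allI ballI)
  show "projective_functor C (cube_functor n)" for n by (rule projective_P)
  show "nat_transf C (cube_functor (Suc n)) (cube_functor n) (\<lambda>_. bd)" for n by (rule nat_transf_bd)
  have tot: "coeff_sum (frag_extend (frag_of \<circ> g) a) = coeff_sum a" for g :: "'b \<Rightarrow> 'c" and a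
    using subset_UNIV by (rule frag_additive_eqI) (simp_all add: frag_extend_diff)
  have nat: "nat_transf C (cube_functor 0) const_int (\<lambda>_. coeff_sum)"
    by (auto simp: nat_transf_def const_int_def hom_def tot)
  have "coeff_sum ` carrier (free_Abelian_group (cubes 0 c)) = UNIV" if c: "c \<in> points X" for c
  proof -
    have "cube c {} \<one>\<^bsub>M\<^esub> \<in> cubes 0 c" using c by (intro cube_in_cubes) auto
    then have "k \<in> coeff_sum ` carrier (free_Abelian_group (cubes 0 c))" for k
      by (intro image_eqI[of _ _ "frag_cmul k (frag_of (cube c {} \<one>\<^bsub>M\<^esub>))"]) (auto dest: subsetD[OF keys_cmul])
    then show ?thesis by blast
  qed
  then show "epi_transf C (cube_functor 0) const_int (\<lambda>_. coeff_sum)"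
    using nat by (simp add: epi_transf_def const_int_def K_cat_simps)
  fix c assume "c \<in> Ob C"
  show "kernel (fob (cube_functor 0) c) (fob const_int c) coeff_sum = bd ` carrier (fob (cube_functor 1) c)"
  proof
    show "kernel (fob (cube_functor 0) c) (fob const_int c) coeff_sum \<subseteq> bd ` carrier (fob (cube_functor 1) c)"
    proof
      fix z assume "z \<in> kernel (fob (cube_functor 0) c) (fob const_int c) coeff_sum"
      then obtain w where "keys w \<subseteq> cubes (Suc 0) c" "z = bd w"
        using exact_zero[of z c] by (auto simp: kernel_def const_int_def)
      then show "z \<in> bd ` carrier (fob (cube_functor 1) c)" by auto
    qed
    show "bd ` carrier (fob (cube_functor 1) c) \<subseteq> kernel (fob (cube_functor 0) c) (fob const_int c) coeff_sum"
      using coeff_sum_bd[of _ 1 c] keys_bd[of _ 0 c]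
      by (intro image_subsetI) (simp add: kernel_def const_int_def)
  qed
  fix n
  show "kernel (fob (cube_functor (Suc n)) c) (fob (cube_functor n) c) bd =
      bd ` carrier (fob (cube_functor (Suc (Suc n))) c)"
  proof
    show "kernel (fob (cube_functor (Suc n)) c) (fob (cube_functor n) c) bd \<subseteq>
        bd ` carrier (fob (cube_functor (Suc (Suc n))) c)"
    proof
      fix z assume "z \<in> kernel (fob (cube_functor (Suc n)) c) (fob (cube_functor n) c) bd"
      then obtain w where "keys w \<subseteq> cubes (Suc (Suc n)) c" "z = bd w"
        using exact_positive[of z n c] by (auto simp: kernel_def)
      then show "z \<in> bd ` carrier (fob (cube_functor (Suc (Suc n))) c)" by auto
    qed
    show "bd ` carrier (fob (cube_functor (Suc (Suc n))) c) \<subseteq>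
        kernel (fob (cube_functor (Suc n)) c) (fob (cube_functor n) c) bd"
      using bd_bd[of _ "Suc (Suc n)" c] keys_bd[of _ "Suc n" c]
      by (intro image_subsetI) (simp add: kernel_def)
  qed
qed

abbreviation cell_cx :: "nat \<Rightarrow> ('x \<times> 'e set \<Rightarrow>\<^sub>0 int) monoid" where
  "cell_cx n \<equiv> free_Abelian_group (cells n)"

text \<open>What remains of \<open>bd_cube\<close> when the traces are forgotten, i.e. the boundary
  induced on the colimits.\<close>

definition cell_boundary :: "('x \<times> 'e set \<Rightarrow>\<^sub>0 int) \<Rightarrow> ('x \<times> 'e set \<Rightarrow>\<^sub>0 int)" where
  "cell_boundary = frag_extend (\<lambda>(x, S). \<Sum>e\<in>S. frag_cmul (incidence r S e)
     (frag_of (step x e, S - {e}) - frag_of (x, S - {e})))"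

lemma cell_boundary_hom:
  "cell_boundary \<in> hom (free_Abelian_group (cells (Suc n))) (free_Abelian_group (cells n))"
  unfolding cell_boundary_def
proof (rule frag_extend_hom)
  fix j assume "j \<in> cells (Suc n)"
  then obtain x S where j: "j = (x, S)" "x \<in> points X" "S \<subseteq> E" "clique I S" "card S = Suc n"
    by (auto simp: cells_def)
  have S: "finite S" using j(4) by (simp add: clique_def)
  have "keys (frag_cmul k (frag_of (step x e, S - {e}) - frag_of (x, S - {e}))) \<subseteq> cells n"
    if "e \<in> S" for e k
  proof -
    have "step x e \<in> points X" using j that by (intro act_closed letter_closed) auto
    then have "(step x e, S - {e}) \<in> cells n" "(x, S - {e}) \<in> cells n"
      using j S that by (auto simp: cells_def clique_def)
    then show ?thesis by (intro order_trans[OF keys_cmul] order_trans[OF keys_diff]) auto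
  qed
  then show "keys (case j of (x, S) \<Rightarrow> \<Sum>e\<in>S. frag_cmul (incidence r S e)
      (frag_of (step x e, S - {e}) - frag_of (x, S - {e}))) \<subseteq> cells n"
    unfolding j(1) prod.case by (intro order_trans[OF keys_sum]) blast
qed

text \<open>\<open>colim_collapse\<close> identifies the colimits of the cubical resolution with the
  cell groups and their maps with \<open>cell_boundary\<close>. The complex property of the cells is
  a result of this identification.\<close>

lemma
  shows chain_complex_cells: "chain_complex cell_cx (\<lambda>_. cell_boundary)"
    and comm_group_rset_homology: "comm_group (rset_homology M X (Suc k))"
    and rset_homology_cells: "rset_homology M X (Suc k) \<cong>
      chain_homology cell_cx (\<lambda>_. cell_boundary) (Suc k)"
proof -
  let ?G = "\<lambda>n. colim C (cube_functor n)" and ?d = "\<lambda>n. colim_map C (cube_functor (Suc n)) (cube_functor n) (\<lambda>_. bd)"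
  note res = projective_resolution_cubes
  have *: "chain_complex ?G ?d" by (rule chain_complex_colim[OF C res])
  have commute: "based_functor.colim_collapse C (cells n) cube_cell (?d n a) =
      cell_boundary (based_functor.colim_collapse C (cells (Suc n)) cube_cell a)"
    if "a \<in> carrier (?G (Suc n))" for n a
  proof (rule colim_collapse_colim_map[OF based_functor_axioms based_functor_axioms nat_transf_bd
        cell_boundary_hom _ that])
    fix c b assume "b \<in> cubes (Suc n) c"
    then obtain x S p where "b = cube x S p" by (rule cubesE)
    then show "frag_extend (frag_of \<circ> cube_cell) (bd (frag_of b)) = cell_boundary (frag_of (cube_cell b))"
      by (simp add: bd_cube cell_boundary_def cube_cell_def frag_extend_sum_all frag_extend_cmul frag_extend_diff)
  qed
  have iso: "based_functor.colim_collapse C (cells n) cube_cell \<in> iso (?G n) (free_Abelian_group (cells n))" for n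
    by (rule colim_collapse_iso)
  note transport = chain_homology_isomorphic_complexes[where G = ?G and d = ?d
      and H = "\<lambda>n. free_Abelian_group (cells n)" and e = "\<lambda>_. cell_boundary"
      and f = "\<lambda>n. based_functor.colim_collapse C (cells n) cube_cell"]
  show "chain_complex cell_cx (\<lambda>_. cell_boundary)"
    by (rule transport(1)[OF *]) (rule abelian_free_Abelian_group cell_boundary_hom iso commute, assumption?)+
  have hom: "chain_homology ?G ?d (Suc k) \<cong>
      chain_homology cell_cx (\<lambda>_. cell_boundary) (Suc k)"
    by (rule transport(2)[OF *]) (rule abelian_free_Abelian_group cell_boundary_hom iso commute, assumption?)+
  show "comm_group (rset_homology M X (Suc k))"
    unfolding rset_homology_def by (rule comm_group_left_derived_colim[OF C res])
  show "rset_homology M X (Suc k) \<cong>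
      chain_homology cell_cx (\<lambda>_. cell_boundary) (Suc k)"
    unfolding rset_homology_def
    by (rule iso_trans[OF left_derived_colim_iso[OF C res] hom])
qed

end

section \<open>Splitting off the first point\<close>

lemma simplex_boundary_incidence:
  "simplex_boundary r = frag_extend (\<lambda>S. \<Sum>e\<in>S. frag_cmul (incidence r S e) (frag_of (S - {e})))"
  by (simp add: simplex_boundary_def incidence_def)

lemma simplex_boundary_simps [simp]:
  "simplex_boundary r 0 = 0" "simplex_boundary r (- a) = - simplex_boundary r a"
  "simplex_boundary r (a - b) = simplex_boundary r a - simplex_boundary r b"
  "simplex_boundary r (a + b) = simplex_boundary r a + simplex_boundary r b"
  "simplex_boundary r (frag_cmul k a) = frag_cmul k (simplex_boundary r a)"
  "simplex_boundary r (\<Sum>i\<in>A. g i) = (\<Sum>i\<in>A. simplex_boundary r (g i))"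
  by (simp_all add: simplex_boundary_def frag_extend_minus frag_extend_diff frag_extend_add
      frag_extend_cmul frag_extend_sum_all)

lemma comm_group_DirProd: "comm_group G \<Longrightarrow> comm_group H \<Longrightarrow> comm_group (G \<times>\<times> H)"
  by (rule group.group_comm_groupI)
    (auto simp: comm_group_def intro: DirProd_group comm_monoid.m_comm)

text \<open>The map \<open>f\<close> is given on cycles only and need not come from a chain map: the
  lift of clique cycles used below yields cycles only on cycles, and it respects boundaries by means
  of a separate bounding chain.\<close>

lemma chain_homology_DirProd_isoI:
  assumes G: "chain_complex G d" and K: "chain_complex K \<delta>" and H: "chain_complex H e"
    and f: "f \<in> hom (cycle_group G d n \<times>\<times> cycle_group K \<delta> n) (cycle_group H e n)"
    and bd: "\<And>z c. z \<in> carrier (G (Suc (Suc n))) \<Longrightarrow> c \<in> carrier (K (Suc (Suc n))) \<Longrightarrow>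
      f (d (Suc n) z, \<delta> (Suc n) c) \<in> e (Suc n) ` carrier (H (Suc (Suc n)))"
    and inj: "\<And>z c w. z \<in> carrier (cycle_group G d n) \<Longrightarrow> c \<in> carrier (cycle_group K \<delta> n) \<Longrightarrow>
      w \<in> carrier (H (Suc (Suc n))) \<Longrightarrow> f (z, c) = e (Suc n) w \<Longrightarrow>
      z \<in> d (Suc n) ` carrier (G (Suc (Suc n))) \<and> c \<in> \<delta> (Suc n) ` carrier (K (Suc (Suc n)))"
    and surj: "\<And>b. b \<in> carrier (cycle_group H e n) \<Longrightarrow>
      \<exists>z\<in>carrier (cycle_group G d n). \<exists>c\<in>carrier (cycle_group K \<delta> n). b = f (z, c)"
  shows "chain_homology G d (Suc n) \<times>\<times> chain_homology K \<delta> (Suc n) \<cong> chain_homology H e (Suc n)"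
proof -
  let ?B = "\<lambda>G d. d (Suc n) ` carrier (G (Suc (Suc n)))"
  interpret G: comm_group "cycle_group G d n" by (rule comm_group_cycle_group[OF G])
  interpret K: comm_group "cycle_group K \<delta> n" by (rule comm_group_cycle_group[OF K])
  interpret H: comm_group "cycle_group H e n" by (rule comm_group_cycle_group[OF H])
  note sG = subgroup_boundaries[OF G, of n] and sK = subgroup_boundaries[OF K, of n]
    and sH = subgroup_boundaries[OF H, of n]
  have "(cycle_group G d n Mod ?B G d) \<times>\<times> (cycle_group K \<delta> n Mod ?B K \<delta>) \<cong>
      (cycle_group G d n \<times>\<times> cycle_group K \<delta> n) Mod (?B G d \<times> ?B K \<delta>)"
    by (rule G.FactGroup_DirProd_multiplication_iso_1[OF K.is_group G.subgroup_imp_normal[OF sG]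
          K.subgroup_imp_normal[OF sK]])
  also have "(cycle_group G d n \<times>\<times> cycle_group K \<delta> n) Mod (?B G d \<times> ?B K \<delta>) \<cong>
      cycle_group H e n Mod ?B H e"
  proof (rule FactGroup_isoI[OF comm_group_DirProd[OF G.comm_group_axioms K.comm_group_axioms]
        H.comm_group_axioms DirProd_subgroups[OF G.is_group sG K.is_group sK] sH f])
    fix a assume "a \<in> carrier (cycle_group G d n \<times>\<times> cycle_group K \<delta> n)"
    then obtain z c where a: "a = (z, c)" "z \<in> carrier (cycle_group G d n)" "c \<in> carrier (cycle_group K \<delta> n)"
      by auto
    show "f a \<in> ?B H e \<longleftrightarrow> a \<in> ?B G d \<times> ?B K \<delta>"
    proof
      assume "f a \<in> ?B H e"
      then show "a \<in> ?B G d \<times> ?B K \<delta>" using inj[OF a(2,3)] unfolding a(1) by auto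
    next
      assume "a \<in> ?B G d \<times> ?B K \<delta>"
      then obtain z' c' where "z' \<in> carrier (G (Suc (Suc n)))" "c' \<in> carrier (K (Suc (Suc n)))"
        "a = (d (Suc n) z', \<delta> (Suc n) c')" by auto
      then show "f a \<in> ?B H e" by (simp only: bd)
    qed
  next
    fix b assume b: "b \<in> carrier (cycle_group H e n)"
    then obtain z c where zc: "z \<in> carrier (cycle_group G d n)" "c \<in> carrier (cycle_group K \<delta> n)" "b = f (z, c)"
      using surj by blast
    have "b = \<one>\<^bsub>cycle_group H e n\<^esub> \<otimes>\<^bsub>cycle_group H e n\<^esub> f (z, c)"
      using H.l_one[OF b] zc(3) by simp
    moreover have "(z, c) \<in> carrier (cycle_group G d n \<times>\<times> cycle_group K \<delta> n)" using zc by simp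
    ultimately show "\<exists>a\<in>carrier (cycle_group G d n \<times>\<times> cycle_group K \<delta> n). \<exists>c\<in>?B H e. b = c \<otimes>\<^bsub>cycle_group H e n\<^esub> f a"
      using subgroup.one_closed[OF sH] by blast
  qed
  finally show ?thesis by (simp only: chain_homology_Suc)
qed

section \<open>Chain maps between the cell complexes of consecutive point sets\<close>

fun shift :: "xpoint \<Rightarrow> xpoint" where
  "shift (Elt i) = Elt (Suc i)"
| "shift Base = Base"

definition shift_chain :: "(xpoint \<times> 'e set \<Rightarrow>\<^sub>0 int) \<Rightarrow> (xpoint \<times> 'e set \<Rightarrow>\<^sub>0 int)" where
  "shift_chain = frag_extend (\<lambda>(x, S). frag_of (shift x, S))"

definition unshift_chain :: "(xpoint \<times> 'e set \<Rightarrow>\<^sub>0 int) \<Rightarrow> (xpoint \<times> 'e set \<Rightarrow>\<^sub>0 int)" where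
  "unshift_chain = frag_extend (\<lambda>(x, S). case x of Elt 0 \<Rightarrow> 0 | Elt (Suc i) \<Rightarrow> frag_of (Elt i, S)
     | Base \<Rightarrow> frag_of (Base, S))"

text \<open>The projection to the quotient by the image of \<open>shift_chain\<close>: cells at
  \<open>Elt 0\<close> are the only ones that the shift misses.\<close>

definition first_part :: "(xpoint \<times> 'e set \<Rightarrow>\<^sub>0 int) \<Rightarrow> ('e set \<Rightarrow>\<^sub>0 int)" where
  "first_part = frag_extend (\<lambda>(x, S). if x = Elt 0 then frag_of S else 0)"

definition at_point :: "xpoint \<Rightarrow> ('e set \<Rightarrow>\<^sub>0 int) \<Rightarrow> (xpoint \<times> 'e set \<Rightarrow>\<^sub>0 int)" where
  "at_point x = frag_extend (\<lambda>S. frag_of (x, S))"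

lemma splitting_maps_simps [simp]:
  "shift_chain 0 = 0" "shift_chain (a - b) = shift_chain a - shift_chain b"
  "shift_chain (a + b) = shift_chain a + shift_chain b"
  "shift_chain (frag_cmul k a) = frag_cmul k (shift_chain a)"
  "shift_chain (\<Sum>i\<in>A. g i) = (\<Sum>i\<in>A. shift_chain (g i))"
  "unshift_chain 0 = 0" "unshift_chain (a - b) = unshift_chain a - unshift_chain b"
  "unshift_chain (a + b) = unshift_chain a + unshift_chain b"
  "first_part 0 = 0" "first_part (a - b) = first_part a - first_part b"
  "first_part (a + b) = first_part a + first_part b"
  "first_part (frag_cmul k a) = frag_cmul k (first_part a)"
  "first_part (\<Sum>i\<in>A. g i) = (\<Sum>i\<in>A. first_part (g i))"
  "at_point x 0 = 0" "at_point x (c - c') = at_point x c - at_point x c'"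
  "at_point x (- c) = - at_point x c"
  "at_point x (c + c') = at_point x c + at_point x c'"
  "at_point x (frag_cmul k c) = frag_cmul k (at_point x c)"
  "at_point x (\<Sum>i\<in>A. h i) = (\<Sum>i\<in>A. at_point x (h i))"
  by (simp_all add: shift_chain_def unshift_chain_def first_part_def at_point_def frag_extend_minus
      frag_extend_diff frag_extend_add frag_extend_cmul frag_extend_sum_all)

lemma splitting_maps_of [simp]:
  "shift_chain (frag_of (x, S)) = frag_of (shift x, S)"
  "unshift_chain (frag_of (Elt 0, S)) = 0"
  "unshift_chain (frag_of (Elt (Suc i), S)) = frag_of (Elt i, S)"
  "unshift_chain (frag_of (Base, S)) = frag_of (Base, S)"
  "first_part (frag_of (x, S)) = (if x = Elt 0 then frag_of S else 0)"
  "at_point x (frag_of S) = frag_of (x, S)"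
  by (simp_all add: shift_chain_def unshift_chain_def first_part_def at_point_def)

lemma unshift_shift_chain: "unshift_chain (shift_chain z) = z"
proof (rule frag_additive_eqI[OF subset_UNIV, of "\<lambda>z. unshift_chain (shift_chain z)" "\<lambda>z. z"])
  fix b :: "xpoint \<times> 'a set"
  obtain x S where "b = (x, S)" by (cases b)
  then show "unshift_chain (shift_chain (frag_of b)) = frag_of b" by (cases x) simp_all
qed simp_all

text \<open>A splitting of groups of chains only: \<open>at_point (Elt 0)\<close> does not commute
  with boundaries in general, since letters move x_0.\<close>

lemma shift_unshift_chain: "shift_chain (unshift_chain z) + at_point (Elt 0) (first_part z) = z"
proof (rule frag_additive_eqI[OF subset_UNIV,
      of "\<lambda>z. shift_chain (unshift_chain z) + at_point (Elt 0) (first_part z)" "\<lambda>z. z"])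
  fix b :: "xpoint \<times> 'a set"
  obtain x S where b: "b = (x, S)" by (cases b)
  show "shift_chain (unshift_chain (frag_of b)) + at_point (Elt 0) (first_part (frag_of b)) = frag_of b"
  proof (cases x)
    case (Elt i)
    then show ?thesis by (cases i) (simp_all add: b)
  qed (simp add: b)
qed simp_all

lemma first_part_shift_chain [simp]: "first_part (shift_chain z) = 0"
proof (rule frag_additive_eqI[OF subset_UNIV, of "\<lambda>z. first_part (shift_chain z)" "\<lambda>z. 0"])
  fix b :: "xpoint \<times> 'a set"
  obtain x S where "b = (x, S)" by (cases b)
  then show "first_part (shift_chain (frag_of b)) = 0" by (cases x) simp_all
qed simp_all

lemma first_part_at_point [simp]: "first_part (at_point x c) = (if x = Elt 0 then c else 0)"
  by (rule frag_additive_eqI[OF subset_UNIV, of "\<lambda>c. first_part (at_point x c)"]) simp_all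

lemma shift_chain_at_Base [simp]: "shift_chain (at_point Base c) = at_point Base c"
  by (rule frag_additive_eqI[OF subset_UNIV, of "\<lambda>c. shift_chain (at_point Base c)"]) simp_all

locale ordered_commutation = commutation E I for E :: "'e set" and I +
  fixes r :: "('e \<times> 'e) set"
  assumes r: "linear_order_on E r"
begin

text \<open>The index stays a parameter because the splitting works with the complexes for
  \<open>m\<close> and \<open>m + 1\<close> at the same time.\<close>

sublocale S: trace_action_system E I r "X_set l" for l
  by unfold_locales (rule r, rule right_pointed_set_X_set)

text \<open>Graded by cardinality, with the empty clique in degree 0: simplices of dimension n are
  \<open>cliques (Suc n)\<close>, whence the degree shift.\<close>

definition cliques :: "nat \<Rightarrow> 'e set set" where
  "cliques n = {S. S \<subseteq> E \<and> clique I S \<and> card S = n}"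

abbreviation clique_cx :: "nat \<Rightarrow> ('e set \<Rightarrow>\<^sub>0 int) monoid" where
  "clique_cx n \<equiv> free_Abelian_group (cliques n)"

lemma keys_simplex_boundary:
  assumes "keys c \<subseteq> cliques (Suc n)"
  shows "keys (simplex_boundary r c) \<subseteq> cliques n"
proof -
  have "keys (\<Sum>e\<in>S. frag_cmul (incidence r S e) (frag_of (S - {e}))) \<subseteq> cliques n"
    if "S \<in> cliques (Suc n)" for S
    using that by (intro order_trans[OF keys_sum]) (auto simp: cliques_def clique_def dest: subsetD[OF keys_cmul])
  then show ?thesis
    using assms unfolding simplex_boundary_incidence by (intro order_trans[OF keys_frag_extend]) blast
qed

lemma simplex_boundary_simplex_boundary:
  assumes "keys c \<subseteq> cliques n"
  shows "simplex_boundary r (simplex_boundary r c) = 0"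
proof (rule frag_additive_eqI[OF assms, of "\<lambda>c. simplex_boundary r (simplex_boundary r c)" "\<lambda>c. 0"])
  fix S assume "S \<in> cliques n"
  then have S: "finite S" "S \<subseteq> E" by (auto simp: cliques_def clique_def)
  have "simplex_boundary r (simplex_boundary r (frag_of S)) =
      (\<Sum>e\<in>S. frag_cmul (incidence r S e)
        (\<Sum>f\<in>S - {e}. frag_cmul (incidence r (S - {e}) f) (frag_of (S - {e} - {f}))))"
    by (simp add: simplex_boundary_incidence frag_extend_sum_all frag_extend_cmul)
  also have "\<dots> = 0" by (rule double_face_sum[OF r S]) (simp add: Diff_insert[symmetric] insert_commute)
  finally show "simplex_boundary r (simplex_boundary r (frag_of S)) = 0" .
qed simp_all

lemma chain_complex_cliques:
  "chain_complex clique_cx (\<lambda>_. simplex_boundary r)"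
  unfolding chain_complex_def
proof (intro conjI allI ballI)
  show "simplex_boundary r \<in> hom (free_Abelian_group (cliques (Suc n))) (free_Abelian_group (cliques n))" for n
    by (rule homI) (use keys_simplex_boundary in auto)
qed (simp_all add: abelian_free_Abelian_group simplex_boundary_simplex_boundary)

lemma simplex_chains_cliques:
  "simplex_chains (commuting_simplices E I) n = free_Abelian_group (cliques (Suc n))"
proof -
  have "{S \<in> commuting_simplices E I. card S = Suc n} = cliques (Suc n)"
    by (auto simp: commuting_simplices_def cliques_def clique_def)
  then show ?thesis by (simp add: simplex_chains_def)
qed

text \<open>The augmentation is the boundary to the empty clique.\<close>

lemma reduced_simplicial_homology_cliques:
  "reduced_simplicial_homology r (commuting_simplices E I) n =
     chain_homology clique_cx (\<lambda>_. simplex_boundary r) (Suc n)"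
proof (cases n)
  case 0
  have "simplex_boundary r c = frag_cmul (augmentation c) (frag_of {})"
    if c: "keys c \<subseteq> cliques (Suc 0)" for c
  proof -
    have "simplex_boundary r c = (\<Sum>S\<in>keys c. frag_cmul (Poly_Mapping.lookup c S) (frag_of {}))"
      unfolding simplex_boundary_incidence frag_extend_def
    proof (rule sum.cong[OF HOL.refl])
      fix S assume "S \<in> keys c"
      then obtain a where "S = {a}" using c by (auto simp: cliques_def card_1_singleton_iff)
      moreover
      have e: "{u \<in> {a}. u \<noteq> a \<and> (u, a) \<in> r} = {}" by auto
      have "incidence r {a} a = 1" unfolding incidence_def e by simp
      ultimately show "frag_cmul (Poly_Mapping.lookup c S)
          (\<Sum>e\<in>S. frag_cmul (incidence r S e) (frag_of (S - {e}))) = frag_cmul (Poly_Mapping.lookup c S) (frag_of {})"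
        by simp
    qed
    also have "\<dots> = frag_cmul (augmentation c) (frag_of {})"
      by (rule poly_mapping_eqI) (simp add: lookup_sum augmentation_def sum_distrib_right)
    finally show ?thesis .
  qed
  then have "kernel (free_Abelian_group (cliques (Suc 0))) integer_group augmentation =
      kernel (free_Abelian_group (cliques (Suc 0))) (free_Abelian_group (cliques 0)) (simplex_boundary r)"
    by (auto simp: kernel_def)
  then show ?thesis by (simp add: 0 simplex_chains_cliques)
next
  case (Suc k)
  then show ?thesis by (simp add: simplicial_homology_def simplex_chains_cliques)
qed

lemma step_X_set: "e \<in> E \<Longrightarrow> act (X_set n) x (letter E I e) = X_step n x e"
  unfolding letter_def by (subst act_X_set) auto

lemma cell_boundary_cell:
  assumes "S \<subseteq> E"
  shows "S.cell_boundary n (frag_of (x, S)) =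
    (\<Sum>e\<in>S. frag_cmul (incidence r S e) (frag_of (X_step n x e, S - {e}) - frag_of (x, S - {e})))"
  unfolding S.cell_boundary_def
  by (simp, rule sum.cong) (use assms in \<open>auto simp: step_X_set\<close>)

lemma cell_boundary_simps [simp]:
  "S.cell_boundary n 0 = 0" "S.cell_boundary n (- a) = - S.cell_boundary n a"
  "S.cell_boundary n (a - b) = S.cell_boundary n a - S.cell_boundary n b"
  "S.cell_boundary n (a + b) = S.cell_boundary n a + S.cell_boundary n b"
  "S.cell_boundary n (\<Sum>i\<in>A. g i) = (\<Sum>i\<in>A. S.cell_boundary n (g i))"
  by (simp_all add: S.cell_boundary_def frag_extend_minus frag_extend_diff frag_extend_add
      frag_extend_cmul frag_extend_sum_all)

abbreviation X_points :: "int \<Rightarrow> xpoint set" where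
  "X_points n \<equiv> {Elt i |i. int i \<le> n} \<union> {Base}"

lemma points_X_set: "points (X_set n) = X_points n"
  by (simp add: X_set_def)

lemma cellsE:
  assumes "b \<in> S.cells n k"
  obtains x S where "b = (x, S)" "x \<in> X_points n" "S \<in> cliques k" "S \<subseteq> E"
  using assms unfolding S.cells_def cliques_def points_X_set by auto

lemma cells_iff:
  "(x, S) \<in> S.cells n k \<longleftrightarrow> x \<in> X_points n \<and> S \<in> cliques k"
  unfolding S.cells_def cliques_def points_X_set by auto

lemma keys_shift_chain:
  assumes "keys z \<subseteq> S.cells n k"
  shows "keys (shift_chain z) \<subseteq> S.cells (n + 1) k"
  unfolding shift_chain_def
proof (rule order_trans[OF keys_frag_extend], rule UN_least)
  fix b assume "b \<in> keys z"
  then have "b \<in> S.cells n k" using assms by blast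
  then obtain x S where "b = (x, S)" "x \<in> X_points n" "S \<in> cliques k"
    by (rule cellsE)
  then show "keys (case b of (x, S) \<Rightarrow> frag_of (shift x, S)) \<subseteq> S.cells (n + 1) k"
    by (cases x) (auto simp: cells_iff)
qed

lemma keys_unshift_chain:
  assumes "keys z \<subseteq> S.cells (n + 1) k"
  shows "keys (unshift_chain z) \<subseteq> S.cells n k"
  unfolding unshift_chain_def
proof (rule order_trans[OF keys_frag_extend], rule UN_least)
  fix b assume "b \<in> keys z"
  then have "b \<in> S.cells (n + 1) k" using assms by blast
  then obtain x S where "b = (x, S)" "x \<in> X_points (n + 1)" "S \<in> cliques k"
    by (rule cellsE)
  then show "keys (case b of (x, S) \<Rightarrow> case x of Elt 0 \<Rightarrow> 0 | Elt (Suc i) \<Rightarrow> frag_of (Elt i, S)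
     | Base \<Rightarrow> frag_of (Base, S)) \<subseteq> S.cells n k"
    by (auto simp: cells_iff points_X_set split: xpoint.split nat.split)
qed

lemma keys_first_part:
  assumes "keys z \<subseteq> S.cells n k"
  shows "keys (first_part z) \<subseteq> cliques k"
  unfolding first_part_def
proof (rule order_trans[OF keys_frag_extend], rule UN_least)
  fix b assume "b \<in> keys z"
  then have "b \<in> S.cells n k" using assms by blast
  then obtain x S where "b = (x, S)" "S \<in> cliques k" by (rule cellsE)
  then show "keys (case b of (x, S) \<Rightarrow> if x = Elt 0 then frag_of S else 0) \<subseteq> cliques k" by auto
qed

lemma keys_at_point:
  assumes "keys c \<subseteq> cliques k" "x \<in> X_points n"
  shows "keys (at_point x c) \<subseteq> S.cells n k"
  unfolding at_point_def
  by (rule order_trans[OF keys_frag_extend]) (use assms in \<open>auto simp: cells_iff\<close>)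

text \<open>The points other than \<open>Elt 0\<close> form a pointed subset isomorphic to the
  smaller point set, since shifting commutes with every step; the last point is sent to
  \<open>Base\<close> on both sides.\<close>

lemma boundary_shift_chain:
  assumes "keys z \<subseteq> S.cells n k"
  shows "S.cell_boundary (n + 1) (shift_chain z) = shift_chain (S.cell_boundary n z)"
proof (rule frag_additive_eqI[OF assms, of "\<lambda>z. S.cell_boundary (n + 1) (shift_chain z)"])
  fix b assume "b \<in> S.cells n k"
  then obtain x S where b: "b = (x, S)" "S \<subseteq> E" by (rule cellsE)
  have "X_step (n + 1) (shift x) e = shift (X_step n x e)" for e :: 'e by (cases x) auto
  then show "S.cell_boundary (n + 1) (shift_chain (frag_of b)) = shift_chain (S.cell_boundary n (frag_of b))"
    using b(2) by (simp add: b(1) cell_boundary_cell)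
qed simp_all

text \<open>No letter leads to \<open>Elt 0\<close>, so front faces contribute nothing there and
  only the back faces, with their minus sign, survive.\<close>

lemma first_part_boundary:
  assumes "keys z \<subseteq> S.cells n k"
  shows "first_part (S.cell_boundary n z) = - simplex_boundary r (first_part z)"
proof (rule frag_additive_eqI[OF assms, of "\<lambda>z. first_part (S.cell_boundary n z)"])
  fix b assume "b \<in> S.cells n k"
  then obtain x S where b: "b = (x, S)" "S \<subseteq> E" by (rule cellsE)
  have "X_step n x e \<noteq> Elt 0" for e :: 'e by (cases x) auto
  then show "first_part (S.cell_boundary n (frag_of b)) = - simplex_boundary r (first_part (frag_of b))"
    using b(2) by (simp add: b(1) cell_boundary_cell simplex_boundary_incidence frag_cmul_minus flip: sum_negf)
qed simp_all

lemma boundary_at_point: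
  assumes "keys c \<subseteq> cliques k" and x: "\<And>e. e \<in> E \<Longrightarrow> X_step n x e = y"
  shows "S.cell_boundary n (at_point x c) = at_point y (simplex_boundary r c) - at_point x (simplex_boundary r c)"
proof (rule frag_additive_eqI[OF assms(1), of "\<lambda>c. S.cell_boundary n (at_point x c)"])
  fix S assume "S \<in> cliques k"
  then have S: "S \<subseteq> E" by (simp add: cliques_def)
  have "S.cell_boundary n (frag_of (x, S)) =
      (\<Sum>e\<in>S. frag_cmul (incidence r S e) (frag_of (y, S - {e}) - frag_of (x, S - {e})))"
    unfolding cell_boundary_cell[OF S] by (rule sum.cong) (use S x in auto)
  then show "S.cell_boundary n (at_point x (frag_of S)) =
      at_point y (simplex_boundary r (frag_of S)) - at_point x (simplex_boundary r (frag_of S))"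
    by (simp add: simplex_boundary_incidence frag_cmul_diff sum_subtractf)
qed simp_all

text \<open>Every point moves on to the next one under every letter, so the boundary telescopes.\<close>

definition sweep :: "nat \<Rightarrow> ('e set \<Rightarrow>\<^sub>0 int) \<Rightarrow> (xpoint \<times> 'e set \<Rightarrow>\<^sub>0 int)" where
  "sweep N c = (\<Sum>i\<le>N. at_point (Elt i) c)"

text \<open>The lift of clique chains. The term at \<open>Base\<close> is what lets the telescoping
  boundary of \<open>sweep\<close> hit the lift of a clique boundary exactly.\<close>

definition reduced_first :: "('e set \<Rightarrow>\<^sub>0 int) \<Rightarrow> (xpoint \<times> 'e set \<Rightarrow>\<^sub>0 int)" where
  "reduced_first c = at_point (Elt 0) c - at_point Base c"

lemma boundary_sweep:
  assumes c: "keys c \<subseteq> cliques k"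
  shows "S.cell_boundary (int N) (sweep N c) = - reduced_first (simplex_boundary r c)"
proof -
  let ?c = "simplex_boundary r c"
  have "(\<Sum>i\<le>j. S.cell_boundary (int N) (at_point (Elt i) c)) =
      at_point (if j < N then Elt (Suc j) else Base) ?c - at_point (Elt 0) ?c" if "j \<le> N" for j
    using that
  proof (induction j)
    case 0
    show ?case by (simp add: boundary_at_point[OF c, of "int N" "Elt 0" "if 0 < N then Elt (Suc 0) else Base"])
  next
    case (Suc j)
    then show ?case
      by (simp add: boundary_at_point[OF c, of "int N" "Elt (Suc j)" "if Suc j < N then Elt (Suc (Suc j)) else Base"])
  qed
  from this[of N] show ?thesis by (simp add: sweep_def reduced_first_def)
qed

lemma keys_sweep:
  "keys c \<subseteq> cliques k \<Longrightarrow> keys (sweep N c) \<subseteq> S.cells (int N) k"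
  unfolding sweep_def
  by (intro order_trans[OF keys_sum] UN_least keys_at_point) (auto simp: points_X_set)

lemma first_part_sweep: "first_part (sweep N c) = c"
  by (simp add: sweep_def)

abbreviation cell_cycles :: "int \<Rightarrow> nat \<Rightarrow> (xpoint \<times> 'e set \<Rightarrow>\<^sub>0 int) monoid" where
  "cell_cycles m \<equiv> cycle_group (S.cell_cx m) (\<lambda>_. S.cell_boundary m)"

abbreviation clique_cycles :: "nat \<Rightarrow> ('e set \<Rightarrow>\<^sub>0 int) monoid" where
  "clique_cycles \<equiv> cycle_group clique_cx (\<lambda>_. simplex_boundary r)"

text \<open>The isomorphism and all preimages are written down explicitly, in place of a long exact
  sequence and a section. Every cycle for \<open>m + 1\<close> turns out to be equal to a value of
  the map, not merely homologous to one.\<close>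

lemma chain_homology_split:
  assumes "m \<ge> - 1"
  shows "chain_homology (S.cell_cx m) (\<lambda>_. S.cell_boundary m) (Suc k) \<times>\<times>
      chain_homology clique_cx (\<lambda>_. simplex_boundary r) (Suc k) \<cong>
    chain_homology (S.cell_cx (m + 1)) (\<lambda>_. S.cell_boundary (m + 1)) (Suc k)"
proof (rule chain_homology_DirProd_isoI[where f = "\<lambda>(z, c). shift_chain z + reduced_first c",
      OF S.chain_complex_cells chain_complex_cliques S.chain_complex_cells])
  \<comment> \<open>The index of the last point of \<open>X_set (m + 1)\<close>, a natural number
    because m is at least -1; \<open>sweep N\<close> thus runs over all points except
    \<open>Base\<close>.\<close>
  define N where "N = nat (m + 1)"
  have N: "m + 1 = int N" using assms by (simp add: N_def)
  have pts: "Elt 0 \<in> X_points (m + 1)"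
    "Base \<in> X_points n" for n
    using assms by (auto simp: points_X_set)
  have keys_rf: "keys (reduced_first c) \<subseteq> S.cells (m + 1) n" if "keys c \<subseteq> cliques n" for c n
    unfolding reduced_first_def
    by (rule order_trans[OF keys_diff Un_least[OF keys_at_point[OF that pts(1)] keys_at_point[OF that pts(2)]]])
  have bd_rf: "S.cell_boundary (m + 1) (reduced_first c) = 0"
    if c: "keys c \<subseteq> cliques n" and "simplex_boundary r c = 0" for c n
    using boundary_at_point[OF c, of "m + 1" "Elt 0" "if 0 < N then Elt (Suc 0) else Base"]
      boundary_at_point[OF c, of "m + 1" Base Base] that(2) by (simp add: reduced_first_def N)
  {
    show "(\<lambda>(z, c). shift_chain z + reduced_first c) \<in> hom
      (cell_cycles m k \<times>\<times> clique_cycles k) (cell_cycles (m + 1) k)"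
    proof (rule homI; clarify)
      fix z c
      assume "(z, c) \<in> carrier (cell_cycles m k \<times>\<times> clique_cycles k)"
      then have z: "keys z \<subseteq> S.cells m (Suc k)" "S.cell_boundary m z = 0"
        and c: "keys c \<subseteq> cliques (Suc k)" "simplex_boundary r c = 0"
        by (auto simp: carrier_cycle_group)
      show "shift_chain z + reduced_first c \<in>
          carrier (cell_cycles (m + 1) k)"
        using keys_add[of "shift_chain z" "reduced_first c"] keys_shift_chain[OF z(1)] keys_rf[OF c(1)]
          boundary_shift_chain[OF z(1)] z(2) bd_rf[OF c]
        by (auto simp: carrier_cycle_group)
    qed (simp add: reduced_first_def)
  next
    fix z c assume "z \<in> carrier (S.cell_cx m (Suc (Suc k)))"
      and "c \<in> carrier (clique_cx (Suc (Suc k)))"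
    then have z: "keys z \<subseteq> S.cells m (Suc (Suc k))" and c: "keys c \<subseteq> cliques (Suc (Suc k))"
      by simp_all
    \<comment> \<open>The lift of a clique boundary is itself a boundary, bounded by the negative
      sweep.\<close>
    have "S.cell_boundary (m + 1) (sweep N c) = - reduced_first (simplex_boundary r c)"
      unfolding N by (rule boundary_sweep[OF c])
    then have "shift_chain (S.cell_boundary m z) + reduced_first (simplex_boundary r c) =
        S.cell_boundary (m + 1) (shift_chain z - sweep N c)"
      by (simp add: boundary_shift_chain[OF z])
    moreover have "keys (shift_chain z - sweep N c) \<subseteq> S.cells (m + 1) (Suc (Suc k))"
      using keys_diff[of "shift_chain z" "sweep N c"] keys_shift_chain[OF z] keys_sweep[OF c, of N]
      by (auto simp: N)
    ultimately show "(case (S.cell_boundary m z, simplex_boundary r c) of (z, c) \<Rightarrow> shift_chain z + reduced_first c)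
        \<in> S.cell_boundary (m + 1) ` carrier (S.cell_cx (m + 1) (Suc (Suc k)))"
      by (intro image_eqI[of _ _ "shift_chain z - sweep N c"]) simp_all
  next
    fix z c w
    assume "z \<in> carrier (cell_cycles m k)"
      and "c \<in> carrier (clique_cycles k)"
      and "w \<in> carrier (S.cell_cx (m + 1) (Suc (Suc k)))"
      and "(case (z, c) of (z, c) \<Rightarrow> shift_chain z + reduced_first c) = S.cell_boundary (m + 1) w"
    then have z: "keys z \<subseteq> S.cells m (Suc k)" and c: "keys c \<subseteq> cliques (Suc k)"
      and w: "keys w \<subseteq> S.cells (m + 1) (Suc (Suc k))"
      and eq: "S.cell_boundary (m + 1) w = shift_chain z + reduced_first c"
      by (auto simp: carrier_cycle_group)
    define b where "b = first_part w"
    have b: "keys b \<subseteq> cliques (Suc (Suc k))" unfolding b_def by (rule keys_first_part[OF w])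
    \<comment> \<open>This is the equation \<open>eq\<close> read off at \<open>Elt 0\<close>, where
      shifted chains have no cells.\<close>
    have cb: "c = simplex_boundary r (- b)"
      using first_part_boundary[OF w] eq by (simp add: b_def reduced_first_def)
    \<comment> \<open>The sweep has the same cells at \<open>Elt 0\<close> as \<open>w\<close>, so
      \<open>v\<close> is a shifted chain; its boundary cancels the term
      \<open>reduced_first c\<close>, as \<open>c\<close> is minus the boundary of
      \<open>b\<close>.\<close>
    define v where "v = w - sweep N b"
    have v: "keys v \<subseteq> S.cells (m + 1) (Suc (Suc k))"
      unfolding v_def using keys_diff[of w "sweep N b"] w keys_sweep[OF b, of N] by (auto simp: N)
    have "first_part v = 0" by (simp add: v_def b_def first_part_sweep)
    then have vs: "shift_chain (unshift_chain v) = v" using shift_unshift_chain[of v] by simp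
    have uv: "keys (unshift_chain v) \<subseteq> S.cells m (Suc (Suc k))" by (rule keys_unshift_chain[OF v])
    have "S.cell_boundary (m + 1) v = shift_chain z"
      using boundary_sweep[OF b, of N] eq cb by (simp add: v_def N reduced_first_def)
    then have "shift_chain (S.cell_boundary m (unshift_chain v)) = shift_chain z"
      using boundary_shift_chain[OF uv] by (simp add: vs)
    then have "S.cell_boundary m (unshift_chain v) = z" by (metis unshift_shift_chain)
    then show "z \<in> S.cell_boundary m ` carrier (S.cell_cx m (Suc (Suc k))) \<and>
        c \<in> simplex_boundary r ` carrier (clique_cx (Suc (Suc k)))"
      using uv b cb by (auto intro!: image_eqI[of _ _ "- b"])
  next
    fix z assume "z \<in> carrier (cell_cycles (m + 1) k)"
    then have z: "keys z \<subseteq> S.cells (m + 1) (Suc k)" "S.cell_boundary (m + 1) z = 0"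
      by (auto simp: carrier_cycle_group)
    define c where "c = first_part z"
    have c: "keys c \<subseteq> cliques (Suc k)" unfolding c_def by (rule keys_first_part[OF z(1)])
    have dc: "simplex_boundary r c = 0" using first_part_boundary[OF z(1)] z(2) by (simp add: c_def)
    \<comment> \<open>The added term makes up for the one that \<open>reduced_first c\<close>
      subtracts at \<open>Base\<close>, a point fixed by the shift.\<close>
    define y where "y = unshift_chain z + at_point Base c"
    have y: "keys y \<subseteq> S.cells m (Suc k)"
      unfolding y_def using keys_add[of "unshift_chain z" "at_point Base c"] keys_unshift_chain[OF z(1)]
        keys_at_point[OF c pts(2), of m] by blast
    have zy: "z = shift_chain y + reduced_first c"
      using shift_unshift_chain[of z] by (simp add: y_def reduced_first_def c_def algebra_simps)
    have "shift_chain (S.cell_boundary m y) = 0"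
      using z(2) bd_rf[OF c dc] boundary_shift_chain[OF y] by (simp add: zy)
    then have "S.cell_boundary m y = 0" by (metis unshift_shift_chain splitting_maps_simps(6))
    then show "\<exists>y\<in>carrier (cell_cycles m k).
        \<exists>c\<in>carrier (clique_cycles k).
          z = (case (y, c) of (z, c) \<Rightarrow> shift_chain z + reduced_first c)"
      using y c dc zy by (auto simp: carrier_cycle_group)
  }
qed

lemma rset_homology_split:
  assumes "m \<ge> - 1"
  shows "rset_homology M (X_set (m + 1)) (Suc k) \<cong>
    rset_homology M (X_set m) (Suc k) \<times>\<times> reduced_simplicial_homology r (commuting_simplices E I) k"
proof -
  let ?H = "\<lambda>m. chain_homology (S.cell_cx m) (\<lambda>_. S.cell_boundary m) (Suc k)"
  let ?K = "chain_homology clique_cx (\<lambda>_. simplex_boundary r) (Suc k)"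
  let ?R = "\<lambda>m. rset_homology M (X_set m) (Suc k)"
  have gH: "group (?H n)" for n
    using comm_group_chain_homology[OF S.chain_complex_cells] by (simp add: comm_group_def del: chain_homology.simps)
  have gR: "group (?R n)" for n using S.comm_group_rset_homology by (simp add: comm_group_def)
  have gK: "group ?K"
    using comm_group_chain_homology[OF chain_complex_cliques] by (simp add: comm_group_def del: chain_homology.simps)
  have "?R (m + 1) \<cong> ?H (m + 1)" by (rule S.rset_homology_cells)
  also have "?H (m + 1) \<cong> ?H m \<times>\<times> ?K"
    by (rule group.iso_sym[OF DirProd_group[OF gH gK] chain_homology_split[OF assms]])
  also have "?R m \<times>\<times> ?K \<cong> ?H m \<times>\<times> ?K"
    by (rule group.DirProd_iso_trans[OF gR S.rset_homology_cells iso_refl])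
  then have "?H m \<times>\<times> ?K \<cong> ?R m \<times>\<times> ?K"
    by (rule group.iso_sym[OF DirProd_group[OF gR gK]])
  finally show ?thesis by (simp only: reduced_simplicial_homology_cliques)
qed

end

theorem theorem1p1:
  fixes E :: "'e set" and I r :: "('e \<times> 'e) set" and m :: int and k :: nat
  assumes "I \<subseteq> E \<times> E" and "irrefl I" and "sym I"
    and "linear_order_on E r"
    and "m \<ge> -1" and "k \<ge> 1"
  shows "rset_homology (trace_monoid E I) (X_set (m + 1)) k
           \<cong> rset_homology (trace_monoid E I) (X_set m) k
              \<times>\<times> reduced_simplicial_homology r (commuting_simplices E I) (k - 1)
         \<and> (k \<ge> 2 \<longrightarrow>
             rset_homology (trace_monoid E I) (X_set (m + 1)) k
               \<cong> rset_homology (trace_monoid E I) (X_set m) k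
                  \<times>\<times> simplicial_homology r (commuting_simplices E I) (k - 1))"
proof -
  interpret ordered_commutation E I r
    by unfold_locales (use assms in auto)
  obtain j where j: "k = Suc j" using assms(6) by (cases k) auto
  have split: "rset_homology M (X_set (m + 1)) (Suc j) \<cong>
      rset_homology M (X_set m) (Suc j) \<times>\<times> reduced_simplicial_homology r (commuting_simplices E I) j"
    by (rule rset_homology_split[OF assms(5)])
  show ?thesis
  proof (intro conjI impI)
    \<comment> \<open>Here \<open>k - 1\<close> is a successor, where reduced and ordinary
      simplicial homology agree by definition.\<close>
    assume "k \<ge> 2"
    then obtain i where "j = Suc i" using j by (cases j) auto
    then show "rset_homology M (X_set (m + 1)) k \<cong>
        rset_homology M (X_set m) k \<times>\<times> simplicial_homology r (commuting_simplices E I) (k - 1)"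
      using split by (simp add: j)
  qed (use split in \<open>simp add: j\<close>)
qed

end
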